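(* Let $d \ge 2$, let $K$ be a subfield of $\mathbb{R}$, and let $\alpha =(\alpha_1,\dots,\alpha_d)\in K^d$ with $\alpha_d=1$. Suppose that for any linearly independent linear forms $L_1, \dots, L_{d-1}$ of $d-1$ variables with coefficients in $K$ there exists a constant $\gamma <1$ such that the inequality \[ \left\| \alpha_1 n_1 + \cdots + \alpha_{d-1} n_{d-1} \right\| \cdot \prod_{k=1}^{d-1} \left( |L_k (n)| +1 \right) < |n|^{-\gamma} \] has only finitely many integral solutions $n \in \mathbb{Z}^{d-1}$. Let $P \subseteq [0,1]^d$ be a polytope with nonempty interior, and suppose that every facet of $P$ has a normal vector $\nu$ with coordinates in $K$ and $\langle \nu, \alpha \rangle \neq 0$. Then there exists a constant $C>0$, depending only on $\alpha$ and the normal vectors of the facets of $P$, such that for every starting point $s \in [0,1]^d$ and every $T>0$, \[ |\Delta_T (s, \alpha, P)| \le C. \]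
   Context: $\|x\|$ denotes the distance from $x\in\mathbb{R}$ to the nearest integer, $|n|$ is the Euclidean norm, and $\{x\}$ the fractional part of $x$. For $s \in [0,1]^d$, $\alpha \in \mathbb{R}^d$, a set $A \subseteq [0,1]^d$ with characteristic function $\chi_A$, and $T>0$, \[ \Delta_T (s, \alpha, A)=\int_0^T \chi_A(\{ s_1+t\alpha_1 \}, \dots, \{ s_d+t\alpha_d \}) \, \mathrm{d}t - T \lambda(A), \] where $\lambda$ is Lebesgue measure. A polytope is the convex hull of finitely many points; its facets are its $(d-1)$-dimensional faces, and a normal vector of a facet is any nonzero vector orthogonal to it (not necessarily of unit length). *)

theory Defs
  imports "HOL-Analysis.Analysis"
begin

text \<open>
  The space \<open>\<real>\<^sup>d\<close> with \<open>d \<ge> 2\<close> is rendered as \<open>real^('m option)\<close>, where \<open>'m\<close> is an arbitrary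
  finite (and nonempty) type with \<open>d - 1\<close> elements: the coordinates \<open>1, \<dots>, d - 1\<close> are those of the
  form \<open>Some i\<close>, and the last coordinate is \<open>None\<close>. Hence \<open>real^'m\<close> is \<open>\<real>\<^sup>d\<^sup>-\<^sup>1\<close>.
\<close>

definition real_subfield :: "real set \<Rightarrow> bool" where
  "real_subfield K \<longleftrightarrow> 0 \<in> K \<and> 1 \<in> K \<and>
     (\<forall>x\<in>K. \<forall>y\<in>K. x + y \<in> K \<and> x * y \<in> K) \<and> (\<forall>x\<in>K. - x \<in> K \<and> inverse x \<in> K)"

definition dist_to_int :: "real \<Rightarrow> real" where
  "dist_to_int x = \<bar>x - of_int (round x)\<bar>"

text \<open>
  A linear form on \<open>\<real>\<^sup>d\<^sup>-\<^sup>1\<close> is given by its coefficient vector, and a list of \<open>d - 1\<close> forms by a family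
  indexed by \<open>'m\<close>; injectivity makes independence of the range independence of the family.
  The point \<open>n = 0\<close>, where \<open>norm n powr - \<gamma>\<close> is \<open>0\<close>, does not affect finiteness.
\<close>

definition diophantine_over :: "real set \<Rightarrow> real^('m::finite option) \<Rightarrow> bool" where
  "diophantine_over K \<alpha> \<longleftrightarrow>
     (\<forall>L :: 'm \<Rightarrow> real^'m.
        (\<forall>k i. L k $ i \<in> K) \<and> inj L \<and> independent (range L) \<longrightarrow>
        (\<exists>\<gamma><1. finite {n :: real^'m. (\<forall>i. n $ i \<in> \<int>) \<and>
            dist_to_int (\<Sum>i\<in>UNIV. \<alpha> $ Some i * n $ i) * (\<Prod>k\<in>UNIV. \<bar>L k \<bullet> n\<bar> + 1)
              < norm n powr (- \<gamma>)}))"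

definition discrepancy :: "real \<Rightarrow> real^'n \<Rightarrow> real^'n \<Rightarrow> (real^'n) set \<Rightarrow> real" where
  "discrepancy T s \<alpha> A =
     (LINT t:{0..T}|lebesgue. indicat_real A (\<chi> i. frac (s $ i + t * \<alpha> $ i))) - T * measure lebesgue A"

text \<open>Orthogonality to a facet means orthogonality to its directions (differences of its points).\<close>

definition normal_to :: "'a::real_inner \<Rightarrow> 'a set \<Rightarrow> bool" where
  "normal_to \<nu> F \<longleftrightarrow> \<nu> \<noteq> 0 \<and> (\<forall>x\<in>F. \<forall>y\<in>F. orthogonal \<nu> (x - y))"

definition facet_normals :: "'a::euclidean_space set \<Rightarrow> 'a set" where
  "facet_normals P = {\<nu>. \<exists>F. F facet_of P \<and> normal_to \<nu> F}"

end

theory Submission imports Defs begin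

text \<open>
  As a function of the starting point, the discrepancy is a continuous function on the torus
  whose Fourier coefficients are those of \<open>P\<close> times factors of modulus at most \<open>1 / \<bar>n \<bullet> \<alpha>\<bar>\<close>, so it is
  bounded by the sum of the moduli of its coefficients.

  The Fourier transform of \<open>P\<close> is estimated without surface measures. If \<open>n \<bullet> u = 1 / 2\<close>, shifting by
  \<open>u\<close> changes the sign of the transform, so the transform of a set \<open>S\<close> is controlled by those of
  \<open>S - (S + u)\<close> and \<open>S - (S - u)\<close>. For an intersection of strips these differences split into
  intersections of strips with the same normals, one of the strips having become thin. Iterating
  with shifts in directions orthogonal to the normals already used, until the set is thin in \<open>d\<close>
  independent directions, gives
  \<open>\<bar>ft P n\<bar> \<le> C / norm n * (\<Sum>V. \<Prod>v\<in>V. 1 / (1 + \<bar>v \<bullet> n\<bar>))\<close> over finitely many independent sets \<open>V\<close> of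
  \<open>d - 1\<close> vectors over \<open>K\<close>, each orthogonal to some facet normal; these depend on the normals only.

  Restricted to the hyperplane \<open>n \<bullet> \<alpha> = 0\<close>, the forms in \<open>V\<close> are \<open>d - 1\<close> independent forms in \<open>d - 1\<close>
  variables, because \<open>\<alpha>\<close> is transversal to the facets. In a box where \<open>norm n\<close> and all
  \<open>1 + \<bar>v \<bullet> n\<bar>\<close> are fixed up to a factor of 2, the hypothesis applied to differences shows that the
  numbers \<open>n \<bullet> \<alpha>\<close> are separated. Hence \<open>1 / \<bar>n \<bullet> \<alpha>\<bar>\<close> sums over the box to little more than its
  largest term, and the sum over all boxes converges since \<open>\<gamma> < 1\<close>.
\<close>

section \<open>Cutting a polytope along shifted strips\<close>

text \<open>The divergence theorem would need an induction over the faces of \<open>P\<close>. It is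
  replaced by a class of sets stable under differences of translates: intersections of strips with
  normals from one fixed finite set and arbitrary intervals. Constants and families \<open>V\<close>
  are chosen before the intervals, so they cannot depend on the position of the facets.

  One of the \<open>d\<close> shifts is made along \<open>n\<close> itself. It needs no vector over
  \<open>K\<close>, it yields the factor \<open>1 / norm n\<close>, and it makes a first strip thin,
  with some normal \<open>a\<close>. The other shifts are orthogonal to \<open>a\<close>; this
  leaves exactly the \<open>d - 1\<close> forms that the hypothesis admits.

  The same product of forms occurs in the decay of the transform and in the lower bound for
  \<open>\<bar>n \<bullet> \<alpha>\<bar>\<close>, so it cancels: a box with \<open>norm n\<close>
  near \<open>2 ^ k\<close> contributes \<open>2 powr ((\<gamma> - 1) * k)\<close> up to a power of
  \<open>k\<close>, and the number of boxes is polynomial in \<open>k\<close>.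

  Transversality is used once more: an orbit meets the boundary at countably many times only, so the
  discrepancy is continuous in the starting point.\<close>

definition expi :: "'a::euclidean_space \<Rightarrow> 'a \<Rightarrow> complex" where
  "expi n x = cis (2 * pi * (n \<bullet> x))"

lemma norm_expi [simp]: "cmod (expi n x) = 1"
  by (simp add: expi_def)

lemma expi_add: "expi n (x + y) = expi n x * expi n y"
  by (simp add: expi_def inner_add_right cis_mult distrib_left)

lemma expi_add_left: "expi (m + n) x = expi m x * expi n x"
  by (simp add: expi_def inner_add_left cis_mult distrib_left)

lemma expi_zero [simp]: "expi 0 x = 1" "expi n 0 = 1"
  by (simp_all add: expi_def)

lemma continuous_on_expi [continuous_intros]:
  "continuous_on A f \<Longrightarrow> continuous_on A (\<lambda>x. expi n (f x))"
  unfolding expi_def cis_conv_exp by (intro continuous_intros)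

lemma measurable_expi [measurable]: "expi n \<in> borel_measurable borel"
  by (intro borel_measurable_continuous_onI continuous_intros)

definition ft :: "'a::euclidean_space set \<Rightarrow> 'a \<Rightarrow> complex" where
  "ft S n = (LINT x:S|lborel. expi n x)"

lemma set_integrable_expi:
  assumes "S \<in> sets borel" "bounded S"
  shows "set_integrable lborel S (expi n)"
proof -
  obtain a b where "S \<subseteq> cbox a b" using assms(2) bounded_subset_cbox_symmetric by blast
  moreover have "set_integrable lborel (cbox a b) (expi n)"
    unfolding set_integrable_def
    by (rule borel_integrable_compact) (auto intro!: continuous_intros)
  ultimately show ?thesis using assms(1) by (auto intro: set_integrable_subset)
qed

lemma ft_Un:
  assumes "S \<in> sets borel" "bounded S" "T \<in> sets borel" "bounded T" "S \<inter> T = {}"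
  shows "ft (S \<union> T) n = ft S n + ft T n"
  unfolding ft_def using assms by (intro set_integral_Un set_integrable_expi)

lemma shift_image_eq_vimage: "(+) c ` S = (\<lambda>x. x - c) -` (S :: 'a::euclidean_space set)"
  by (auto simp: image_iff intro!: bexI[of _ "_ - c"])

lemma shift_image_borel:
  fixes S :: "'a::euclidean_space set"
  assumes "S \<in> sets borel" shows "(+) c ` S \<in> sets borel"
  unfolding shift_image_eq_vimage
  using assms by (auto intro!: measurable_sets_borel[of "\<lambda>x. x - c"])

lemma ft_translate:
  assumes S[measurable]: "S \<in> sets borel"
  shows "ft ((+) c ` S) n = expi n c * ft S n"
proof -
  have [measurable]: "(+) c ` S \<in> sets borel" by (rule shift_image_borel[OF S])
  have "ft ((+) c ` S) n = (LINT x|distr lborel borel ((+) c). indicator ((+) c ` S) x *\<^sub>R expi n x)"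
    unfolding ft_def set_lebesgue_integral_def lborel_distr_plus ..
  also have "\<dots> = (LINT x|lborel. indicator ((+) c ` S) (c + x) *\<^sub>R expi n (c + x))"
    by (rule integral_distr) simp_all
  also have "\<dots> = (LINT x|lborel. expi n c * (indicator S x *\<^sub>R expi n x))"
    by (rule Bochner_Integration.integral_cong) (auto simp: expi_add indicator_def)
  also have "\<dots> = expi n c * ft S n"
    unfolding ft_def set_lebesgue_integral_def by (rule integral_mult_right_zero)
  finally show ?thesis .
qed

text \<open>If \<open>expi n u = -1\<close>, the translate \<open>S + u\<close> has the transform of
  \<open>S\<close> with opposite sign. Subtracting removes the common part and leaves twice the
  transform of \<open>S\<close> on one side, the two set differences on the other. The second
  disjunct serves shifts that move \<open>S\<close> off itself: then the first piece is all of
  \<open>S\<close>.\<close>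

lemma ft_le_shift:
  assumes S: "S \<in> sets borel" "bounded S"
      and u: "n \<bullet> u = 1 / 2 \<or> (\<forall>x\<in>S. x - u \<notin> S)"
  shows "cmod (ft S n) \<le> cmod (ft {x\<in>S. x - u \<notin> S} n) + cmod (ft {x\<in>S. x + u \<notin> S} n)"
proof (cases "\<forall>x\<in>S. x - u \<notin> S")
  case True
  then have "{x\<in>S. x - u \<notin> S} = S" by auto
  then show ?thesis by simp
next
  case False
  then have nu: "n \<bullet> u = 1/2" using u by auto
  let ?T = "(+) u ` S"
  have T: "?T \<in> sets borel" by (rule shift_image_borel[OF S(1)])
  have bT: "bounded ?T" using S(2) by (rule bounded_translation)
  have A: "{x\<in>S. x - u \<notin> S} = S - ?T" unfolding shift_image_eq_vimage by auto
  have B: "(+) u ` {x\<in>S. x + u \<notin> S} = ?T - S" by (auto simp: image_iff algebra_simps)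
  have 1: "ft S n = ft (S - ?T) n + ft (S \<inter> ?T) n"
    by (subst ft_Un[symmetric]) (use S T bT in \<open>auto intro: arg_cong[where f = "\<lambda>S. ft S n"] bounded_subset\<close>)
  have 2: "ft ?T n = ft (?T - S) n + ft (S \<inter> ?T) n"
    by (subst ft_Un[symmetric]) (use S T bT in \<open>auto intro: arg_cong[where f = "\<lambda>S. ft S n"] bounded_subset\<close>)
  have "2 * pi * (n \<bullet> u) = pi" using nu by simp
  then have "expi n u = -1" by (simp only: expi_def cis_pi)
  then have 3: "ft ?T n = - ft S n" by (simp add: ft_translate[OF S(1)])
  \<comment> \<open>\<open>?T - S\<close> is the translate by \<open>u\<close> of the points that
    leave \<open>S\<close> under \<open>+ u\<close>, and a translation changes only the
    phase.\<close>
  have 4: "cmod (ft (?T - S) n) = cmod (ft {x\<in>S. x + u \<notin> S} n)"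
  proof -
    have eq: "{x\<in>S. x + u \<notin> S} = S - (+) (- u) ` S"
      unfolding shift_image_eq_vimage by auto
    have "{x\<in>S. x + u \<notin> S} \<in> sets borel"
      unfolding eq by (rule sets.Diff[OF S(1) shift_image_borel[OF S(1)]])
    then show ?thesis unfolding B[symmetric] by (simp add: ft_translate norm_mult)
  qed
  have "2 * ft S n = ft (S - ?T) n - ft (?T - S) n"
    using 1 2 3 by (simp add: algebra_simps)
  then have "2 * cmod (ft S n) \<le> cmod (ft (S - ?T) n) + cmod (ft (?T - S) n)"
    by (metis norm_mult norm_numeral norm_triangle_ineq4)
  then have "cmod (ft S n) \<le> cmod (ft (S - ?T) n) + cmod (ft (?T - S) n)"
    using norm_ge_zero[of "ft S n"] by linarith
  then show ?thesis unfolding A 4 .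
qed

text \<open>The sets \<open>I a\<close> will be intervals of any kind, open, closed, half-open or
  empty: this class is stable under \<open>shift_diff\<close>, so endpoints never have to be
  discussed.\<close>

definition strips :: "'a::euclidean_space set \<Rightarrow> ('a \<Rightarrow> real set) \<Rightarrow> 'a set" where
  "strips A I = {x. \<forall>a\<in>A. a \<bullet> x \<in> I a}"

lemma strips_borel:
  assumes "finite A" "\<And>a. a \<in> A \<Longrightarrow> is_interval (I a)"
  shows "strips A I \<in> sets borel"
proof -
  have "strips A I = (\<Inter>a\<in>A. (\<lambda>x. a \<bullet> x) -` I a)" by (auto simp: strips_def)
  moreover have "(\<lambda>x. a \<bullet> x) -` I a \<in> sets borel" if "a \<in> A" for a
    using real_interval_borel_measurable[OF assms(2)[OF that]]
    by (intro measurable_sets_borel[of _ borel]) auto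
  ultimately show ?thesis using assms(1)
    by (cases "A = {}") auto
qed

abbreviation shift_diff :: "real set \<Rightarrow> real \<Rightarrow> real set" where
  "shift_diff I c \<equiv> {r\<in>I. r - c \<notin> I}"

lemma is_interval_shift_Int:
  fixes I :: "real set"
  assumes "is_interval I" shows "is_interval {r\<in>I. r - c \<in> I}"
  using assms unfolding is_interval_1
  by simp (meson diff_right_mono)

text \<open>What the translate by \<open>c\<close> leaves uncovered is one piece, at the lower end
  of \<open>I\<close> if \<open>c \<ge> 0\<close> and at the upper end otherwise.\<close>

lemma is_interval_shift_diff:
  fixes I :: "real set"
  assumes "is_interval I" shows "is_interval (shift_diff I c)"
  unfolding is_interval_1
proof (intro ballI allI impI, elim conjE)
  fix x y z
  assume x: "x \<in> shift_diff I c" and y: "y \<in> shift_diff I c" and z: "x \<le> z" "z \<le> y"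
  have mem: "r \<in> I" if "p \<in> I" "q \<in> I" "p \<le> r" "r \<le> q" for p q r
    using that assms unfolding is_interval_1 by blast
  have "z \<in> I" using mem[of x y z] x y z by auto
  moreover have "z - c \<notin> I"
  proof
    assume zc: "z - c \<in> I"
    show False
    proof (cases "c \<ge> 0")
      case True
      have "y - c \<in> I" using mem[of "z - c" y "y - c"] zc y z True by auto
      then show False using y by auto
    next
      case False
      have "x - c \<in> I" using mem[of x "z - c" "x - c"] zc x z False by auto
      then show False using x by auto
    qed
  qed
  ultimately show "z \<in> shift_diff I c" by simp
qed

lemma shift_diff_width:
  fixes I :: "real set"
  assumes "is_interval I" "x \<in> shift_diff I c" "y \<in> shift_diff I c"
  shows "\<bar>x - y\<bar> \<le> \<bar>c\<bar>"
proof -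
  have mem: "r \<in> I" if "p \<in> I" "q \<in> I" "p \<le> r" "r \<le> q" for p q r
    using that assms unfolding is_interval_1 by blast
  have *: "y - x \<le> \<bar>c\<bar>" if "x \<in> shift_diff I c" "y \<in> shift_diff I c" for x y
  proof (rule ccontr)
    assume "\<not> y - x \<le> \<bar>c\<bar>"
    then show False
      using mem[of x y "y - c"] mem[of x y "x - c"] that by (cases "c \<ge> 0") auto
  qed
  show ?thesis using *[OF assms(2,3)] *[OF assms(3,2)] by linarith
qed

text \<open>The pieces are indexed by the first strip which the point \<open>x - u\<close> leaves.\<close>

lemma ft_leaving_le:
  assumes "finite A'" "A' \<subseteq> A" "finite A"
    and "\<And>a. a \<in> A \<Longrightarrow> is_interval (I a)" "bounded (strips A I)"
    and "\<And>a J. a \<in> A' \<Longrightarrow> (\<And>b. b \<in> A \<Longrightarrow> is_interval (J b)) \<Longrightarrow> (\<And>b. b \<in> A \<Longrightarrow> J b \<subseteq> I b)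
           \<Longrightarrow> J a \<subseteq> shift_diff (I a) (c a) \<Longrightarrow> cmod (ft (strips A J) n) \<le> \<beta> a"
  shows "cmod (ft {x\<in>strips A I. \<exists>a\<in>A'. a \<bullet> x - c a \<notin> I a} n) \<le> sum \<beta> A'"
  using assms
proof (induction A' arbitrary: I rule: finite_induct)
  case empty
  then show ?case by (simp add: ft_def set_lebesgue_integral_def)
next
  case (insert a A')
  \<comment> \<open>Strip \<open>a\<close> is split: \<open>J0\<close> keeps the values that leave
    it, \<open>I0\<close> those that stay. The latter go on to the remaining strips
    \<open>A'\<close>.\<close>
  define J0 where "J0 = I(a := shift_diff (I a) (c a))"
  define I0 where "I0 = I(a := {r\<in>I a. r - c a \<in> I a})"
  have J0: "J0 a = shift_diff (I a) (c a)" "\<And>b. b \<noteq> a \<Longrightarrow> J0 b = I b"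
    and I0: "I0 a = {r\<in>I a. r - c a \<in> I a}" "\<And>b. b \<noteq> a \<Longrightarrow> I0 b = I b"
    by (auto simp: J0_def I0_def)
  have sub: "J0 b \<subseteq> I b" "I0 b \<subseteq> I b" for b
    using J0 I0 by (cases "b = a"; auto)+
  define R where "R = {x\<in>strips A I0. \<exists>b\<in>A'. b \<bullet> x - c b \<notin> I0 b}"
  let ?S = "{x\<in>strips A I. \<exists>b\<in>insert a A'. b \<bullet> x - c b \<notin> I b}"
  have aA: "a \<in> A" using insert.prems by auto
  have I0': "I0 b = I b" if "b \<in> A'" for b using that insert.hyps I0(2) by metis
  have mI0: "x \<in> strips A I0 \<longleftrightarrow> x \<in> strips A I \<and> a \<bullet> x - c a \<in> I a" for x
    using I0 aA by (auto simp: strips_def) (metis (no_types, lifting) mem_Collect_eq)+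
  have mJ0: "x \<in> strips A J0 \<longleftrightarrow> x \<in> strips A I \<and> a \<bullet> x - c a \<notin> I a" for x
    using J0 aA by (auto simp: strips_def) (metis (no_types, lifting) mem_Collect_eq)+
  have eq: "?S = strips A J0 \<union> R" and disj: "strips A J0 \<inter> R = {}"
    using I0' by (auto simp: R_def mI0 mJ0)
  have iJ: "is_interval (J0 b)" and iI: "is_interval (I0 b)" if "b \<in> A" for b
    using insert.prems(3)[OF that] J0 I0 is_interval_shift_Int is_interval_shift_diff
    by (cases "b = a"; simp)+
  have b: "bounded (strips A J0)" "bounded (strips A I0)" "bounded R"
    using insert.prems(4) by (auto intro: bounded_subset simp: mI0 mJ0 R_def)
  have mR: "R \<in> sets borel"
  proof -
    have "R = strips A I0 \<inter> (\<Union>b\<in>A'. (\<lambda>x. b \<bullet> x - c b) -` (- I0 b))"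
      by (auto simp: R_def)
    moreover have "(\<lambda>x. b \<bullet> x - c b) -` (- I0 b) \<in> sets borel" if "b \<in> A'" for b
      using real_interval_borel_measurable[OF iI[of b]] that insert.prems(1)
      by (intro measurable_sets_borel[of _ borel]) auto
    ultimately show ?thesis
      using strips_borel[OF insert.prems(2) iI] insert.hyps(1) by auto
  qed
  have "cmod (ft R n) \<le> sum \<beta> A'"
    unfolding R_def
  proof (rule insert.IH)
    show "cmod (ft (strips A J) n) \<le> \<beta> b"
      if "b \<in> A'" "\<And>b. b \<in> A \<Longrightarrow> is_interval (J b)" "\<And>b. b \<in> A \<Longrightarrow> J b \<subseteq> I0 b"
         "J b \<subseteq> shift_diff (I0 b) (c b)" for b J
    proof (rule insert.prems(5))
      show "J e \<subseteq> I e" if "e \<in> A" for e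
        using \<open>\<And>b. b \<in> A \<Longrightarrow> J b \<subseteq> I0 b\<close>[OF that] sub(2) by blast
    qed (use that I0' in auto)
  qed (use insert.prems iI b in auto)
  moreover have "cmod (ft (strips A J0) n) \<le> \<beta> a"
    by (rule insert.prems(5)) (use iJ aA sub J0 in auto)
  moreover have "ft ?S n = ft (strips A J0) n + ft R n"
    unfolding eq using disj b mR strips_borel[OF insert.prems(2) iJ] by (intro ft_Un) auto
  ultimately show ?case
    using insert.hyps norm_triangle_ineq[of "ft (strips A J0) n" "ft R n"] by simp
qed

text \<open>The factor 2 accounts for the shifts by \<open>u\<close> and \<open>- u\<close>; strips
  with \<open>a \<bullet> u = 0\<close> are never left. The bound \<open>\<beta> a\<close> is
  demanded for every family \<open>J\<close> below \<open>I\<close> that is thin at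
  \<open>a\<close>, so that an induction hypothesis can be inserted.\<close>

lemma ft_strips_step:
  assumes A: "finite A"
    and I: "\<And>a. a \<in> A \<Longrightarrow> is_interval (I a)" and b: "bounded (strips A I)"
    and u: "n \<bullet> u = 1 / 2 \<or> (\<forall>x\<in>strips A I. x - u \<notin> strips A I)"
    and \<beta>: "\<And>a J. a \<in> A \<Longrightarrow> a \<bullet> u \<noteq> 0 \<Longrightarrow> (\<And>b. b \<in> A \<Longrightarrow> is_interval (J b)) \<Longrightarrow> (\<And>b. b \<in> A \<Longrightarrow> J b \<subseteq> I b)
           \<Longrightarrow> (\<And>x y. x \<in> J a \<Longrightarrow> y \<in> J a \<Longrightarrow> \<bar>x - y\<bar> \<le> \<bar>a \<bullet> u\<bar>) \<Longrightarrow> cmod (ft (strips A J) n) \<le> \<beta> a"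
  shows "cmod (ft (strips A I) n) \<le> 2 * (\<Sum>a\<in>{a\<in>A. a \<bullet> u \<noteq> 0}. \<beta> a)"
proof -
  let ?A' = "{a\<in>A. a \<bullet> u \<noteq> 0}"
  have *: "cmod (ft {x\<in>strips A I. x - s *\<^sub>R u \<notin> strips A I} n) \<le> sum \<beta> ?A'"
    if "\<bar>s\<bar> = 1" for s
  proof -
    have "{x\<in>strips A I. x - s *\<^sub>R u \<notin> strips A I}
        = {x\<in>strips A I. \<exists>a\<in>?A'. a \<bullet> x - a \<bullet> (s *\<^sub>R u) \<notin> I a}"
      using that by (auto simp: strips_def inner_diff_right)
    moreover have "cmod (ft {x\<in>strips A I. \<exists>a\<in>?A'. a \<bullet> x - a \<bullet> (s *\<^sub>R u) \<notin> I a} n) \<le> sum \<beta> ?A'"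
    proof (rule ft_leaving_le)
      show "cmod (ft (strips A J) n) \<le> \<beta> a"
        if "a \<in> ?A'" "\<And>b. b \<in> A \<Longrightarrow> is_interval (J b)" "\<And>b. b \<in> A \<Longrightarrow> J b \<subseteq> I b"
           "J a \<subseteq> shift_diff (I a) (a \<bullet> (s *\<^sub>R u))" for a J
      proof (rule \<beta>)
        show "\<bar>x - y\<bar> \<le> \<bar>a \<bullet> u\<bar>" if "x \<in> J a" "y \<in> J a" for x y
          using shift_diff_width[OF I, of a x "a \<bullet> (s *\<^sub>R u)" y] that \<open>a \<in> ?A'\<close> \<open>\<bar>s\<bar> = 1\<close>
            \<open>J a \<subseteq> shift_diff (I a) (a \<bullet> (s *\<^sub>R u))\<close>
          by (auto simp: abs_mult)
      qed (use that in auto)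
    qed (use A I b in auto)
    ultimately show ?thesis by simp
  qed
  have "cmod (ft (strips A I) n) \<le> cmod (ft {x\<in>strips A I. x - u \<notin> strips A I} n)
         + cmod (ft {x\<in>strips A I. x + u \<notin> strips A I} n)"
    by (rule ft_le_shift[OF strips_borel[OF A I] b u])
  then show ?thesis using *[of 1] *[of "-1"] by simp
qed

section \<open>Orthogonality over a subfield\<close>

definition vecs :: "real set \<Rightarrow> (real^'n) set" where
  "vecs K = {x. \<forall>i. x $ i \<in> K}"

lemma real_subfieldD:
  assumes "real_subfield K"
  shows "0 \<in> K" "1 \<in> K" "x \<in> K \<Longrightarrow> y \<in> K \<Longrightarrow> x + y \<in> K" "x \<in> K \<Longrightarrow> y \<in> K \<Longrightarrow> x * y \<in> K"
    "x \<in> K \<Longrightarrow> - x \<in> K" "x \<in> K \<Longrightarrow> inverse x \<in> K"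
    "x \<in> K \<Longrightarrow> y \<in> K \<Longrightarrow> x - y \<in> K" "x \<in> K \<Longrightarrow> y \<in> K \<Longrightarrow> x / y \<in> K"
proof -
  show *: "0 \<in> K" "1 \<in> K" "\<And>x y. x \<in> K \<Longrightarrow> y \<in> K \<Longrightarrow> x + y \<in> K" "\<And>x y. x \<in> K \<Longrightarrow> y \<in> K \<Longrightarrow> x * y \<in> K"
    "\<And>x. x \<in> K \<Longrightarrow> - x \<in> K" "\<And>x. x \<in> K \<Longrightarrow> inverse x \<in> K"
    using assms by (auto simp: real_subfield_def)
  show "x \<in> K \<Longrightarrow> y \<in> K \<Longrightarrow> x - y \<in> K" using *(3)[of x "- y"] *(5) by simp
  show "x \<in> K \<Longrightarrow> y \<in> K \<Longrightarrow> x / y \<in> K" using *(4)[of x "inverse y"] *(6) by (simp add: divide_inverse)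
qed

lemma real_subfield_inner:
  assumes K: "real_subfield K" and "x \<in> vecs K" "y \<in> vecs K"
  shows "x \<bullet> y \<in> K"
proof -
  have "sum f S \<in> K" if "finite S" "\<And>i. i \<in> S \<Longrightarrow> f i \<in> K" for S :: "'a set" and f
    using that by (induction S rule: finite_induct) (auto simp: real_subfieldD[OF K])
  moreover have "x $ i * y $ i \<in> K" for i
    using assms by (auto simp: vecs_def intro: real_subfieldD[OF K])
  ultimately show ?thesis by (simp add: inner_vec_def)
qed

text \<open>Gram-Schmidt without normalisation: only field operations occur, so the projection stays
  over \<open>K\<close>.\<close>

lemma orthogonal_projection_over_subfield:
  fixes B :: "(real^'n) set"
  assumes K: "real_subfield K" and "finite B" "B \<subseteq> vecs K" "x \<in> vecs K"
  shows "\<exists>y\<in>vecs K. (\<forall>b\<in>B. y \<bullet> b = 0) \<and> x - y \<in> span B"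
  using assms(2-4)
proof (induction B arbitrary: x rule: finite_induct)
  case empty
  then show ?case by (auto simp: span_zero intro!: bexI[of _ x])
next
  case (insert b B)
  obtain b' where b': "b' \<in> vecs K" "\<forall>e\<in>B. b' \<bullet> e = 0" "b - b' \<in> span B"
    using insert.IH[of b] insert.prems by auto
  obtain y where y: "y \<in> vecs K" "\<forall>e\<in>B. y \<bullet> e = 0" "x - y \<in> span B"
    using insert.IH[of x] insert.prems by auto
  have perp: "z \<bullet> e = 0" if "\<forall>e\<in>B. z \<bullet> e = 0" "e \<in> span B" for z e
    using that(2) by (rule span_induct) (use that(1) in \<open>auto simp: subspace_def inner_right_distrib\<close>)
  \<comment> \<open>If \<open>b' = 0\<close>, then \<open>t = 0\<close> by the convention for
    division by zero; \<open>z = y\<close> is then already orthogonal to \<open>b\<close>, which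
    lies in \<open>span B\<close>.\<close>
  define t where "t = (y \<bullet> b') / (b' \<bullet> b')"
  define z where "z = y - t *\<^sub>R b'"
  have "t \<in> K" unfolding t_def using b'(1) y(1) K by (auto intro: real_subfieldD real_subfield_inner)
  then have "z \<in> vecs K" using b'(1) y(1) K by (auto simp: z_def vecs_def intro: real_subfieldD)
  moreover have zB: "\<forall>e\<in>B. z \<bullet> e = 0" using b'(2) y(2) by (simp add: z_def inner_diff_left)
  moreover have "z \<bullet> b = 0"
  proof -
    have "z \<bullet> b = z \<bullet> b' + z \<bullet> (b - b')" by (simp add: inner_diff_right)
    also have "z \<bullet> (b - b') = 0" using perp[OF zB b'(3)] .
    also have "z \<bullet> b' = 0" by (simp add: z_def t_def inner_diff_left)
    finally show ?thesis by simp
  qed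
  moreover have "x - z \<in> span (insert b B)"
  proof -
    have "x - z = (x - y) + t *\<^sub>R (b - (b - b'))" by (simp add: z_def)
    moreover have "span B \<subseteq> span (insert b B)" by (rule span_mono) auto
    then have xy: "x - y \<in> span (insert b B)" and bb: "b - b' \<in> span (insert b B)" using y(3) b'(3) by auto
    moreover have "b - (b - b') \<in> span (insert b B)"
      by (rule span_diff) (use bb in \<open>auto intro: span_base\<close>)
    ultimately show ?thesis using xy by (metis span_add span_scale)
  qed
  ultimately show ?case by blast
qed

text \<open>Fewer vectors than the dimension cannot span, so some standard unit vector lies outside
  \<open>span B\<close>; its component orthogonal to \<open>B\<close> is over \<open>K\<close> and
  nonzero.\<close>

lemma exists_orthogonal_over_subfield:
  fixes B :: "(real^'n) set"
  assumes K: "real_subfield K" and B: "finite B" "B \<subseteq> vecs K" "card B < CARD('n)"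
  shows "\<exists>v\<in>vecs K. v \<noteq> 0 \<and> (\<forall>b\<in>B. v \<bullet> b = 0)"
proof -
  have "\<exists>i. axis i 1 \<notin> span B"
  proof (rule ccontr)
    assume "\<not> ?thesis"
    then have "(Basis :: (real^'n) set) \<subseteq> span B" by (auto simp: Basis_vec_def)
    then have "span Basis \<subseteq> span B" by (rule span_minimal) (rule subspace_span)
    then have "span B = UNIV" by auto
    then have "dim B = DIM(real^'n)" by (simp only: dim_eq_full)
    then have "DIM(real^'n) \<le> card B" using dim_le_card'[OF B(1)] by simp
    then show False using B(3) by simp
  qed
  then obtain i where i: "(axis i 1 :: real^'n) \<notin> span B" by blast
  have "(axis i 1 :: real^'n) \<in> vecs K" using K by (auto simp: vecs_def axis_def real_subfieldD)
  then obtain y where y: "y \<in> vecs K" "\<forall>b\<in>B. y \<bullet> b = 0" "axis i 1 - y \<in> span B"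
    using orthogonal_projection_over_subfield[OF K B(1,2)] by blast
  then show ?thesis using i by (intro bexI[of _ y]) auto
qed

section \<open>Dual bases and the volume of thin sets\<close>

lemma orthogonal_spanning_imp_zero:
  fixes x :: "real^'n"
  assumes "independent B" "card B = CARD('n)" "\<forall>b\<in>B. b \<bullet> x = 0"
  shows "x = 0"
proof -
  have "span B = UNIV"
    using assms by (simp add: dim_eq_full[symmetric] dim_eq_card_independent)
  then have "x \<in> span B" by simp
  then have "x \<bullet> x = 0"
    by (rule span_induct[where P = "\<lambda>y. y \<bullet> x = 0"])
      (use assms(3) in \<open>auto simp: subspace_def inner_left_distrib\<close>)
  then show ?thesis by simp
qed

lemma dual_vector:
  fixes B :: "(real^'n) set"
  assumes B: "independent B" "card B = CARD('n)" "b \<in> B"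
  shows "\<exists>g. b \<bullet> g = 1 \<and> (\<forall>b'\<in>B - {b}. b' \<bullet> g = 0)"
proof -
  have fB: "finite B" using B(1) by (rule independent_imp_finite)
  have "real_subfield UNIV" by (simp add: real_subfield_def)
  then obtain v where v: "v \<noteq> 0" "\<forall>b'\<in>B - {b}. v \<bullet> b' = 0"
    using exists_orthogonal_over_subfield[of UNIV "B - {b}"] fB B
    by (auto simp: vecs_def card_Diff_singleton)
  have "v \<bullet> b \<noteq> 0"
    using orthogonal_spanning_imp_zero[OF B(1,2), of v] v by (auto simp: inner_commute)
  then show ?thesis
    using v(2) by (intro exI[of _ "v /\<^sub>R (v \<bullet> b)"]) (auto simp: inner_commute)
qed

text \<open>Translates of a set that is thin in the directions of a basis can be packed
  disjointly into a fixed ball.\<close>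

lemma measure_thin_le:
  fixes B :: "(real^'n) set"
  assumes B: "independent B" "card B = CARD('n)" and S0: "bounded S0"
  shows "\<exists>C\<ge>0. \<forall>S w. S \<in> sets borel \<and> S \<subseteq> S0 \<and>
           (\<forall>b\<in>B. w b > 0 \<and> (\<forall>x\<in>S. \<forall>y\<in>S. \<bar>b \<bullet> x - b \<bullet> y\<bar> \<le> w b)) \<longrightarrow>
           measure lborel S \<le> C * (\<Prod>b\<in>B. w b)"
proof -
  have fB: "finite B" using B(1) by (rule independent_imp_finite)
  have "\<forall>b\<in>B. \<exists>g. b \<bullet> g = 1 \<and> (\<forall>b'\<in>B - {b}. b' \<bullet> g = 0)"
    using dual_vector[OF B] by blast
  then obtain g where g: "\<And>b. b \<in> B \<Longrightarrow> b \<bullet> g b = 1"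
    "\<And>b b'. b \<in> B \<Longrightarrow> b' \<in> B \<Longrightarrow> b' \<noteq> b \<Longrightarrow> b' \<bullet> g b = 0"
    by (metis Diff_iff singletonD)
  obtain r where r: "\<And>x. x \<in> S0 \<Longrightarrow> norm x \<le> r" using S0 by (auto simp: bounded_iff)
  define Q where "Q = cball (0::real^'n) (r + (\<Sum>b\<in>B. 2 * norm (g b)))"
  have "measure lborel S \<le> measure lborel Q * (\<Prod>b\<in>B. w b)"
    if S: "S \<in> sets borel" "S \<subseteq> S0"
      and w: "\<And>b. b \<in> B \<Longrightarrow> w b > 0"
        "\<And>b x y. b \<in> B \<Longrightarrow> x \<in> S \<Longrightarrow> y \<in> S \<Longrightarrow> \<bar>b \<bullet> x - b \<bullet> y\<bar> \<le> w b" for S w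
  proof -
    \<comment> \<open>At least \<open>1 / w b\<close> translates in direction \<open>g b\<close>, at
      spacing \<open>2 * w b\<close>. Twice the width separates them strictly, while
      \<open>k b < 1 / w b\<close> keeps each displacement at most \<open>2 * norm (g b)\<close>;
      this is the origin of the radius of \<open>Q\<close>.\<close>
    define N where "N b = nat \<lceil>1 / w b\<rceil>" for b
    define \<tau> where "\<tau> k = (\<Sum>b\<in>B. (2 * w b * real (k b)) *\<^sub>R g b)" for k :: "real^'n \<Rightarrow> nat"
    have \<tau>: "b \<bullet> \<tau> k = 2 * w b * real (k b)" if "b \<in> B" for b k
    proof -
      have "b \<bullet> \<tau> k = (\<Sum>b'\<in>B. if b' = b then 2 * w b * real (k b) else 0)"
        unfolding \<tau>_def inner_sum_right by (rule sum.cong) (use g that in auto)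
      then show ?thesis using that fB by simp
    qed
    let ?P = "PiE B (\<lambda>b. {..<N b})"
    have fP: "finite ?P" using fB by (auto intro: finite_PiE)
    have tm: "(+) c ` S \<in> sets borel" for c
      by (rule shift_image_borel[OF S(1)])
    have tS: "measure lborel ((+) c ` S) = measure lborel S" for c
      using measure_translation[of c S] S(1) tm by (simp add: measure_completion)
    have disj: "disjoint_family_on (\<lambda>k. (+) (\<tau> k) ` S) ?P"
      unfolding disjoint_family_on_def
    proof (intro ballI impI)
      fix k k' assume k: "k \<in> ?P" "k' \<in> ?P" "k \<noteq> k'"
      then obtain b where b: "b \<in> B" "k b \<noteq> k' b" by (meson PiE_ext)
      have False if "x \<in> S" "y \<in> S" "\<tau> k + x = \<tau> k' + y" for x y
      proof -
        have "b \<bullet> x - b \<bullet> y = 2 * w b * (real (k' b) - real (k b))"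
          using arg_cong[OF that(3), of "\<lambda>z. b \<bullet> z"] \<tau>[OF b(1)]
          by (simp add: inner_add_right algebra_simps)
        then have "\<bar>b \<bullet> x - b \<bullet> y\<bar> = 2 * w b * \<bar>real (k' b) - real (k b)\<bar>"
          using w(1)[OF b(1)] by (simp add: abs_mult)
        moreover have "\<bar>real (k' b) - real (k b)\<bar> \<ge> 1" using b(2) by linarith
        ultimately have "\<bar>b \<bullet> x - b \<bullet> y\<bar> \<ge> 2 * w b"
          using w(1)[OF b(1)] by (metis mult.right_neutral mult_left_mono less_imp_le mult_pos_pos zero_less_numeral)
        then show False using w(2)[OF b(1) that(1,2)] w(1)[OF b(1)] by linarith
      qed
      then show "(+) (\<tau> k) ` S \<inter> (+) (\<tau> k') ` S = {}" by blast
    qed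
    have sub: "(\<Union>k\<in>?P. (+) (\<tau> k) ` S) \<subseteq> Q"
    proof clarify
      fix k x assume k: "k \<in> ?P" and x: "x \<in> S"
      have "norm (\<tau> k) \<le> (\<Sum>b\<in>B. 2 * norm (g b))"
        unfolding \<tau>_def
      proof (rule sum_norm_le)
        fix b assume b: "b \<in> B"
        have "k b < N b" using k b by auto
        then have "real (k b) < 1 / w b" unfolding N_def by linarith
        then have "w b * real (k b) \<le> 1" using w(1)[OF b] by (simp add: field_simps)
        then have "(w b * real (k b)) * (2 * norm (g b)) \<le> 1 * (2 * norm (g b))"
          by (intro mult_right_mono) auto
        then show "norm ((2 * w b * real (k b)) *\<^sub>R g b) \<le> 2 * norm (g b)"
          using w(1)[OF b] by (simp add: abs_mult algebra_simps)
      qed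
      moreover have "norm x \<le> r" using r x S by blast
      ultimately show "\<tau> k + x \<in> Q"
        using norm_triangle_ineq[of "\<tau> k" x] by (simp add: Q_def)
    qed
    have "(\<Sum>k\<in>?P. measure lborel ((+) (\<tau> k) ` S)) = measure lborel (\<Union>k\<in>?P. (+) (\<tau> k) ` S)"
    proof (rule measure_finite_Union[symmetric, OF fP _ disj])
      show "emeasure lborel ((+) (\<tau> k) ` S) \<noteq> \<infinity>" for k
      proof -
        have "bounded ((+) (\<tau> k) ` S)"
          using S(2) S0 bounded_subset by (intro bounded_translation) blast
        then show ?thesis using emeasure_bounded_finite by (metis less_irrefl)
      qed
    qed (use tm in auto)
    also have "\<dots> \<le> measure lborel Q"
      by (rule measure_mono_fmeasurable[OF sub])
        (use tm fP in \<open>auto simp: Q_def intro!: fmeasurableI emeasure_bounded_finite\<close>)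
    finally have 1: "(\<Prod>b\<in>B. real (N b)) * measure lborel S \<le> measure lborel Q"
      using fB by (simp add: tS card_PiE)
    have "(\<Prod>b\<in>B. 1 / w b) \<le> (\<Prod>b\<in>B. real (N b))"
      by (rule prod_mono) (use w(1) in \<open>auto simp: N_def less_imp_le intro: real_nat_ceiling_ge\<close>)
    then have "(\<Prod>b\<in>B. 1 / w b) * measure lborel S \<le> measure lborel Q"
      using 1 by (meson measure_nonneg mult_right_mono order_trans)
    moreover have "(\<Prod>b\<in>B. w b) > 0" using w(1) by (rule prod_pos)
    ultimately show ?thesis by (simp add: prod_dividef field_simps)
  qed
  then show ?thesis by (intro exI[of _ "measure lborel Q"]) auto
qed

section \<open>Decay of the Fourier transform\<close>

lemma norm_ft_le_measure:
  assumes "S \<in> sets borel" "bounded S"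
  shows "cmod (ft S n) \<le> measure lborel S"
proof -
  have "cmod (ft S n) \<le> (LINT x|lborel. norm (indicator S x *\<^sub>R expi n x))"
    unfolding ft_def set_lebesgue_integral_def by (rule integral_norm_bound)
  also have "\<dots> = (LINT x|lborel. indicator S x)"
    by (rule Bochner_Integration.integral_cong) (auto simp: indicator_def)
  also have "\<dots> = measure lborel S" using assms by simp
  finally show ?thesis .
qed

definition form_weight :: "(real^'n) set \<Rightarrow> real^'n \<Rightarrow> real" where
  "form_weight V n = (\<Prod>v\<in>V. 1 / (1 + \<bar>v \<bullet> n\<bar>))"

lemma form_weight_pos: "form_weight V n > 0"
  unfolding form_weight_def by (rule prod_pos) auto

lemma form_weight_nonneg [simp]: "form_weight V n \<ge> 0"
  using form_weight_pos[of V n] by simp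

lemma form_weight_insert:
  "finite V \<Longrightarrow> v \<notin> V \<Longrightarrow> form_weight (insert v V) n = form_weight V n / (1 + \<bar>v \<bullet> n\<bar>)"
  by (simp add: form_weight_def)

text \<open>The assertion for the induction: the strips with normals in \<open>B\<close> have widths
  at most \<open>w\<close>, and \<open>k\<close> shifts are still to come. \<open>C\<close> and
  \<open>\<V>\<close> precede the quantifiers over \<open>I\<close>, \<open>w\<close> and
  \<open>n\<close>, so they depend on the normals only. Each width enters linearly, because the gain
  of a shift is passed on as the width of a newly thin strip.\<close>

definition decay_data ::
  "real set \<Rightarrow> (real^'n) set \<Rightarrow> (real^'n) set \<Rightarrow> nat \<Rightarrow> real \<Rightarrow> (real^'n) set set \<Rightarrow> bool" where
  "decay_data K A B k C \<V> \<longleftrightarrow> C \<ge> 0 \<and> finite \<V> \<and>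
      (\<forall>V\<in>\<V>. finite V \<and> independent V \<and> card V = k \<and> V \<subseteq> vecs K \<and> (\<forall>v\<in>V. \<forall>b\<in>B. v \<bullet> b = 0)) \<and>
      (\<forall>I w n. (\<forall>a\<in>A. is_interval (I a)) \<longrightarrow> strips A I \<subseteq> cbox 0 1 \<longrightarrow>
         (\<forall>b\<in>B. w b > 0 \<and> (\<forall>x\<in>I b. \<forall>y\<in>I b. \<bar>x - y\<bar> \<le> w b)) \<longrightarrow>
         cmod (ft (strips A I) n) \<le> C * (\<Prod>b\<in>B. w b) * (\<Sum>V\<in>\<V>. form_weight V n))"

lemma decay_dataD:
  assumes "decay_data K A B k C \<V>"
  shows "C \<ge> 0" "finite \<V>" "V \<in> \<V> \<Longrightarrow> finite V" "V \<in> \<V> \<Longrightarrow> independent V"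
    "V \<in> \<V> \<Longrightarrow> card V = k" "V \<in> \<V> \<Longrightarrow> V \<subseteq> vecs K"
    "V \<in> \<V> \<Longrightarrow> v \<in> V \<Longrightarrow> b \<in> B \<Longrightarrow> v \<bullet> b = 0"
    "(\<And>a. a \<in> A \<Longrightarrow> is_interval (I a)) \<Longrightarrow> strips A I \<subseteq> cbox 0 1 \<Longrightarrow> (\<And>b. b \<in> B \<Longrightarrow> w b > 0) \<Longrightarrow>
      (\<And>b x y. b \<in> B \<Longrightarrow> x \<in> I b \<Longrightarrow> y \<in> I b \<Longrightarrow> \<bar>x - y\<bar> \<le> w b) \<Longrightarrow>
      cmod (ft (strips A I) n) \<le> C * (\<Prod>b\<in>B. w b) * (\<Sum>V\<in>\<V>. form_weight V n)"
proof -
  note D = assms[unfolded decay_data_def]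
  note D1 = D[THEN conjunct1] and D2 = D[THEN conjunct2, THEN conjunct1]
    and D3 = D[THEN conjunct2, THEN conjunct2, THEN conjunct1, THEN bspec]
    and D4 = D[THEN conjunct2, THEN conjunct2, THEN conjunct2]
  show "C \<ge> 0" "finite \<V>" "V \<in> \<V> \<Longrightarrow> finite V" "V \<in> \<V> \<Longrightarrow> independent V"
    "V \<in> \<V> \<Longrightarrow> card V = k" "V \<in> \<V> \<Longrightarrow> V \<subseteq> vecs K"
    "V \<in> \<V> \<Longrightarrow> v \<in> V \<Longrightarrow> b \<in> B \<Longrightarrow> v \<bullet> b = 0"
    using D1 D2 D3 by auto
  show "cmod (ft (strips A I) n) \<le> C * (\<Prod>b\<in>B. w b) * (\<Sum>V\<in>\<V>. form_weight V n)"
    if "\<And>a. a \<in> A \<Longrightarrow> is_interval (I a)" "strips A I \<subseteq> cbox 0 1" "\<And>b. b \<in> B \<Longrightarrow> w b > 0"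
      "\<And>b x y. b \<in> B \<Longrightarrow> x \<in> I b \<Longrightarrow> y \<in> I b \<Longrightarrow> \<bar>x - y\<bar> \<le> w b"
    by (rule D4[rule_format]) (use that in auto)
qed

text \<open>
  \<open>B\<close> collects the normals of the strips that are already thin. A shift in a direction \<open>v\<close> orthogonal
  to \<open>B\<close> keeps them thin and makes a strip thin whose normal lies outside \<open>span B\<close>. If \<open>\<bar>v \<bullet> n\<bar> < 1\<close>,
  the shift is taken so long that it moves the cube off itself.
\<close>

lemma exists_decay_data:
  fixes A :: "(real^'n) set"
  assumes K: "real_subfield K" and A: "finite A" "A \<subseteq> vecs K"
  shows "B \<subseteq> A \<Longrightarrow> independent B \<Longrightarrow> card B + k = CARD('n) \<Longrightarrow> \<exists>C \<V>. decay_data K A B k C \<V>"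
proof (induction k arbitrary: B)
  case 0
  \<comment> \<open>Here \<open>B\<close> is a basis, so the trivial bound by the volume suffices;
    the empty family of forms has weight 1.\<close>
  obtain C where "C \<ge> 0" and C: "\<And>S w. S \<in> sets borel \<Longrightarrow> S \<subseteq> cbox 0 1 \<Longrightarrow>
           (\<forall>b\<in>B. w b > 0 \<and> (\<forall>x\<in>S. \<forall>y\<in>S. \<bar>b \<bullet> x - b \<bullet> y\<bar> \<le> w b)) \<Longrightarrow>
           measure lborel S \<le> C * (\<Prod>b\<in>B. w b)"
    using measure_thin_le[of B "cbox 0 1"] 0 by auto
  have "cmod (ft (strips A I) n) \<le> C * (\<Prod>b\<in>B. w b)"
    if "\<forall>a\<in>A. is_interval (I a)" "strips A I \<subseteq> cbox 0 1"
       "\<forall>b\<in>B. w b > 0 \<and> (\<forall>x\<in>I b. \<forall>y\<in>I b. \<bar>x - y\<bar> \<le> w b)" for I :: "real^'n \<Rightarrow> real set" and w n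
  proof -
    have m: "strips A I \<in> sets borel" using that A(1) by (intro strips_borel) auto
    have "cmod (ft (strips A I) n) \<le> measure lborel (strips A I)"
      by (rule norm_ft_le_measure[OF m bounded_subset[OF bounded_cbox that(2)]])
    also have "\<dots> \<le> C * (\<Prod>b\<in>B. w b)"
      by (rule C[OF m that(2)]) (use that(3) 0(1) in \<open>auto simp: strips_def\<close>)
    finally show ?thesis .
  qed
  then have "decay_data K A B 0 C {{}}" using \<open>C \<ge> 0\<close>
    unfolding decay_data_def by (auto simp: form_weight_def independent_empty)
  then show ?case by blast
next
  case (Suc k)
  have fB: "finite B" using Suc.prems A finite_subset by blast
  obtain v where v: "v \<in> vecs K" "v \<noteq> 0" "\<And>b. b \<in> B \<Longrightarrow> v \<bullet> b = 0"
    using exists_orthogonal_over_subfield[OF K fB] Suc.prems A(2) by force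
  define A' where "A' = {a\<in>A. a \<bullet> v \<noteq> 0}"
  have fA': "finite A'" using A by (simp add: A'_def)
  \<comment> \<open>A normal in \<open>span B\<close> would be orthogonal to \<open>v\<close>; hence
    only new directions become thin, and \<open>insert a B\<close> stays independent.\<close>
  have notin: "a \<notin> span B" if "a \<in> A'" for a
  proof
    assume "a \<in> span B"
    then have "v \<bullet> a = 0"
      by (rule span_induct) (use v(3) in \<open>auto simp: subspace_def inner_right_distrib\<close>)
    then show False using that by (simp add: A'_def inner_commute)
  qed
  have "\<exists>C \<V>. decay_data K A (insert a B) k C \<V>" if "a \<in> A'" for a
  proof -
    have "a \<notin> B" using notin[OF that] span_base by blast
    then have "card (insert a B) + k = CARD('n)" using Suc.prems(3) fB by simp
    moreover have "independent (insert a B)"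
      using notin[OF that] Suc.prems(2) by (simp add: independent_insert)
    moreover have "insert a B \<subseteq> A" using that Suc.prems(1) by (auto simp: A'_def)
    ultimately show ?thesis by (intro Suc.IH)
  qed
  then obtain C \<V> where good: "\<And>a. a \<in> A' \<Longrightarrow> decay_data K A (insert a B) k (C a) (\<V> a)" by metis
  obtain D where D: "\<And>x y. x \<in> cbox (0::real^'n) 1 \<Longrightarrow> y \<in> cbox 0 1 \<Longrightarrow> dist x y \<le> D"
    using bounded_cbox[of "0::real^'n" 1] by (metis bounded_two_points)
  have D0: "D \<ge> 0" using D[of 0 0] by (simp add: mem_box_cart)
  \<comment> \<open>\<open>D\<close> bounds the distances within the cube, so the shift by
    \<open>H *\<^sub>R v\<close>, of length \<open>D + 1\<close>, moves the cube off itself.\<close>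
  define H where "H = (D + 1) / norm v"
  have H: "H > 0" using D0 v(2) by (simp add: H_def)
  \<comment> \<open>Covers both choices of \<open>h\<close> below: the half-period shift needs
    \<open>M \<ge> 1\<close>, the long shift \<open>M \<ge> 2 * H\<close>.\<close>
  define M where "M = 2 * H + 1"
  have Cn: "C a \<ge> 0" "finite (\<V> a)" if "a \<in> A'" for a
    using decay_dataD(1,2)[OF good[OF that]] by auto
  define \<W> where "\<W> = (\<Union>a\<in>A'. insert v ` \<V> a)"
  have fW: "finite \<W>" unfolding \<W>_def using fA' Cn(2) by auto
  \<comment> \<open>All of \<open>V\<close> is orthogonal to \<open>a\<close>, whereas
    \<open>v\<close> is not, so adding \<open>v\<close> keeps the family independent.\<close>
  have vV: "finite V" "v \<notin> span V" if "a \<in> A'" "V \<in> \<V> a" for a V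
  proof -
    show "finite V" using decay_dataD(3)[OF good[OF that(1)] that(2)] .
    show "v \<notin> span V"
    proof
      assume "v \<in> span V"
      then have "v \<bullet> a = 0"
        by (rule span_induct) (use decay_dataD(7)[OF good[OF that(1)] that(2)] in \<open>auto simp: subspace_def inner_left_distrib\<close>)
      then show False using that(1) by (simp add: A'_def inner_commute)
    qed
  qed
  then have vnV: "v \<notin> V" if "a \<in> A'" "V \<in> \<V> a" for a V using that span_base by blast
  have 1: "finite V \<and> independent V \<and> card V = Suc k \<and> V \<subseteq> vecs K \<and> (\<forall>u\<in>V. \<forall>b\<in>B. u \<bullet> b = 0)"
    if "V \<in> \<W>" for V
  proof -
    obtain a V' where V': "a \<in> A'" "V' \<in> \<V> a" "V = insert v V'" using \<open>V \<in> \<W>\<close> by (auto simp: \<W>_def)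
    note D = decay_dataD(3-7)[OF good[OF V'(1)] V'(2)]
    show ?thesis using V'(3) vV[OF V'(1,2)] vnV[OF V'(1,2)] v D by (auto simp: independent_insert)
  qed
  define C' where "C' = 2 * M * (\<Sum>a\<in>A'. C a * \<bar>a \<bullet> v\<bar>)"
  have C'0: "C' \<ge> 0" unfolding C'_def M_def using H Cn(1) by (intro mult_nonneg_nonneg sum_nonneg) auto
  have 2: "cmod (ft (strips A I) n) \<le> C' * (\<Prod>b\<in>B. w b) * (\<Sum>V\<in>\<W>. form_weight V n)"
    if I: "\<forall>a\<in>A. is_interval (I a)" "strips A I \<subseteq> cbox 0 1"
       and w: "\<And>b. b \<in> B \<Longrightarrow> w b > 0" "\<And>b x y. b \<in> B \<Longrightarrow> x \<in> I b \<Longrightarrow> y \<in> I b \<Longrightarrow> \<bar>x - y\<bar> \<le> w b"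
    for I w n
  proof -
    \<comment> \<open>The half-period shift is too long when \<open>v \<bullet> n\<close> is near 0;
      the fixed long shift then takes its place, and \<open>\<bar>h\<bar>\<close> is of order
      \<open>1 / (1 + \<bar>v \<bullet> n\<bar>)\<close> in both cases.\<close>
    define h where "h = (if \<bar>v \<bullet> n\<bar> \<ge> 1 then 1 / (2 * (v \<bullet> n)) else H)"
    define u where "u = h *\<^sub>R v"
    have h0: "h \<noteq> 0" using H by (auto simp: h_def)
    have hM: "\<bar>h\<bar> \<le> M / (1 + \<bar>v \<bullet> n\<bar>)"
    proof (cases "\<bar>v \<bullet> n\<bar> \<ge> 1")
      case True
      then have "1 / (2 * \<bar>v \<bullet> n\<bar>) \<le> 1 / (1 + \<bar>v \<bullet> n\<bar>)" by (intro divide_left_mono) auto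
      also have "\<dots> \<le> M / (1 + \<bar>v \<bullet> n\<bar>)" using H by (intro divide_right_mono) (auto simp: M_def)
      finally show ?thesis using True by (simp add: h_def abs_mult)
    next
      case False
      then have "H * (1 + \<bar>v \<bullet> n\<bar>) \<le> H * 2" using H by (intro mult_left_mono) auto
      then have "H * (1 + \<bar>v \<bullet> n\<bar>) \<le> M" by (simp add: M_def)
      then have "H \<le> M / (1 + \<bar>v \<bullet> n\<bar>)" by (subst pos_le_divide_eq) auto
      then show ?thesis using False H by (simp add: h_def)
    qed
    have u: "n \<bullet> u = 1 / 2 \<or> (\<forall>x\<in>strips A I. x - u \<notin> strips A I)"
    proof (cases "\<bar>v \<bullet> n\<bar> \<ge> 1")
      case True
      then have "v \<bullet> n \<noteq> 0" by auto
      then have "n \<bullet> u = 1 / 2" using True by (simp add: u_def h_def inner_commute[of n v])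
      then show ?thesis ..
    next
      case False
      then have "norm u = D + 1" using H v(2) D0 by (simp add: u_def h_def H_def)
      then have "x - u \<notin> strips A I" if "x \<in> strips A I" for x
        using D[of x "x - u"] that I(2) by (auto simp: dist_norm)
      then show ?thesis by blast
    qed
    have Au: "{a\<in>A. a \<bullet> u \<noteq> 0} = A'" using h0 by (auto simp: A'_def u_def)
    define F where "F a = (\<Sum>V\<in>\<V> a. form_weight V n)" for a
    define W where "W = (\<Prod>b\<in>B. w b)"
    have W: "W > 0" unfolding W_def using w(1) by (rule prod_pos)
    have "cmod (ft (strips A I) n) \<le> 2 * (\<Sum>a\<in>{a\<in>A. a \<bullet> u \<noteq> 0}. C a * (\<bar>a \<bullet> u\<bar> * W) * F a)"
    proof (rule ft_strips_step[OF A(1) _ _ u])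
      fix a J
      assume a: "a \<in> A" "a \<bullet> u \<noteq> 0" and J: "\<And>b. b \<in> A \<Longrightarrow> is_interval (J b)" "\<And>b. b \<in> A \<Longrightarrow> J b \<subseteq> I b"
        "\<And>x y. x \<in> J a \<Longrightarrow> y \<in> J a \<Longrightarrow> \<bar>x - y\<bar> \<le> \<bar>a \<bullet> u\<bar>"
      have aA': "a \<in> A'" using a Au by blast
      then have aB: "a \<notin> B" using notin span_base by blast
      have sJ: "strips A J \<subseteq> cbox 0 1" using I(2) J(2) by (fastforce simp: strips_def)
      let ?w = "w(a := \<bar>a \<bullet> u\<bar>)"
      have "cmod (ft (strips A J) n) \<le> C a * (\<Prod>b\<in>insert a B. ?w b) * F a"
        unfolding F_def
      proof (rule decay_dataD(8)[OF good[OF aA'] J(1) sJ])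
        fix b assume b: "b \<in> insert a B"
        show "?w b > 0" using b w(1) a by auto
        fix x y assume xy: "x \<in> J b" "y \<in> J b"
        show "\<bar>x - y\<bar> \<le> ?w b"
        proof (cases "b = a")
          case True
          then show ?thesis using J(3) xy by simp
        next
          case False
          then have "b \<in> B" "b \<in> A" using b Suc.prems(1) by auto
          then show ?thesis using w(2)[of b x y] J(2)[of b] xy False by auto
        qed
      qed
      also have "(\<Prod>b\<in>insert a B. ?w b) = \<bar>a \<bullet> u\<bar> * W"
      proof -
        have "(\<Prod>b\<in>B. ?w b) = W" unfolding W_def by (rule prod.cong) (use aB in auto)
        then show ?thesis using aB fB by simp
      qed
      finally show "cmod (ft (strips A J) n) \<le> C a * (\<bar>a \<bullet> u\<bar> * W) * F a" .
    qed (use I bounded_subset[OF bounded_cbox I(2)] in auto)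
    \<comment> \<open>The width \<open>\<bar>a \<bullet> u\<bar> = \<bar>h\<bar> * \<bar>a \<bullet>
      v\<bar>\<close> of the new thin strip supplies the factor
      \<open>1 / (1 + \<bar>v \<bullet> n\<bar>)\<close> that turns the weight of \<open>V\<close>
      into that of \<open>insert v V\<close>.\<close>
    also have "\<dots> \<le> 2 * (\<Sum>a\<in>A'. C a * \<bar>a \<bullet> v\<bar> * (M * W * (\<Sum>V\<in>\<W>. form_weight V n)))"
      unfolding Au
    proof (intro mult_left_mono sum_mono)
      fix a assume a: "a \<in> A'"
      have "F a / (1 + \<bar>v \<bullet> n\<bar>) = (\<Sum>V\<in>\<V> a. form_weight (insert v V) n)"
        unfolding F_def sum_divide_distrib
        by (rule sum.cong) (use vV[OF a] vnV[OF a] in \<open>auto simp: form_weight_insert\<close>)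
      also have "\<dots> = (\<Sum>V\<in>insert v ` \<V> a. form_weight V n)"
      proof (subst sum.reindex)
        show "inj_on (insert v) (\<V> a)" using vnV[OF a] by (intro inj_onI) (metis insert_ident)
      qed simp
      also have "\<dots> \<le> (\<Sum>V\<in>\<W>. form_weight V n)"
        by (rule sum_mono2[OF fW]) (use a in \<open>auto simp: \<W>_def\<close>)
      finally have F: "F a / (1 + \<bar>v \<bullet> n\<bar>) \<le> (\<Sum>V\<in>\<W>. form_weight V n)" .
      have F0: "F a \<ge> 0" unfolding F_def by (simp add: sum_nonneg)
      have "\<bar>h\<bar> * F a \<le> M / (1 + \<bar>v \<bullet> n\<bar>) * F a" by (rule mult_right_mono[OF hM F0])
      also have "\<dots> = M * (F a / (1 + \<bar>v \<bullet> n\<bar>))" by simp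
      also have "\<dots> \<le> M * (\<Sum>V\<in>\<W>. form_weight V n)" by (rule mult_left_mono[OF F]) (use H in \<open>auto simp: M_def\<close>)
      finally have "(C a * \<bar>a \<bullet> v\<bar> * W) * (\<bar>h\<bar> * F a) \<le> (C a * \<bar>a \<bullet> v\<bar> * W) * (M * (\<Sum>V\<in>\<W>. form_weight V n))"
        using Cn(1)[OF a] W by (intro mult_left_mono) auto
      then show "C a * (\<bar>a \<bullet> u\<bar> * W) * F a \<le> C a * \<bar>a \<bullet> v\<bar> * (M * W * (\<Sum>V\<in>\<W>. form_weight V n))"
        by (simp add: u_def abs_mult mult_ac)
    qed simp
    also have "\<dots> = C' * W * (\<Sum>V\<in>\<W>. form_weight V n)"
      by (simp add: C'_def sum_distrib_right sum_distrib_left mult_ac)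
    finally show ?thesis unfolding W_def .
  qed
  have "decay_data K A B (Suc k) C' \<W>"
    unfolding decay_data_def
    by (intro conjI allI impI ballI C'0 fW 2) (use 1 in auto)
  then show ?case by blast
qed

text \<open>A shift along \<open>n\<close> of length \<open>1 / (2 * norm n)\<close> opens the
  iteration: a strip with normal \<open>a\<close> gets width at most
  \<open>norm a / (2 * norm n)\<close>, and \<open>decay_data\<close> with \<open>B = {a}\<close>
  does the rest. Hence all vectors of one \<open>V\<close> are orthogonal to a common
  \<open>a\<close>.\<close>

lemma ft_strips_decay:
  fixes A :: "(real^'n) set"
  assumes K: "real_subfield K" and A: "finite A" "A \<subseteq> vecs K" and d: "CARD('n) = Suc k"
  shows "\<exists>C\<ge>0. \<exists>\<V>. finite \<V> \<and>
      (\<forall>V\<in>\<V>. independent V \<and> card V = k \<and> V \<subseteq> vecs K \<and> (\<exists>a\<in>A. a \<noteq> 0 \<and> (\<forall>v\<in>V. v \<bullet> a = 0))) \<and>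
      (\<forall>I n. (\<forall>a\<in>A. is_interval (I a)) \<longrightarrow> strips A I \<subseteq> cbox 0 1 \<longrightarrow> n \<noteq> 0 \<longrightarrow>
         cmod (ft (strips A I) n) \<le> C / norm n * (\<Sum>V\<in>\<V>. form_weight V n))"
proof -
  \<comment> \<open>The strip of the zero vector is unaffected by shifts, and \<open>{0}\<close> is
    not independent.\<close>
  let ?A = "A - {0}"
  have fA: "finite ?A" using A by simp
  have "\<forall>a\<in>?A. \<exists>C \<V>. decay_data K A {a} k C \<V>"
  proof
    fix a assume a: "a \<in> ?A"
    show "\<exists>C \<V>. decay_data K A {a} k C \<V>"
      by (rule exists_decay_data[OF K A]) (use a d in \<open>auto simp: independent_insert independent_empty\<close>)
  qed
  then obtain C \<V> where good: "\<And>a. a \<in> ?A \<Longrightarrow> decay_data K A {a} k (C a) (\<V> a)" by metis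
  define \<W> where "\<W> = (\<Union>a\<in>?A. \<V> a)"
  have fW: "finite \<W>" using fA decay_dataD(2)[OF good] by (auto simp: \<W>_def)
  define C' where "C' = (\<Sum>a\<in>?A. C a * norm a)"
  have C'0: "C' \<ge> 0" unfolding C'_def using decay_dataD(1)[OF good] by (intro sum_nonneg) auto
  have 1: "independent V \<and> card V = k \<and> V \<subseteq> vecs K \<and> (\<exists>a\<in>A. a \<noteq> 0 \<and> (\<forall>v\<in>V. v \<bullet> a = 0))"
    if V: "V \<in> \<W>" for V
  proof -
    obtain a where a: "a \<in> ?A" "V \<in> \<V> a" using V by (auto simp: \<W>_def)
    show ?thesis using decay_dataD(4-7)[OF good[OF a(1)] a(2)] a(1) by blast
  qed
  have 2: "cmod (ft (strips A I) n) \<le> C' / norm n * (\<Sum>V\<in>\<W>. form_weight V n)"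
    if I: "\<forall>a\<in>A. is_interval (I a)" "strips A I \<subseteq> cbox 0 1" and n: "n \<noteq> 0" for I n
  proof -
    define u where "u = n /\<^sub>R (2 * (norm n)\<^sup>2)"
    have nu: "n \<bullet> u = 1 / 2"
      using n by (simp add: u_def power2_norm_eq_inner)
    have au: "\<bar>a \<bullet> u\<bar> \<le> norm a / (2 * norm n)" for a
    proof -
      have "\<bar>a \<bullet> u\<bar> \<le> norm a * norm u" by (rule Cauchy_Schwarz_ineq2)
      also have "norm u = 1 / (2 * norm n)" using n by (simp add: u_def power2_eq_square field_simps)
      finally show ?thesis by simp
    qed
    define F where "F = (\<Sum>V\<in>\<W>. form_weight V n)"
    have F0: "F \<ge> 0" unfolding F_def by (simp add: sum_nonneg)
    have "cmod (ft (strips A I) n) \<le> 2 * (\<Sum>a\<in>{a\<in>A. a \<bullet> u \<noteq> 0}. C a * norm a / (2 * norm n) * F)"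
    proof (rule ft_strips_step[OF A(1)])
      fix a J
      assume a: "a \<in> A" "a \<bullet> u \<noteq> 0" and J: "\<And>b. b \<in> A \<Longrightarrow> is_interval (J b)" "\<And>b. b \<in> A \<Longrightarrow> J b \<subseteq> I b"
        "\<And>x y. x \<in> J a \<Longrightarrow> y \<in> J a \<Longrightarrow> \<bar>x - y\<bar> \<le> \<bar>a \<bullet> u\<bar>"
      have a': "a \<in> ?A" using a by auto
      note D = decay_dataD(1,2,8)[OF good[OF a']]
      have sJ: "strips A J \<subseteq> cbox 0 1" using I(2) J(2) by (fastforce simp: strips_def)
      have "cmod (ft (strips A J) n) \<le> C a * (\<Prod>b\<in>{a}. \<bar>b \<bullet> u\<bar>) * (\<Sum>V\<in>\<V> a. form_weight V n)"
        by (rule D(3)) (use a J sJ in auto)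
      also have "\<dots> = C a * \<bar>a \<bullet> u\<bar> * (\<Sum>V\<in>\<V> a. form_weight V n)" by simp
      also have "\<dots> \<le> C a * (norm a / (2 * norm n)) * F"
      proof (intro mult_mono order_refl au)
        show "(\<Sum>V\<in>\<V> a. form_weight V n) \<le> F"
          unfolding F_def by (rule sum_mono2[OF fW]) (use a' in \<open>auto simp: \<W>_def\<close>)
      qed (use D(1) in \<open>auto simp: sum_nonneg\<close>)
      finally show "cmod (ft (strips A J) n) \<le> C a * norm a / (2 * norm n) * F" by simp
    qed (use I bounded_subset[OF bounded_cbox I(2)] nu in auto)
    also have "\<dots> \<le> 2 * (\<Sum>a\<in>?A. C a * norm a / (2 * norm n) * F)"
    proof (intro mult_left_mono sum_mono2 fA)
      fix a assume "a \<in> ?A - {a\<in>A. a \<bullet> u \<noteq> 0}"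
      then have "C a \<ge> 0" using decay_dataD(1)[OF good] by blast
      then show "0 \<le> C a * norm a / (2 * norm n) * F" using F0 by simp
    qed auto
    also have "\<dots> = C' / norm n * F"
      by (simp add: C'_def sum_distrib_left sum_distrib_right sum_divide_distrib mult_ac)
    finally show ?thesis unfolding F_def .
  qed
  show ?thesis
    by (rule exI[of _ C'], rule conjI[OF C'0], rule exI[of _ \<W>], intro conjI fW ballI allI impI)
      (erule 1[THEN conjunct1] 1[THEN conjunct2, THEN conjunct1] 1[THEN conjunct2, THEN conjunct2, THEN conjunct1]
         1[THEN conjunct2, THEN conjunct2, THEN conjunct2] | rule 2; assumption)+
qed

section \<open>Separation of small denominators\<close>

definition int_pts :: "(real^'n) set" where
  "int_pts = {n. \<forall>i. n $ i \<in> \<int>}"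

lemma int_pts_diff: "m \<in> int_pts \<Longrightarrow> n \<in> int_pts \<Longrightarrow> m - n \<in> int_pts"
  by (simp add: int_pts_def)

lemma norm_int_pts_ge_1:
  assumes "n \<in> int_pts" "n \<noteq> 0" shows "norm n \<ge> 1"
proof -
  obtain i where i: "n $ i \<noteq> 0" using assms(2) by (auto simp: vec_eq_iff)
  have "n $ i \<in> \<int>" using assms(1) by (simp add: int_pts_def)
  then have "\<bar>n $ i\<bar> \<ge> 1" using i Ints_nonzero_abs_ge1 by blast
  then show ?thesis using component_le_norm_cart[of n i] by linarith
qed

lemma powr_neg_antimono:
  assumes "1 \<le> x" "x \<le> (y::real)" "0 \<le> g" shows "y powr - g \<le> x powr - g"
  using assms by (simp add: powr_mono2')

lemma dist_to_int_le: "m \<in> \<int> \<Longrightarrow> dist_to_int x \<le> \<bar>x - m\<bar>"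
  by (auto simp: dist_to_int_def round_diff_minimal elim!: Ints_cases)

lemma dist_to_int_int: "m \<in> \<int> \<Longrightarrow> dist_to_int m = 0"
  using dist_to_int_le[of m m] by (simp add: dist_to_int_def)

lemma dist_to_int_eq_0: "dist_to_int x = 0 \<longleftrightarrow> x \<in> \<int>"
  by (auto simp: dist_to_int_int) (metis Ints_of_int dist_to_int_def abs_eq_0 right_minus_eq)

text \<open>The restriction of the form \<open>x \<bullet> _\<close> to the hyperplane \<open>n \<bullet> \<alpha> = 0\<close>, in the first \<open>d - 1\<close> coordinates.\<close>

definition section_form :: "real^('m::finite option) \<Rightarrow> real^('m option) \<Rightarrow> real^'m" where
  "section_form \<alpha> x = (\<chi> i. x $ Some i - x $ None * \<alpha> $ Some i)"

lemma linear_section_form: "linear (section_form \<alpha>)"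
  by (rule linearI) (auto simp: section_form_def vec_eq_iff algebra_simps)

lemma section_form_eq_0:
  assumes "section_form \<alpha> x = 0" "\<alpha> $ None = 1"
  shows "x = (x $ None) *\<^sub>R \<alpha>"
proof -
  have "x $ i = (x $ None *\<^sub>R \<alpha>) $ i" for i
    using assms by (cases i) (auto simp: section_form_def vec_eq_iff)
  then show ?thesis by (subst vec_eq_iff) blast
qed

lemma inner_option:
  fixes x y :: "real^('m::finite option)"
  shows "x \<bullet> y = x $ None * y $ None + (\<Sum>i\<in>UNIV. x $ Some i * y $ Some i)"
  unfolding inner_vec_def by (simp add: UNIV_option_conv sum.reindex)

lemma section_form_inner:
  assumes "\<alpha> $ None = 1"
  shows "section_form \<alpha> v \<bullet> (\<chi> i. n $ Some i) = v \<bullet> n - v $ None * (n \<bullet> \<alpha>)"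
proof -
  have "section_form \<alpha> v \<bullet> (\<chi> i. n $ Some i) =
      (\<Sum>i\<in>UNIV. v $ Some i * n $ Some i) - v $ None * (\<Sum>i\<in>UNIV. n $ Some i * \<alpha> $ Some i)"
    by (simp add: section_form_def inner_vec_def algebra_simps sum_subtractf sum_distrib_left)
  then show ?thesis using assms by (simp add: inner_option algebra_simps)
qed

text \<open>The forms in \<open>V\<close> restrict to independent forms because the kernel of
  \<open>section_form \<alpha>\<close> is the line of \<open>\<alpha>\<close>, while
  \<open>span V\<close> is orthogonal to \<open>a\<close>. The finitely many exceptions are absorbed
  by the constant. The restricted forms differ from \<open>v \<bullet> n\<close> by a bounded amount
  when \<open>\<bar>n \<bullet> \<alpha>\<bar> < 1 / 2\<close>; this costs the factor
  \<open>D\<close>.\<close>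

lemma diophantine_lower_bound:
  fixes \<alpha> :: "real^('m::finite option)"
  assumes K: "real_subfield K" and \<alpha>: "\<alpha> \<in> vecs K" "\<alpha> $ None = 1"
    and dio: "diophantine_over K \<alpha>"
    and V: "V \<subseteq> vecs K" "independent V" "card V = CARD('m)"
    and a: "a \<bullet> \<alpha> \<noteq> 0" "\<forall>v\<in>V. v \<bullet> a = 0"
  shows "\<exists>\<gamma> c. 0 \<le> \<gamma> \<and> \<gamma> < 1 \<and> c > 0 \<and>
           (\<forall>n\<in>int_pts - {0}. \<bar>n \<bullet> \<alpha>\<bar> \<ge> c * norm n powr - \<gamma> * form_weight V n)"
proof -
  have fV: "finite V" using V(2) by (rule independent_imp_finite)
  obtain \<beta> :: "'m \<Rightarrow> real^('m option)" where \<beta>: "bij_betw \<beta> UNIV V"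
    using finite_same_card_bij[OF finite fV, of UNIV] V(3) by auto
  have \<beta>V: "\<beta> k \<in> V" for k using \<beta> unfolding bij_betw_def by blast
  define L where "L k = section_form \<alpha> (\<beta> k)" for k
  have "x \<bullet> a = 0" if "x \<in> span V" for x
    using that by (rule span_induct) (use a(2) in \<open>auto simp: subspace_def inner_left_distrib\<close>)
  then have inj: "inj_on (section_form \<alpha>) (span V)"
  proof (subst linear_inj_on_iff_eq_0[OF linear_section_form subspace_span], intro ballI impI)
    fix x assume x: "x \<in> span V" "section_form \<alpha> x = 0" and perp: "\<And>x. x \<in> span V \<Longrightarrow> x \<bullet> a = 0"
    have "x = (x $ None) *\<^sub>R \<alpha>" by (rule section_form_eq_0[OF x(2) \<alpha>(2)])
    moreover from this have "x $ None * (\<alpha> \<bullet> a) = 0" using perp[OF x(1)] by (metis inner_scaleR_left)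
    ultimately show "x = 0" using a(1) by (auto simp: inner_commute)
  qed
  have rL: "range L = section_form \<alpha> ` V" using \<beta> by (auto simp: L_def bij_betw_def image_image[symmetric])
  have "inj L"
  proof (rule injI)
    fix i j assume "L i = L j"
    then have "\<beta> i = \<beta> j" using inj \<beta>V span_base unfolding L_def inj_on_def by blast
    then show "i = j" using \<beta> unfolding bij_betw_def inj_def by blast
  qed
  moreover have "independent (range L)"
    unfolding rL by (rule linear_independent_injective_image[OF linear_section_form V(2) inj])
  moreover have "L k $ i \<in> K" for k i
  proof -
    have "\<beta> k $ j \<in> K" for j using \<beta>V V(1) unfolding vecs_def by blast
    moreover have "\<alpha> $ j \<in> K" for j using \<alpha>(1) unfolding vecs_def by blast
    ultimately show ?thesis using K by (simp add: L_def section_form_def real_subfieldD)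
  qed
  ultimately obtain \<gamma>0 where \<gamma>0: "\<gamma>0 < 1" and fin0: "finite {n :: real^'m. (\<forall>i. n $ i \<in> \<int>) \<and>
            dist_to_int (\<Sum>i\<in>UNIV. \<alpha> $ Some i * n $ i) * (\<Prod>k\<in>UNIV. \<bar>L k \<bullet> n\<bar> + 1) < norm n powr (- \<gamma>0)}"
    using dio unfolding diophantine_over_def by blast
  define f where "f m = (\<Sum>i\<in>UNIV. \<alpha> $ Some i * m $ i)" for m :: "real^'m"
  define F where "F m = dist_to_int (f m) * (\<Prod>k\<in>UNIV. \<bar>L k \<bullet> m\<bar> + 1)" for m
  define Bad where "Bad = {n \<in> int_pts. F n < norm n powr (- \<gamma>0)}"
  have fin: "finite Bad" using fin0 by (simp add: Bad_def F_def f_def int_pts_def)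
  \<comment> \<open>Negative exponents are raised to 0, so that
    \<open>norm n powr - \<gamma>\<close> does not increase with the norm; the exponent stays below
    1.\<close>
  define \<gamma> where "\<gamma> = max \<gamma>0 0"
  \<comment> \<open>An integral \<open>f m\<close> would make every multiple
    \<open>real (Suc N) *\<^sub>R m\<close> a solution of the inequality, giving infinitely
    many.\<close>
  have Fpos: "F m > 0" if m: "m \<in> int_pts" "m \<noteq> 0" for m
  proof -
    have "f m \<notin> \<int>"
    proof
      assume fm: "f m \<in> \<int>"
      define g where "g N = real (Suc N) *\<^sub>R m" for N
      have "g N \<in> Bad" for N
      proof -
        have "f (g N) = real (Suc N) * f m"
          by (simp add: f_def g_def sum_distrib_left mult_ac del: of_nat_Suc)
        then have "f (g N) \<in> \<int>" using fm by (metis Ints_mult Ints_of_nat)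
        then have "F (g N) = 0" by (simp add: F_def dist_to_int_int)
        moreover have "g N \<noteq> 0" using m(2) by (simp add: g_def del: of_nat_Suc)
        moreover have "g N \<in> int_pts" using m(1) by (auto simp: g_def int_pts_def simp del: of_nat_Suc)
        ultimately show ?thesis by (simp add: Bad_def)
      qed
      then have "range g \<subseteq> Bad" by blast
      moreover have "inj g" using m(2) by (auto simp: inj_def g_def simp del: of_nat_Suc)
      ultimately show False using fin finite_subset range_inj_infinite by blast
    qed
    then have "dist_to_int (f m) > 0" using dist_to_int_eq_0[of "f m"] by (auto simp: dist_to_int_def)
    then show ?thesis unfolding F_def by (intro mult_pos_pos prod_pos) auto
  qed
  \<comment> \<open>The least ratio over the finitely many exceptions; the extra 1 keeps
    \<open>c0 \<le> 1\<close>, as the other points require, and covers the case of no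
    exceptions.\<close>
  define c0 where "c0 = Min (insert 1 ((\<lambda>m. F m * norm m powr \<gamma>) ` (Bad - {0})))"
  have c0: "c0 > 0" unfolding c0_def
    using fin Fpos by (subst Min_gr_iff) (auto simp: Bad_def)
  have c01: "c0 \<le> 1" unfolding c0_def using fin by (intro Min_le) auto
  have low: "F m \<ge> c0 * norm m powr - \<gamma>" if m: "m \<in> int_pts" "m \<noteq> 0" for m
  proof (cases "m \<in> Bad")
    case True
    then have "c0 \<le> F m * norm m powr \<gamma>" unfolding c0_def using fin m by (intro Min_le) auto
    then show ?thesis using m(2) by (simp add: powr_minus field_simps)
  next
    case False
    have n1: "norm m \<ge> 1" by (rule norm_int_pts_ge_1[OF m])
    have "c0 * norm m powr - \<gamma> \<le> 1 * norm m powr - \<gamma>" using c01 by (intro mult_right_mono) auto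
    also have "\<dots> \<le> norm m powr - \<gamma>0" using n1 by (simp add: \<gamma>_def powr_mono)
    also have "\<dots> \<le> F m" using False m by (simp add: Bad_def)
    finally show ?thesis .
  qed
  define D where "D = (\<Prod>v\<in>V. 1 + \<bar>v $ None\<bar>)"
  have D1: "D \<ge> 1" unfolding D_def by (rule prod_ge_1) auto
  \<comment> \<open>The factor 2 gives \<open>c \<le> 1 / 2\<close>, which settles the points with
    \<open>\<bar>n \<bullet> \<alpha>\<bar> \<ge> 1 / 2\<close> at once.\<close>
  define c where "c = c0 / (2 * D)"
  have c: "c > 0" "c \<le> 1 / 2" using c0 c01 D1 by (auto simp: c_def field_simps)
  have main: "\<bar>n \<bullet> \<alpha>\<bar> \<ge> c * norm n powr - \<gamma> * form_weight V n" if n: "n \<in> int_pts" "n \<noteq> 0" for n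
  proof -
    have n1: "norm n \<ge> 1" by (rule norm_int_pts_ge_1[OF n])
    have g0: "\<gamma> \<ge> 0" by (simp add: \<gamma>_def)
    have l1: "form_weight V n \<le> 1" unfolding form_weight_def by (rule prod_le_1) auto
    have p1: "norm n powr - \<gamma> \<le> 1" using powr_neg_antimono[of 1 "norm n" \<gamma>] n1 g0 by simp
    show ?thesis
    proof (cases "\<bar>n \<bullet> \<alpha>\<bar> \<ge> 1 / 2")
      case True
      have "c * norm n powr - \<gamma> * form_weight V n \<le> 1 / 2 * 1 * 1"
        using c l1 p1 by (intro mult_mono) auto
      then show ?thesis using True by simp
    next
      case False
      define m where "m = (\<chi> i. n $ Some i)"
      have mi: "m \<in> int_pts" using n(1) by (simp add: m_def int_pts_def)
      have nN: "n $ None \<in> \<int>" using n(1) by (simp add: int_pts_def)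
      have nf: "n \<bullet> \<alpha> = f m + n $ None"
        using \<alpha>(2) by (simp add: f_def m_def inner_option mult_ac)
      \<comment> \<open>Otherwise \<open>n \<bullet> \<alpha>\<close> would be the nonzero integer
        \<open>n $ None\<close>, contrary to
        \<open>\<bar>n \<bullet> \<alpha>\<bar> < 1 / 2\<close>.\<close>
      have m0: "m \<noteq> 0"
      proof
        assume "m = 0"
        then have z: "n $ Some i = 0" for i by (simp add: m_def vec_eq_iff)
        have "n $ None \<noteq> 0"
        proof
          assume "n $ None = 0"
          then have "n $ i = 0" for i using z by (cases i) auto
          then show False using n(2) by (simp add: vec_eq_iff)
        qed
        then have "\<bar>n $ None\<bar> \<ge> 1" using nN Ints_nonzero_abs_ge1 by blast
        moreover have "f m = 0" using \<open>m = 0\<close> by (simp add: f_def)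
        ultimately show False using False nf by simp
      qed
      have "norm m \<le> norm n"
      proof -
        have "m \<bullet> m \<le> n \<bullet> n" by (simp add: inner_option m_def) (simp add: inner_vec_def)
        then show ?thesis by (simp add: norm_le)
      qed
      then have "c0 * norm n powr - \<gamma> \<le> c0 * norm m powr - \<gamma>"
        using c0 norm_int_pts_ge_1[OF mi m0] g0 by (intro mult_left_mono powr_neg_antimono) auto
      also have "\<dots> \<le> F m" by (rule low[OF mi m0])
      also have "\<dots> \<le> \<bar>n \<bullet> \<alpha>\<bar> * (D / form_weight V n)"
        unfolding F_def
      proof (rule mult_mono)
        show "dist_to_int (f m) \<le> \<bar>n \<bullet> \<alpha>\<bar>"
          using dist_to_int_le[of "- (n $ None)" "f m"] nN nf by simp
        have "(\<Prod>k\<in>UNIV. \<bar>L k \<bullet> m\<bar> + 1) \<le> (\<Prod>k\<in>UNIV. (1 + \<bar>\<beta> k $ None\<bar>) * (1 + \<bar>\<beta> k \<bullet> n\<bar>))"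
        proof (rule prod_mono, intro conjI)
          fix k
          have "\<bar>L k \<bullet> m\<bar> \<le> \<bar>\<beta> k \<bullet> n\<bar> + \<bar>\<beta> k $ None\<bar> * \<bar>n \<bullet> \<alpha>\<bar>"
            unfolding L_def m_def section_form_inner[OF \<alpha>(2)] by (metis abs_mult abs_triangle_ineq4)
          also have "\<bar>\<beta> k $ None\<bar> * \<bar>n \<bullet> \<alpha>\<bar> \<le> \<bar>\<beta> k $ None\<bar> * 1"
            using False by (intro mult_left_mono) auto
          finally have Lk: "\<bar>L k \<bullet> m\<bar> \<le> \<bar>\<beta> k \<bullet> n\<bar> + \<bar>\<beta> k $ None\<bar>" by simp
          show "\<bar>L k \<bullet> m\<bar> + 1 \<le> (1 + \<bar>\<beta> k $ None\<bar>) * (1 + \<bar>\<beta> k \<bullet> n\<bar>)"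
          proof -
            have "0 \<le> \<bar>\<beta> k $ None\<bar> * \<bar>\<beta> k \<bullet> n\<bar>" by simp
            moreover have "(1 + \<bar>\<beta> k $ None\<bar>) * (1 + \<bar>\<beta> k \<bullet> n\<bar>) =
                1 + \<bar>\<beta> k $ None\<bar> + \<bar>\<beta> k \<bullet> n\<bar> + \<bar>\<beta> k $ None\<bar> * \<bar>\<beta> k \<bullet> n\<bar>"
              by (simp add: distrib_left distrib_right)
            ultimately show ?thesis using Lk by linarith
          qed
        qed auto
        also have "\<dots> = (\<Prod>v\<in>V. (1 + \<bar>v $ None\<bar>) * (1 + \<bar>v \<bullet> n\<bar>))"
          by (rule prod.reindex_bij_betw[OF \<beta>])
        also have "\<dots> = D / form_weight V n"
          by (simp add: D_def form_weight_def prod.distrib prod_dividef)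
        finally show "(\<Prod>k\<in>UNIV. \<bar>L k \<bullet> m\<bar> + 1) \<le> D / form_weight V n" .
      qed (auto intro!: prod_nonneg)
      finally have "c0 * norm n powr - \<gamma> * form_weight V n \<le> \<bar>n \<bullet> \<alpha>\<bar> * D"
        using form_weight_pos[of V n] by (simp add: field_simps)
      then have "2 * (c * norm n powr - \<gamma> * form_weight V n) \<le> \<bar>n \<bullet> \<alpha>\<bar>"
        using D1 by (simp add: c_def field_simps)
      moreover have "0 \<le> c * norm n powr - \<gamma> * form_weight V n" using c by simp
      ultimately show ?thesis by linarith
    qed
  qed
  show ?thesis
    by (intro exI[of _ \<gamma>] exI[of _ c]) (use main c \<gamma>0 in \<open>auto simp: \<gamma>_def\<close>)
qed

section \<open>Reciprocal sums over separated points\<close>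

lemma sum_inverse_le_ln: "N \<ge> 1 \<Longrightarrow> (\<Sum>j=1..N. 1 / real j) \<le> 1 + ln (real N)"
proof (induction N rule: dec_induct)
  case base then show ?case by simp
next
  case (step N)
  have "ln (real N / real (Suc N)) \<le> real N / real (Suc N) - 1"
    using step by (intro ln_le_minus_one) auto
  also have "\<dots> = - (1 / real (Suc N))" by (simp add: field_simps)
  finally have "1 / real (Suc N) \<le> ln (real (Suc N)) - ln (real N)"
    using step by (simp add: ln_div)
  then show ?case using step by simp
qed

text \<open>In increasing order the \<open>j\<close>-th point is at least
  \<open>j * \<delta>\<close>. The clause on \<open>Max X\<close> carries this through the
  induction, which adds the largest point last.\<close>

lemma sum_inverse_separated_pos:
  fixes X :: "real set" and \<delta> :: real
  assumes "finite X" "\<delta> > 0" "\<And>x. x \<in> X \<Longrightarrow> x \<ge> \<delta>"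
    "\<And>x y. x \<in> X \<Longrightarrow> y \<in> X \<Longrightarrow> x \<noteq> y \<Longrightarrow> \<bar>x - y\<bar> \<ge> \<delta>"
  shows "(\<Sum>x\<in>X. 1 / x) \<le> (\<Sum>j=1..card X. 1 / real j) / \<delta> \<and> (X \<noteq> {} \<longrightarrow> Max X \<ge> card X * \<delta>)"
  using assms
proof (induction X rule: finite_linorder_max_induct)
  case empty then show ?case by simp
next
  case (insert b X)
  have IH: "(\<Sum>x\<in>X. 1 / x) \<le> (\<Sum>j=1..card X. 1 / real j) / \<delta>" "X \<noteq> {} \<longrightarrow> Max X \<ge> card X * \<delta>"
    using insert.IH insert.prems by blast+
  have bX: "b \<notin> X" using insert.hyps(2) by blast
  have b: "b \<ge> real (Suc (card X)) * \<delta>"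
  proof (cases "X = {}")
    case True then show ?thesis using insert.prems by simp
  next
    case False
    then have "Max X \<in> X" using insert.hyps(1) by simp
    then have "b - Max X \<ge> \<delta>" using insert.hyps(2) insert.prems(3)[of b "Max X"] by fastforce
    then show ?thesis using IH(2) False by (simp add: algebra_simps)
  qed
  have "1 / b \<le> 1 / (real (Suc (card X)) * \<delta>)"
    using b insert.prems(1) by (intro divide_left_mono) (auto intro!: mult_pos_pos less_le_trans[OF _ b] simp del: of_nat_Suc)
  then have "(\<Sum>x\<in>insert b X. 1 / x) \<le> (\<Sum>j=1..card X. 1 / real j) / \<delta> + 1 / (real (Suc (card X)) * \<delta>)"
    using IH(1) bX insert.hyps(1) by simp
  also have "\<dots> = (\<Sum>j=1..Suc (card X). 1 / real j) / \<delta>"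
    by (simp add: add_divide_distrib)
  finally have "(\<Sum>x\<in>insert b X. 1 / x) \<le> (\<Sum>j=1..card (insert b X). 1 / real j) / \<delta>"
    using bX insert.hyps(1) by simp
  moreover have "Max (insert b X) = b"
    using insert.hyps by (intro Max_eqI) (auto simp: less_imp_le)
  ultimately show ?case using b bX insert.hyps(1) by simp
qed

lemma sum_inverse_separated:
  fixes X :: "real set" and \<delta> :: real
  assumes X: "finite X" and "\<delta> > 0" and x: "\<And>x. x \<in> X \<Longrightarrow> \<bar>x\<bar> \<ge> \<delta>"
    and xy: "\<And>x y. x \<in> X \<Longrightarrow> y \<in> X \<Longrightarrow> x \<noteq> y \<Longrightarrow> \<bar>x - y\<bar> \<ge> \<delta>" and N: "card X \<le> N" "N \<ge> 1"
  shows "(\<Sum>x\<in>X. 1 / \<bar>x\<bar>) \<le> 2 * (1 + ln N) / \<delta>"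
proof -
  have *: "(\<Sum>x\<in>Y. 1 / x) \<le> (1 + ln N) / \<delta>"
    if Y: "finite Y" "\<And>x. x \<in> Y \<Longrightarrow> x \<ge> \<delta>" "\<And>x y. x \<in> Y \<Longrightarrow> y \<in> Y \<Longrightarrow> x \<noteq> y \<Longrightarrow> \<bar>x - y\<bar> \<ge> \<delta>" "card Y \<le> N" for Y
  proof -
    have "(\<Sum>x\<in>Y. 1 / x) \<le> (\<Sum>j=1..card Y. 1 / real j) / \<delta>"
      using sum_inverse_separated_pos[OF Y(1) \<open>\<delta> > 0\<close> Y(2,3)] by blast
    also have "\<dots> \<le> (\<Sum>j=1..N. 1 / real j) / \<delta>"
      using \<open>\<delta> > 0\<close> Y(4) by (intro divide_right_mono sum_mono2) auto
    also have "\<dots> \<le> (1 + ln N) / \<delta>"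
      using \<open>\<delta> > 0\<close> sum_inverse_le_ln[OF N(2)] by (intro divide_right_mono) auto
    finally show ?thesis .
  qed
  let ?P = "{x\<in>X. x > 0}" and ?M = "{x\<in>X. x < 0}"
  have "0 \<notin> X" using x[of 0] \<open>\<delta> > 0\<close> by auto
  then have eq: "X = ?P \<union> ?M" by (auto simp: not_less) (metis order_le_less)
  have "(\<Sum>x\<in>X. 1 / \<bar>x\<bar>) = (\<Sum>x\<in>?P. 1 / \<bar>x\<bar>) + (\<Sum>x\<in>?M. 1 / \<bar>x\<bar>)"
    by (subst eq, rule sum.union_disjoint) (use X in auto)
  also have "(\<Sum>x\<in>?P. 1 / \<bar>x\<bar>) = (\<Sum>x\<in>?P. 1 / x)" by (rule sum.cong) auto
  also have "(\<Sum>x\<in>?M. 1 / \<bar>x\<bar>) = (\<Sum>x\<in>uminus ` ?M. 1 / x)"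
    by (subst sum.reindex) (auto intro!: sum.cong)
  also have "(\<Sum>x\<in>?P. 1 / x) \<le> (1 + ln N) / \<delta>"
  proof (rule *)
    show "card ?P \<le> N" using N card_mono[OF X, of ?P] by auto
    show "\<delta> \<le> y" if "y \<in> ?P" for y using x[of y] that by auto
  qed (use X xy in auto)
  also have "(\<Sum>x\<in>uminus ` ?M. 1 / x) \<le> (1 + ln N) / \<delta>"
  proof (rule *)
    have "card (uminus ` ?M) \<le> card ?M" using X by (intro card_image_le) auto
    then show "card (uminus ` ?M) \<le> N" using N card_mono[OF X, of ?M] by auto
    show "\<delta> \<le> y" if "y \<in> uminus ` ?M" for y using x[of "- y"] that by auto
    show "\<bar>y - z\<bar> \<ge> \<delta>" if "y \<in> uminus ` ?M" "z \<in> uminus ` ?M" "y \<noteq> z" for y z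
      using xy[of "- y" "- z"] that by auto
  qed (use X in auto)
  finally show ?thesis by simp
qed

section \<open>Dyadic decomposition of the frequencies\<close>

lemma card_int_pts_le:
  "finite {n \<in> int_pts. norm (n::real^'n) \<le> real R} \<and>
   card {n \<in> int_pts. norm (n::real^'n) \<le> real R} \<le> (2 * R + 1) ^ CARD('n)"
proof -
  let ?S = "{n \<in> int_pts. norm (n::real^'n) \<le> real R}"
  let ?T = "PiE (UNIV :: 'n set) (\<lambda>_. {- int R..int R})"
  define \<phi> where "\<phi> n = (\<lambda>i. \<lfloor>n $ i\<rfloor>)" for n :: "real^'n"
  have fl: "of_int \<lfloor>n $ i\<rfloor> = n $ i" if "n \<in> int_pts" for n :: "real^'n" and i
  proof -
    have "n $ i \<in> \<int>" using that by (simp add: int_pts_def)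
    then show ?thesis by (rule of_int_floor)
  qed
  have inj: "inj_on \<phi> ?S"
  proof (rule inj_onI)
    fix x y assume "x \<in> ?S" "y \<in> ?S" "\<phi> x = \<phi> y"
    then have "x $ i = y $ i" for i using fl[of x i] fl[of y i] by (auto simp: \<phi>_def dest: fun_cong[of _ _ i])
    then show "x = y" by (simp add: vec_eq_iff)
  qed
  have sub: "\<phi> ` ?S \<subseteq> ?T"
  proof clarify
    fix n :: "real^'n" assume n: "n \<in> int_pts" "norm n \<le> real R"
    have "\<lfloor>n $ i\<rfloor> \<in> {- int R..int R}" for i
    proof -
      have "\<bar>n $ i\<bar> \<le> real R" using component_le_norm_cart[of n i] n(2) by linarith
      then have "\<bar>real_of_int \<lfloor>n $ i\<rfloor>\<bar> \<le> real R" by (simp only: fl[OF n(1), of i])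
      then show ?thesis by auto
    qed
    then show "\<phi> n \<in> ?T" by (simp add: \<phi>_def PiE_def Pi_def extensional_UNIV)
  qed
  have fT: "finite ?T" by (intro finite_PiE) auto
  have "card ?T = (2 * R + 1) ^ CARD('n)"
    by (simp add: card_PiE nat_add_distrib nat_mult_distrib)
  then show ?thesis using inj_on_finite[OF inj sub fT] card_inj_on_le[OF inj sub fT] by simp
qed

text \<open>The lower bound is used both for \<open>n\<close> and for differences
  \<open>n - n'\<close>; the doubling in the second case explains \<open>2 ^ (k + 2)\<close> and the
  factors 4. The number of lattice points, at most exponential in \<open>k\<close>, enters only
  through its logarithm, hence the linear factor in \<open>k\<close>.\<close>

lemma sum_dyadic_cell_le:
  fixes \<alpha> :: "real^'n"
  assumes V: "finite V" and g: "0 \<le> \<gamma>" and c: "c > 0"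
    and low: "\<And>n. n \<in> int_pts \<Longrightarrow> n \<noteq> 0 \<Longrightarrow> \<bar>n \<bullet> \<alpha>\<bar> \<ge> c * norm n powr - \<gamma> * form_weight V n"
    and B: "B \<subseteq> int_pts" "\<And>n. n \<in> B \<Longrightarrow> 2 ^ k \<le> norm n" "\<And>n. n \<in> B \<Longrightarrow> norm n < 2 ^ (k + 1)"
      "\<And>n v. n \<in> B \<Longrightarrow> v \<in> V \<Longrightarrow> 2 ^ e v \<le> 1 + \<bar>v \<bullet> n\<bar>"
      "\<And>n v. n \<in> B \<Longrightarrow> v \<in> V \<Longrightarrow> 1 + \<bar>v \<bullet> n\<bar> < 2 ^ (e v + 1)"
  shows "(\<Sum>n\<in>B. 1 / norm n * form_weight V n / \<bar>n \<bullet> \<alpha>\<bar>)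
     \<le> 2 * 4 ^ card V / c * (1 + real CARD('n) * (real k + 3)) * ((2 ^ (k + 2)) powr \<gamma> / 2 ^ k)"
proof -
  define W where "W = (\<Prod>v\<in>V. (2::real) ^ e v)"
  have W: "W > 0" unfolding W_def by (rule prod_pos) auto
  define \<delta> where "\<delta> = c * (2 ^ (k + 2)) powr - \<gamma> / (4 ^ card V * W)"
  have \<delta>: "\<delta> > 0" using c W by (simp add: \<delta>_def)
  have key: "\<bar>m \<bullet> \<alpha>\<bar> \<ge> \<delta>"
    if m: "m \<in> int_pts" "m \<noteq> 0" "norm m \<le> 2 ^ (k + 2)" "\<And>v. v \<in> V \<Longrightarrow> 1 + \<bar>v \<bullet> m\<bar> \<le> 4 * 2 ^ e v" for m
  proof -
    have "1 / (4 ^ card V * W) = (\<Prod>v\<in>V. 1 / (4 * 2 ^ e v))"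
      by (simp add: W_def prod_dividef prod.distrib)
    also have "\<dots> \<le> form_weight V m"
      unfolding form_weight_def using m(4) by (intro prod_mono conjI divide_left_mono) (auto intro!: mult_pos_pos add_pos_nonneg)
    finally have 1: "1 / (4 ^ card V * W) \<le> form_weight V m" .
    have "\<delta> = c * (2 ^ (k + 2)) powr - \<gamma> * (1 / (4 ^ card V * W))" by (simp add: \<delta>_def)
    also have "\<dots> \<le> c * norm m powr - \<gamma> * form_weight V m"
      using c 1 W powr_neg_antimono[OF norm_int_pts_ge_1[OF m(1,2)] m(3) g]
      by (intro mult_mono) (auto intro!: mult_nonneg_nonneg)
    also have "\<dots> \<le> \<bar>m \<bullet> \<alpha>\<bar>" by (rule low[OF m(1,2)])
    finally show ?thesis .
  qed
  have n0: "n \<noteq> 0" if "n \<in> B" for n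
  proof -
    have "(0::real) < 2 ^ k" by simp
    also have "\<dots> \<le> norm n" by (rule B(2)[OF that])
    finally show ?thesis by simp
  qed
  have k1: "\<bar>n \<bullet> \<alpha>\<bar> \<ge> \<delta>" if n: "n \<in> B" for n
  proof (rule key)
    show "norm n \<le> 2 ^ (k + 2)"
      using B(3)[OF n] power_increasing[of "k + 1" "k + 2" "2::real"] by linarith
    show "1 + \<bar>v \<bullet> n\<bar> \<le> 4 * 2 ^ e v" if "v \<in> V" for v using B(5)[OF n that] by simp
  qed (use n n0 B in auto)
  have k2: "\<bar>n \<bullet> \<alpha> - n' \<bullet> \<alpha>\<bar> \<ge> \<delta>" if n: "n \<in> B" "n' \<in> B" "n \<noteq> n'" for n n'
  proof -
    have "\<bar>(n - n') \<bullet> \<alpha>\<bar> \<ge> \<delta>"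
    proof (rule key)
      show "n - n' \<in> int_pts" using n B(1) by (auto intro: int_pts_diff)
      show "norm (n - n') \<le> 2 ^ (k + 2)"
        using B(3)[OF n(1)] B(3)[OF n(2)] norm_triangle_ineq4[of n n'] by simp
      show "1 + \<bar>v \<bullet> (n - n')\<bar> \<le> 4 * 2 ^ e v" if "v \<in> V" for v
        using B(5)[OF n(1) that] B(5)[OF n(2) that] by (simp add: inner_diff_right)
    qed (use n in auto)
    then show ?thesis by (simp add: inner_diff_left)
  qed
  have inj: "inj_on (\<lambda>n. n \<bullet> \<alpha>) B"
    using k2 \<delta> by (intro inj_onI) fastforce
  let ?R = "2 ^ (k + 1) :: nat"
  have BR: "B \<subseteq> {n \<in> int_pts. norm n \<le> real ?R}"
  proof
    fix n assume n: "n \<in> B"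
    have "norm n \<le> real ?R" using less_imp_le[OF B(3)[OF n]] by simp
    then show "n \<in> {n \<in> int_pts. norm n \<le> real ?R}" using n B(1) by blast
  qed
  have fB: "finite B" using finite_subset[OF BR] card_int_pts_le by blast
  have "card B \<le> (2 * ?R + 1) ^ CARD('n)"
    using card_mono[OF _ BR] card_int_pts_le[where 'n = 'n, of ?R] by linarith
  also have "\<dots> \<le> (2 ^ (k + 3)) ^ CARD('n)"
  proof (intro power_mono)
    have "(1::nat) \<le> 2 ^ k" by simp
    then show "2 * ?R + 1 \<le> 2 ^ (k + 3)" by (simp add: power_add)
  qed simp
  finally have cB: "card B \<le> 2 ^ ((k + 3) * CARD('n))" by (simp only: power_mult)
  have "(\<Sum>n\<in>B. 1 / \<bar>n \<bullet> \<alpha>\<bar>) = (\<Sum>x\<in>(\<lambda>n. n \<bullet> \<alpha>) ` B. 1 / \<bar>x\<bar>)"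
    by (simp add: sum.reindex[OF inj])
  also have "\<dots> \<le> 2 * (1 + ln (real (2 ^ ((k + 3) * CARD('n))))) / \<delta>"
  proof (rule sum_inverse_separated[OF _ \<delta>])
    show "card ((\<lambda>n. n \<bullet> \<alpha>) ` B) \<le> 2 ^ ((k + 3) * CARD('n))"
      using card_image_le[OF fB, of "\<lambda>n. n \<bullet> \<alpha>"] cB by linarith
  qed (use fB k1 k2 in auto)
  also have "ln (real (2 ^ ((k + 3) * CARD('n)))) = real ((k + 3) * CARD('n)) * ln 2"
    by (simp add: ln_realpow)
  also have "2 * (1 + real ((k + 3) * CARD('n)) * ln 2) / \<delta> \<le> 2 * (1 + real CARD('n) * (real k + 3)) / \<delta>"
  proof -
    have "ln (2::real) \<le> 1" using ln_le_minus_one[of "2::real"] by simp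
    then have "real ((k + 3) * CARD('n)) * ln 2 \<le> real ((k + 3) * CARD('n)) * 1"
      by (intro mult_left_mono) auto
    then show ?thesis using \<delta> by (intro divide_right_mono mult_left_mono) (auto simp: algebra_simps)
  qed
  finally have S: "(\<Sum>n\<in>B. 1 / \<bar>n \<bullet> \<alpha>\<bar>) \<le> 2 * (1 + real CARD('n) * (real k + 3)) / \<delta>" .
  have "(\<Sum>n\<in>B. 1 / norm n * form_weight V n / \<bar>n \<bullet> \<alpha>\<bar>) \<le> (\<Sum>n\<in>B. 1 / 2 ^ k * (1 / W) * (1 / \<bar>n \<bullet> \<alpha>\<bar>))"
  proof (rule sum_mono)
    fix n assume n: "n \<in> B"
    have "form_weight V n \<le> (\<Prod>v\<in>V. 1 / 2 ^ e v)"
      unfolding form_weight_def using B(4)[OF n] by (intro prod_mono conjI divide_left_mono) (auto intro!: mult_pos_pos add_pos_nonneg)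
    also have "\<dots> = 1 / W" by (simp add: W_def prod_dividef)
    finally have "form_weight V n \<le> 1 / W" .
    moreover have "1 / norm n \<le> 1 / 2 ^ k"
      using B(2)[OF n] n0[OF n] by (intro divide_left_mono) auto
    ultimately have "1 / norm n * form_weight V n \<le> 1 / 2 ^ k * (1 / W)" by (intro mult_mono) auto
    then have "1 / norm n * form_weight V n * (1 / \<bar>n \<bullet> \<alpha>\<bar>) \<le> 1 / 2 ^ k * (1 / W) * (1 / \<bar>n \<bullet> \<alpha>\<bar>)"
      by (rule mult_right_mono) simp
    then show "1 / norm n * form_weight V n / \<bar>n \<bullet> \<alpha>\<bar> \<le> 1 / 2 ^ k * (1 / W) * (1 / \<bar>n \<bullet> \<alpha>\<bar>)" by simp
  qed
  also have "\<dots> = 1 / 2 ^ k * (1 / W) * (\<Sum>n\<in>B. 1 / \<bar>n \<bullet> \<alpha>\<bar>)" by (rule sum_distrib_left[symmetric])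
  also have "\<dots> \<le> 1 / 2 ^ k * (1 / W) * (2 * (1 + real CARD('n) * (real k + 3)) / \<delta>)"
    using W by (intro mult_left_mono S) auto
  \<comment> \<open>\<open>1 / \<delta>\<close> contains \<open>W\<close>, which cancels the bound
    \<open>1 / W\<close> for the weight: the result no longer depends on the exponents
    \<open>e\<close> of the cell.\<close>
  also have "\<dots> = 2 * 4 ^ card V / c * (1 + real CARD('n) * (real k + 3)) * ((2 ^ (k + 2)) powr \<gamma> / 2 ^ k)"
    using W c by (simp add: \<delta>_def powr_minus divide_simps)
  finally show ?thesis .
qed

lemma dyadic_scale:
  assumes "x \<ge> (1::real)" shows "\<exists>j::nat. 2 ^ j \<le> x \<and> x < 2 ^ (j + 1)"
proof -
  obtain N where N: "x < 2 ^ N" using real_arch_pow[of 2 x] by auto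
  define j where "j = (LEAST N. x < 2 ^ N)"
  have j: "x < 2 ^ j" unfolding j_def using N by (rule LeastI)
  have "j \<noteq> 0" using j assms by (intro notI) simp
  then obtain i where i: "j = Suc i" by (cases j) auto
  have "\<not> x < 2 ^ i" using not_less_Least[of i "\<lambda>N. x < 2 ^ N"] i by (simp add: j_def)
  then show ?thesis using j i by (intro exI[of _ i]) auto
qed

text \<open>By Cauchy-Schwarz \<open>1 + \<bar>v \<bullet> n\<bar> < 2 ^ (k + q)\<close> on the
  shell, so each form has only \<open>k + q\<close> dyadic scales and
  \<open>(k + q) ^ card V\<close> cells cover the shell, all with the same bound.\<close>

lemma sum_dyadic_shell_le:
  fixes \<alpha> :: "real^'n"
  assumes V: "finite V" and g: "0 \<le> \<gamma>" and c: "c > 0"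
    and low: "\<And>n. n \<in> int_pts \<Longrightarrow> n \<noteq> 0 \<Longrightarrow> \<bar>n \<bullet> \<alpha>\<bar> \<ge> c * norm n powr - \<gamma> * form_weight V n"
    and q: "\<And>v. v \<in> V \<Longrightarrow> 1 + 2 * norm v < 2 ^ q"
    and F: "finite F" "F \<subseteq> int_pts" "\<And>n. n \<in> F \<Longrightarrow> 2 ^ k \<le> norm n" "\<And>n. n \<in> F \<Longrightarrow> norm n < 2 ^ (k + 1)"
  shows "(\<Sum>n\<in>F. 1 / norm n * form_weight V n / \<bar>n \<bullet> \<alpha>\<bar>) \<le>
      (real k + real q) ^ card V *
      (2 * 4 ^ card V / c * (1 + real CARD('n) * (real k + 3)) * ((2 ^ (k + 2)) powr \<gamma> / 2 ^ k))"
proof -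
  have "\<forall>(n::real^'n) v. \<exists>j::nat. 2 ^ j \<le> 1 + \<bar>v \<bullet> n\<bar> \<and> 1 + \<bar>v \<bullet> n\<bar> < 2 ^ (j + 1)"
    using dyadic_scale by auto
  then obtain e where e: "\<And>n v :: real^'n. 2 ^ e n v \<le> 1 + \<bar>v \<bullet> n\<bar>" "\<And>n v :: real^'n. 1 + \<bar>v \<bullet> n\<bar> < 2 ^ (e n v + 1)"
    by metis
  define E where "E n = restrict (e n) V" for n
  let ?T = "PiE V (\<lambda>_. {..<k + q})"
  have fT: "finite ?T" using V by (intro finite_PiE) auto
  let ?g = "\<lambda>n. 1 / norm n * form_weight V n / \<bar>n \<bullet> \<alpha>\<bar>"
  let ?b = "2 * 4 ^ card V / c * (1 + real CARD('n) * (real k + 3)) * ((2 ^ (k + 2)) powr \<gamma> / 2 ^ k)"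
  have sub: "E ` F \<subseteq> ?T"
  proof clarify
    fix n assume n: "n \<in> F"
    have "e n v < k + q" if v: "v \<in> V" for v
    proof -
      have "1 \<le> (2::real) ^ k" by simp
      have "(2::real) ^ e n v \<le> 1 + \<bar>v \<bullet> n\<bar>" by (rule e)
      also have "\<dots> \<le> 1 + norm v * norm n" using Cauchy_Schwarz_ineq2[of v n] by simp
      also have "\<dots> \<le> 1 + norm v * 2 ^ (k + 1)" using F(4)[OF n] by (intro add_left_mono mult_left_mono) auto
      also have "\<dots> \<le> 2 ^ k * (1 + 2 * norm v)" using \<open>1 \<le> 2 ^ k\<close> by (simp add: algebra_simps)
      also have "\<dots> < 2 ^ k * 2 ^ q" using q[OF v] by (intro mult_strict_left_mono) auto
      finally have "(2::real) ^ e n v < 2 ^ (k + q)" by (simp add: power_add)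
      then show ?thesis by simp
    qed
    then show "E n \<in> ?T" by (auto simp: E_def)
  qed
  have "(\<Sum>n\<in>F. ?g n) = (\<Sum>y\<in>?T. \<Sum>n\<in>{n\<in>F. E n = y}. ?g n)"
    by (rule sum.group[symmetric, OF F(1) fT sub])
  also have "\<dots> \<le> (\<Sum>y\<in>?T. ?b)"
  proof (rule sum_mono)
    fix y assume "y \<in> ?T"
    show "(\<Sum>n\<in>{n\<in>F. E n = y}. ?g n) \<le> ?b"
    proof (rule sum_dyadic_cell_le[OF V g c low])
      show "2 ^ y v \<le> 1 + \<bar>v \<bullet> n\<bar>" if "n \<in> {n\<in>F. E n = y}" "v \<in> V" for n v
        using that e(1)[of n v] by (auto simp: E_def)
      show "1 + \<bar>v \<bullet> n\<bar> < 2 ^ (y v + 1)" if "n \<in> {n\<in>F. E n = y}" "v \<in> V" for n v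
        using that e(2)[of v n] by (auto simp: E_def)
    qed (use F in auto)
  qed
  also have "\<dots> = (real k + real q) ^ card V * ?b"
    using V by (simp add: card_PiE)
  finally show ?thesis .
qed

lemma power_le_exp:
  assumes "x \<ge> 0" "\<epsilon> > 0" "p \<ge> 1"
  shows "x ^ p \<le> (real p / \<epsilon>) ^ p * exp (\<epsilon> * x)"
proof -
  have p: "real p > 0" using assms(3) by simp
  have "\<epsilon> * x / real p \<le> exp (\<epsilon> * x / real p)"
    using exp_ge_add_one_self[of "\<epsilon> * x / real p"] by linarith
  then have "x \<le> real p / \<epsilon> * exp (\<epsilon> * x / real p)" using assms(2) p by (simp add: field_simps)
  then have "x ^ p \<le> (real p / \<epsilon> * exp (\<epsilon> * x / real p)) ^ p" using assms(1) by (rule power_mono)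
  also have "\<dots> = (real p / \<epsilon>) ^ p * exp (\<epsilon> * x)"
    using p by (simp only: power_mult_distrib exp_of_nat_mult[symmetric]) simp
  finally show ?thesis .
qed

lemma summable_power_times_geometric:
  fixes \<rho> Q :: real
  assumes \<rho>: "0 < \<rho>" "\<rho> < 1" and Q: "Q \<ge> 0" and p: "p \<ge> 1"
  shows "summable (\<lambda>k. (real k + Q) ^ p * \<rho> ^ k)"
proof -
  \<comment> \<open>Half of the geometric rate; the other half pays for the power of
    \<open>k\<close>.\<close>
  define \<epsilon> where "\<epsilon> = - ln \<rho> / 2"
  have \<epsilon>: "\<epsilon> > 0" using \<rho> by (simp add: \<epsilon>_def)
  have e: "\<rho> = exp (- 2 * \<epsilon>)" using \<rho> by (simp add: \<epsilon>_def)
  have "summable (\<lambda>k. (real p / \<epsilon>) ^ p * exp (\<epsilon> * Q) * exp (- \<epsilon>) ^ k)"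
    using \<epsilon> by (intro summable_mult summable_geometric) auto
  moreover have "norm ((real k + Q) ^ p * \<rho> ^ k) \<le> (real p / \<epsilon>) ^ p * exp (\<epsilon> * Q) * exp (- \<epsilon>) ^ k" for k
  proof -
    have "norm ((real k + Q) ^ p * \<rho> ^ k) = (real k + Q) ^ p * \<rho> ^ k" using \<rho> Q by simp
    also have "\<dots> \<le> ((real p / \<epsilon>) ^ p * exp (\<epsilon> * (real k + Q))) * \<rho> ^ k"
      using \<rho> Q \<epsilon> p by (intro mult_right_mono power_le_exp) auto
    also have "\<dots> = (real p / \<epsilon>) ^ p * exp (\<epsilon> * Q) * exp (- \<epsilon>) ^ k"
      unfolding e by (simp add: exp_of_nat_mult[symmetric] exp_add[symmetric] algebra_simps)
    finally show ?thesis .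
  qed
  ultimately show ?thesis by (rule summable_comparison_test'[of _ 0])
qed

text \<open>The terms are nonnegative, so a bound for the finite partial sums suffices. The shell of
  scale \<open>2 ^ k\<close> contributes at most a polynomial in \<open>k\<close> times
  \<open>2 powr ((\<gamma> - 1) * k)\<close>; this is where \<open>\<gamma> < 1\<close>
  decides.\<close>

lemma summable_small_denominators:
  fixes \<alpha> :: "real^'n"
  assumes V: "finite V" and g: "0 \<le> \<gamma>" "\<gamma> < 1" and c: "c > 0"
    and low: "\<And>n. n \<in> int_pts \<Longrightarrow> n \<noteq> 0 \<Longrightarrow> \<bar>n \<bullet> \<alpha>\<bar> \<ge> c * norm n powr - \<gamma> * form_weight V n"
  shows "(\<lambda>n. 1 / norm n * form_weight V n / \<bar>n \<bullet> \<alpha>\<bar>) summable_on (int_pts - {0})"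
proof (rule nonneg_bdd_above_summable_on)
  let ?g = "\<lambda>n. 1 / norm n * form_weight V n / \<bar>n \<bullet> \<alpha>\<bar>"
  show "0 \<le> ?g n" for n by simp
  obtain q0 where q0: "1 + 2 * (\<Sum>v\<in>V. norm v) < 2 ^ q0"
    using real_arch_pow[of 2 "1 + 2 * (\<Sum>v\<in>V. norm v)"] by auto
  have q: "1 + 2 * norm v < 2 ^ q0" if "v \<in> V" for v
    using member_le_sum[OF that, of norm] V q0 by auto
  \<comment> \<open>One power more than the number of cells requires, for the logarithmic factor
    within a cell.\<close>
  define p where "p = card V + 1"
  define D where "D = real CARD('n) + 1"
  define Q where "Q = real q0 + 3"
  define \<rho> where "\<rho> = 2 powr (\<gamma> - 1)"
  have \<rho>: "0 < \<rho>" "\<rho> < 1" using g powr_less_mono[of "\<gamma> - 1" 0 2] by (auto simp: \<rho>_def)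
  define A where "A = 2 * 4 ^ card V / c * D * 4 powr \<gamma>"
  define b where "b k = A * ((real k + Q) ^ p * \<rho> ^ k)" for k :: nat
  have sb: "summable b" unfolding b_def
    by (intro summable_mult summable_power_times_geometric \<rho>) (auto simp: Q_def p_def)
  have A: "A \<ge> 0" using c by (simp add: A_def D_def)
  have b0: "b k \<ge> 0" for k using \<rho> A by (simp add: b_def Q_def)
  have shell: "sum ?g F \<le> b k"
    if F: "finite F" "F \<subseteq> int_pts" "\<And>n. n \<in> F \<Longrightarrow> 2 ^ k \<le> norm n" "\<And>n. n \<in> F \<Longrightarrow> norm n < 2 ^ (k + 1)" for F k
  proof -
    have r: "(2 ^ (k + 2)) powr \<gamma> / 2 ^ k = 4 powr \<gamma> * \<rho> ^ k"
    proof -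
      have "((2::real) ^ (k + 2)) powr \<gamma> = 2 powr (real (k + 2) * \<gamma>)"
        by (simp only: powr_realpow[symmetric] powr_powr zero_less_numeral)
      moreover have "(4::real) powr \<gamma> = 2 powr (2 * \<gamma>)"
        using powr_powr[of 2 2 \<gamma>] by simp
      moreover have "\<rho> ^ k = 2 powr ((\<gamma> - 1) * real k)" by (simp add: \<rho>_def powr_powr[symmetric] powr_realpow)
      moreover have "(2::real) ^ k = 2 powr real k" by (simp add: powr_realpow)
      ultimately show ?thesis by (simp add: powr_diff[symmetric] powr_add[symmetric] algebra_simps)
    qed
    have "sum ?g F \<le> (real k + real q0) ^ card V *
      (2 * 4 ^ card V / c * (1 + real CARD('n) * (real k + 3)) * ((2 ^ (k + 2)) powr \<gamma> / 2 ^ k))"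
      by (rule sum_dyadic_shell_le[OF V g(1) c low q F])
    also have "\<dots> \<le> (real k + Q) ^ card V *
      (2 * 4 ^ card V / c * (D * (real k + Q)) * (4 powr \<gamma> * \<rho> ^ k))"
    proof -
      have "1 + real CARD('n) * (real k + 3) \<le> real k + Q + real CARD('n) * (real k + Q)"
        by (intro add_mono mult_left_mono) (auto simp: Q_def)
      then have "1 + real CARD('n) * (real k + 3) \<le> D * (real k + Q)"
        by (simp add: D_def algebra_simps)
      then show ?thesis unfolding r using c \<rho>
        by (intro mult_mono power_mono order_refl) (auto simp: Q_def D_def)
    qed
    also have "\<dots> = b k" by (simp add: b_def A_def p_def)
    finally show ?thesis .
  qed
  have "sum ?g F \<le> suminf b" if F: "finite F" "F \<subseteq> int_pts - {0}" for F
  proof -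
    have "\<forall>n. n \<in> F \<longrightarrow> (\<exists>j::nat. 2 ^ j \<le> norm n \<and> norm n < 2 ^ (j + 1))"
      using dyadic_scale norm_int_pts_ge_1 F(2) by blast
    then obtain j :: "real^'n \<Rightarrow> nat" where j: "\<And>n. n \<in> F \<Longrightarrow> 2 ^ j n \<le> norm n \<and> norm n < 2 ^ (j n + 1)" by metis
    have "sum ?g F = (\<Sum>k\<in>j ` F. \<Sum>n\<in>{n\<in>F. j n = k}. ?g n)"
      by (rule sum.image_gen[OF F(1)])
    also have "\<dots> \<le> (\<Sum>k\<in>j ` F. b k)"
      by (intro sum_mono shell) (use F j in auto)
    also have "\<dots> \<le> suminf b" by (rule sum_le_suminf[OF sb]) (use F b0 in auto)
    finally show ?thesis .
  qed
  then show "bdd_above (sum ?g ` {F. F \<subseteq> int_pts - {0} \<and> finite F})"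
    by (intro bdd_aboveI[of _ "suminf b"]) auto
qed

section \<open>Fourier series on the torus\<close>

text \<open>Half-open, so that every point has exactly one integer translate in it; the closed cube
  differs from it by a null set.\<close>

definition half_cube :: "(real^'n) set" where
  "half_cube = {x. \<forall>i. 0 \<le> x $ i \<and> x $ i < 1}"

definition frac_vec :: "real^'n \<Rightarrow> real^'n" where
  "frac_vec x = (\<chi> i. frac (x $ i))"

definition floor_vec :: "real^'n \<Rightarrow> real^'n" where
  "floor_vec x = (\<chi> i. of_int \<lfloor>x $ i\<rfloor>)"

definition int_periodic :: "(real^'n \<Rightarrow> 'b) \<Rightarrow> bool" where
  "int_periodic f \<longleftrightarrow> (\<forall>x. \<forall>z\<in>int_pts. f (x + z) = f x)"

lemma int_periodicD: "int_periodic f \<Longrightarrow> z \<in> int_pts \<Longrightarrow> f (x + z) = f x"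
  by (simp add: int_periodic_def)

lemma floor_vec_int [simp]: "floor_vec x \<in> int_pts"
  by (simp add: floor_vec_def int_pts_def)

lemma frac_vec_eq: "frac_vec x = x - floor_vec x"
  by (simp add: frac_vec_def floor_vec_def vec_eq_iff frac_def)

lemma int_pts_add: "m \<in> int_pts \<Longrightarrow> n \<in> int_pts \<Longrightarrow> m + n \<in> int_pts"
  by (simp add: int_pts_def)

lemma int_pts_minus: "m \<in> int_pts \<Longrightarrow> - m \<in> int_pts"
  by (simp add: int_pts_def)

lemma int_pts_0 [simp]: "0 \<in> int_pts"
  by (simp add: int_pts_def)

lemma frac_vec_in_half_cube: "frac_vec x \<in> half_cube"
  by (simp add: frac_vec_def half_cube_def frac_lt_1)

lemma int_periodic_frac_vec: "int_periodic f \<Longrightarrow> f (frac_vec x) = f x"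
  using int_periodicD[of f "- floor_vec x" x] by (simp add: frac_vec_eq int_pts_minus)

lemma diff_int_in_half_cube_iff:
  assumes "z \<in> int_pts" shows "w - z \<in> half_cube \<longleftrightarrow> z = floor_vec w"
proof
  assume w: "w - z \<in> half_cube"
  show "z = floor_vec w"
  proof (subst vec_eq_iff, rule allI)
    fix i
    have "z $ i \<in> \<int>" using assms by (simp add: int_pts_def)
    then obtain k where k: "z $ i = of_int k" by (rule Ints_cases)
    have "0 \<le> w $ i - z $ i" "w $ i - z $ i < 1" using w by (auto simp: half_cube_def)
    then have "\<lfloor>w $ i\<rfloor> = k" using k by linarith
    then show "z $ i = floor_vec w $ i" using k by (simp add: floor_vec_def)
  qed
next
  assume "z = floor_vec w"
  then show "w - z \<in> half_cube" using frac_vec_in_half_cube[of w] by (simp add: frac_vec_eq)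
qed

lemma half_cube_subset_cbox: "half_cube \<subseteq> cbox 0 1"
  by (auto simp: half_cube_def mem_box_cart less_imp_le)

lemma half_cube_borel [measurable]: "half_cube \<in> sets borel"
proof -
  have eq: "half_cube = (\<Inter>i. {x::real^'n. 0 \<le> x $ i} \<inter> {x. x $ i < 1})"
    by (auto simp: half_cube_def)
  have "{x::real^'n. 0 \<le> x $ i} \<inter> {x. x $ i < 1} \<in> sets borel" for i
    by (intro sets.Int borel_closed borel_open closed_Collect_le open_Collect_less continuous_intros)
  then show ?thesis unfolding eq by (intro sets.finite_INT) auto
qed

section \<open>Translation invariance of integrals over the cube\<close>

lemma emeasure_cbox_diff_half_cube: "emeasure lborel (cbox 0 1 - half_cube :: (real^'n) set) = 0"
proof -
  have "box 0 1 \<subseteq> (half_cube :: (real^'n) set)"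
    by (auto simp: half_cube_def mem_box_cart less_imp_le)
  then have "cbox 0 1 - half_cube \<subseteq> (cbox 0 1 - box 0 1 :: (real^'n) set)" by blast
  then have "emeasure lborel (cbox 0 1 - half_cube :: (real^'n) set) \<le> emeasure lborel (cbox 0 1 - box 0 1 :: (real^'n) set)"
    by (rule emeasure_mono) simp
  moreover have "emeasure lborel (cbox 0 1 - box 0 1 :: (real^'n) set) = 0"
    using emeasure_lborel_cbox_eq[of "0::real^'n" 1] emeasure_lborel_box_eq[of "0::real^'n" 1]
    by (subst emeasure_Diff) (auto simp: box_subset_cbox)
  ultimately show ?thesis by simp
qed

lemma lint_cbox_eq_half_cube:
  fixes g :: "real^'n \<Rightarrow> 'b::{banach, second_countable_topology}"
  assumes [measurable]: "g \<in> borel_measurable borel"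
  shows "(LINT x:cbox 0 1|lborel. g x) = (LINT x:half_cube|lborel. g x)"
proof -
  have "AE x in lborel. x \<notin> (cbox 0 1 - half_cube :: (real^'n) set)"
    by (rule AE_not_in) (auto simp: null_sets_def emeasure_cbox_diff_half_cube)
  then have "AE x in lborel. indicator (cbox 0 1) x *\<^sub>R g x = indicator half_cube x *\<^sub>R g x"
    by eventually_elim (use half_cube_subset_cbox in \<open>auto simp: indicator_def\<close>)
  then show ?thesis
    unfolding set_lebesgue_integral_def by (intro integral_cong_AE) auto
qed

lemma integrable_bounded_on_cube:
  fixes g :: "real^'n \<Rightarrow> complex"
  assumes [measurable]: "g \<in> borel_measurable borel" "S \<in> sets borel" and "bounded S"
    and B: "\<And>x. cmod (g x) \<le> B"
  shows "integrable lborel (\<lambda>x. indicator S x *\<^sub>R g x)"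
proof (rule Bochner_Integration.integrable_bound)
  have "B \<ge> 0" using B[of 0] norm_ge_zero order_trans by blast
  then show "AE x in lborel. norm (indicator S x *\<^sub>R g x) \<le> norm (indicator S x *\<^sub>R B)"
    using B by (auto simp: indicator_def)
  show "integrable lborel (\<lambda>x. indicator S x *\<^sub>R B)"
    using emeasure_bounded_finite[OF assms(3)] by (intro integrable_scaleR_left) (simp add: integrable_indicator_iff)
qed simp

text \<open>Both sides are cut along the integer translates of the cube.\<close>

lemma lint_half_cube_shift:
  fixes g :: "real^'n \<Rightarrow> complex"
  assumes g[measurable]: "g \<in> borel_measurable borel" and B: "\<And>x. cmod (g x) \<le> B"
    and per: "int_periodic g"
  shows "(LINT x:half_cube|lborel. g (x + c)) = (LINT x:half_cube|lborel. g x)"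
proof -
  let ?U = "half_cube :: (real^'n) set"
  \<comment> \<open>If \<open>y\<close> and \<open>y + z - c\<close> both lie in the cube, then
    \<open>\<bar>z $ i\<bar> \<le> 1 + \<bar>c $ i\<bar>\<close>; the ball of radius
    \<open>R\<close> thus contains all integer translates that matter.\<close>
  define R where "R = nat \<lceil>\<Sum>i\<in>(UNIV::'n set). 1 + \<bar>c $ i\<bar>\<rceil>"
  define Z where "Z = {z \<in> int_pts. norm (z::real^'n) \<le> real R}"
  have fZ: "finite Z" unfolding Z_def using card_int_pts_le by blast
  have ZI: "z \<in> Z" if "z \<in> int_pts" "y \<in> ?U" "y + z - c \<in> ?U" for y z
  proof -
    have "norm z \<le> (\<Sum>i\<in>UNIV. \<bar>z $ i\<bar>)" by (rule norm_le_l1_cart)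
    also have "\<dots> \<le> (\<Sum>i\<in>(UNIV::'n set). 1 + \<bar>c $ i\<bar>)"
    proof (rule sum_mono)
      fix i
      have "0 \<le> y $ i" "y $ i < 1" "0 \<le> y $ i + z $ i - c $ i" "y $ i + z $ i - c $ i < 1"
        using that(2,3) by (auto simp: half_cube_def)
      then show "\<bar>z $ i\<bar> \<le> 1 + \<bar>c $ i\<bar>" by linarith
    qed
    also have "\<dots> \<le> real R" unfolding R_def by (rule real_nat_ceiling_ge)
    finally show ?thesis using that(1) by (simp add: Z_def)
  qed
  have Zint: "z \<in> int_pts" if "z \<in> Z" for z using that by (simp add: Z_def)
  have s1: "(\<Sum>z\<in>Z. indicator ?U (y - z)) * indicator ?U (y - c) = (indicator ?U (y - c) :: real)" for y
  proof (cases "y - c \<in> ?U")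
    case True
    have "floor_vec y \<in> Z"
      by (rule ZI[of _ "frac_vec y"]) (use True frac_vec_in_half_cube[of y] in \<open>auto simp: frac_vec_eq\<close>)
    moreover have "indicator ?U (y - z) = (if z = floor_vec y then 1 else 0 :: real)" if "z \<in> Z" for z
      using diff_int_in_half_cube_iff[OF Zint[OF that], of y] by (simp add: indicator_def)
    ultimately show ?thesis using fZ by (simp cong: sum.cong)
  qed simp
  have s2: "indicator ?U y * (\<Sum>z\<in>Z. indicator ?U (y + z - c)) = (indicator ?U y :: real)" for y
  proof (cases "y \<in> ?U")
    case True
    have "- floor_vec (y - c) \<in> Z"
      by (rule ZI[of _ y]) (use True frac_vec_in_half_cube[of "y - c"] in \<open>auto simp: int_pts_minus frac_vec_eq algebra_simps\<close>)
    moreover have "indicator ?U (y + z - c) = (if z = - floor_vec (y - c) then 1 else 0 :: real)" if "z \<in> Z" for z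
    proof -
      have "y + z - c \<in> ?U \<longleftrightarrow> - z = floor_vec (y - c)"
        using diff_int_in_half_cube_iff[OF int_pts_minus[OF Zint[OF that]], of "y - c"] by (simp add: algebra_simps)
      also have "\<dots> \<longleftrightarrow> z = - floor_vec (y - c)" by (metis minus_minus)
      finally show ?thesis by (simp add: indicator_def)
    qed
    ultimately show ?thesis using fZ by (simp cong: sum.cong)
  qed simp
  have bU: "bounded ?U" using bounded_subset[OF bounded_cbox half_cube_subset_cbox] .
  have shiftU: "(\<lambda>x. x + t) -` ?U \<in> sets borel" "bounded ((\<lambda>x. x + t) -` ?U)" for t
  proof -
    show "(\<lambda>x. x + t) -` ?U \<in> sets borel" by (rule measurable_sets_borel[of _ borel]) auto
    have "(\<lambda>x. x + t) -` ?U = (\<lambda>x. - t + x) ` ?U"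
      by (auto simp: image_iff algebra_simps intro!: bexI[of _ "_ + t"])
    then show "bounded ((\<lambda>x. x + t) -` ?U)" using bounded_translation[OF bU, of "- t"] by simp
  qed
  have translate: "(LINT x|lborel. h (t + x)) = (LINT x|lborel. h x)"
    if "h \<in> borel_measurable borel" for h :: "real^'n \<Rightarrow> complex" and t
  proof -
    have "(LINT x|lborel. h x) = (LINT x|distr lborel borel ((+) t). h x)" by (simp add: lborel_distr_plus)
    also have "\<dots> = (LINT x|lborel. h (t + x))" by (rule integral_distr) (use that in auto)
    finally show ?thesis ..
  qed
  have int: "integrable lborel (\<lambda>y. (indicator ?U (y - z) * indicator ?U (y - c)) *\<^sub>R g y)" for z
  proof -
    have "integrable lborel (\<lambda>y. indicator ((\<lambda>x. x + - z) -` ?U \<inter> (\<lambda>x. x + - c) -` ?U) y *\<^sub>R g y)"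
      by (intro integrable_bounded_on_cube[OF g _ _ B] sets.Int shiftU bounded_subset[OF shiftU(2)[of "- z"]]) auto
    then show ?thesis
      by (rule Bochner_Integration.integrable_cong[THEN iffD1, rotated 2]) (auto simp: indicator_def)
  qed
  have int': "integrable lborel (\<lambda>y. (indicator ?U y * indicator ?U (y + z - c)) *\<^sub>R g y)" for z
  proof -
    have "integrable lborel (\<lambda>y. indicator (?U \<inter> (\<lambda>x. x + (z - c)) -` ?U) y *\<^sub>R g y)"
      by (intro integrable_bounded_on_cube[OF g _ _ B] sets.Int shiftU half_cube_borel bounded_subset[OF bU]) auto
    then show ?thesis
      by (rule Bochner_Integration.integrable_cong[THEN iffD1, rotated 2]) (auto simp: indicator_def algebra_simps)
  qed
  have "(LINT x:?U|lborel. g (x + c)) = (LINT y|lborel. indicator ?U (y - c) *\<^sub>R g y)"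
    unfolding set_lebesgue_integral_def
    using translate[of "\<lambda>y. indicator ?U (y - c) *\<^sub>R g y" c] by (simp add: add.commute)
  also have "\<dots> = (LINT y|lborel. (\<Sum>z\<in>Z. (indicator ?U (y - z) * indicator ?U (y - c)) *\<^sub>R g y))"
    by (simp only: scaleR_sum_left[symmetric] sum_distrib_right[symmetric] s1)
  also have "\<dots> = (\<Sum>z\<in>Z. LINT y|lborel. (indicator ?U (y - z) * indicator ?U (y - c)) *\<^sub>R g y)"
    by (rule Bochner_Integration.integral_sum) (rule int)
  also have "\<dots> = (\<Sum>z\<in>Z. LINT y|lborel. (indicator ?U y * indicator ?U (y + z - c)) *\<^sub>R g y)"
  proof (rule sum.cong[OF refl])
    fix z assume z: "z \<in> Z"
    have "(LINT y|lborel. (indicator ?U (y - z) * indicator ?U (y - c)) *\<^sub>R g y) =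
      (LINT y|lborel. (indicator ?U (z + y - z) * indicator ?U (z + y - c)) *\<^sub>R g (z + y))"
      by (rule translate[symmetric]) simp
    also have "\<dots> = (LINT y|lborel. (indicator ?U y * indicator ?U (y + z - c)) *\<^sub>R g y)"
      by (rule Bochner_Integration.integral_cong[OF refl])
        (use int_periodicD[OF per Zint[OF z]] in \<open>auto simp: add.commute\<close>)
    finally show "(LINT y|lborel. (indicator ?U (y - z) * indicator ?U (y - c)) *\<^sub>R g y) =
      (LINT y|lborel. (indicator ?U y * indicator ?U (y + z - c)) *\<^sub>R g y)" .
  qed
  also have "\<dots> = (LINT y|lborel. (\<Sum>z\<in>Z. (indicator ?U y * indicator ?U (y + z - c)) *\<^sub>R g y))"
    by (rule Bochner_Integration.integral_sum[symmetric]) (rule int')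
  also have "\<dots> = (LINT y|lborel. indicator ?U y *\<^sub>R g y)"
    by (simp only: scaleR_sum_left[symmetric] sum_distrib_left[symmetric] s2)
  finally show ?thesis unfolding set_lebesgue_integral_def .
qed

lemma lint_cube_shift:
  fixes g :: "real^'n \<Rightarrow> complex"
  assumes g[measurable]: "g \<in> borel_measurable borel" and B: "\<And>x. cmod (g x) \<le> B"
    and per: "int_periodic g"
  shows "(LINT x:cbox 0 1|lborel. g (x + c)) = (LINT x:cbox 0 1|lborel. g x)"
  using lint_half_cube_shift[OF assms] by (simp add: lint_cbox_eq_half_cube)

lemma int_pts_inner:
  assumes "m \<in> int_pts" "n \<in> int_pts" shows "m \<bullet> n \<in> \<int>"
  using assms by (auto simp: inner_vec_def int_pts_def)

lemma expi_int: "m \<in> int_pts \<Longrightarrow> n \<in> int_pts \<Longrightarrow> expi n m = 1"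
  by (simp add: expi_def cis_multiple_2pi int_pts_inner)

lemma int_periodic_expi: "n \<in> int_pts \<Longrightarrow> int_periodic (expi n)"
  by (auto simp: int_periodic_def expi_add expi_int)

text \<open>For \<open>n \<noteq> 0\<close> the half-period shift \<open>c\<close> reverses the sign
  of the integrand, and by translation invariance the integral equals its own negative.\<close>

lemma lint_expi:
  assumes n: "n \<in> int_pts"
  shows "(LINT x:cbox 0 1|lborel. expi n (x::real^'n)) = (if n = 0 then 1 else 0)"
proof (cases "n = 0")
  case True
  have "(LINT x|lborel. indicat_real (cbox 0 1 :: (real^'n) set) x *\<^sub>R (1::complex)) =
      (LINT x|lborel. indicat_real (cbox 0 1 :: (real^'n) set) x) *\<^sub>R 1"
    by (rule integral_scaleR_left)
      (use emeasure_bounded_finite[OF bounded_cbox, of "0::real^'n" 1] in \<open>simp add: integrable_indicator_iff\<close>)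
  also have "(LINT x|lborel. indicat_real (cbox 0 1 :: (real^'n) set) x) = 1"
    by (simp add: content_cbox_cart interval_ne_empty_cart)
  finally show ?thesis using True by (simp add: set_lebesgue_integral_def)
next
  case False
  then obtain i where i: "n $ i \<noteq> 0" by (auto simp: vec_eq_iff)
  define c where "c = (axis i (1 / (2 * n $ i)) :: real^'n)"
  have "2 * pi * (n \<bullet> c) = pi" using i by (simp add: c_def inner_axis)
  then have c: "expi n c = -1" by (simp only: expi_def cis_pi)
  have "(LINT x:cbox 0 1|lborel. expi n x) = (LINT x:cbox 0 1|lborel. expi n (x + c))"
    by (rule lint_cube_shift[symmetric, where B = 1]) (auto simp: int_periodic_expi n)
  also have "\<dots> = - (LINT x:cbox 0 1|lborel. expi n x)"
    by (simp add: expi_add c set_lebesgue_integral_def)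
  finally show ?thesis using False by simp
qed

section \<open>Trigonometric polynomials and uniform approximation\<close>

inductive trig_poly :: "(real^'n \<Rightarrow> complex) \<Rightarrow> bool" where
  monom: "n \<in> int_pts \<Longrightarrow> trig_poly (\<lambda>x. c * expi n x)"
| add: "trig_poly f \<Longrightarrow> trig_poly g \<Longrightarrow> trig_poly (\<lambda>x. f x + g x)"

lemma trig_poly_const: "trig_poly (\<lambda>x. c)"
  using trig_poly.monom[of 0 c] by simp

lemma trig_poly_mult:
  assumes "trig_poly f" "trig_poly g" shows "trig_poly (\<lambda>x. f x * g x)"
  using assms(1)
proof induction
  case (monom n c)
  from assms(2) show ?case
  proof induction
    case (monom m d)
    have "(\<lambda>x. c * expi n x * (d * expi m x)) = (\<lambda>x. c * d * expi (n + m) x)"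
      by (simp add: fun_eq_iff expi_add_left)
    moreover have "n + m \<in> int_pts" by (rule int_pts_add) fact+
    ultimately show ?case using trig_poly.monom[of "n + m" "c * d"] by simp
  next
    case (add f g)
    then show ?case using trig_poly.add by (simp add: algebra_simps)
  qed
next
  case (add f g)
  then show ?case using trig_poly.add by (simp add: algebra_simps)
qed

lemma trig_poly_sum: "finite S \<Longrightarrow> (\<And>i. i \<in> S \<Longrightarrow> trig_poly (f i)) \<Longrightarrow> trig_poly (\<lambda>x. \<Sum>i\<in>S. f i x)"
  by (induction S rule: finite_induct) (auto intro: trig_poly_const trig_poly.add)

text \<open>Embeds the torus as a compact subset of a Euclidean space. Polynomials in the ambient
  coordinates pull back to trigonometric polynomials, which brings the problem into the reach of
  Stone-Weierstrass.\<close>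

definition torus_map :: "real^'n \<Rightarrow> complex^'n" where
  "torus_map x = (\<chi> i. cis (2 * pi * x $ i))"

lemma continuous_on_torus_map: "continuous_on S torus_map"
  unfolding torus_map_def cis_conv_exp by (intro continuous_on_vec_lambda continuous_intros)

lemma torus_map_eq_imp:
  assumes "torus_map x = torus_map y" shows "x - y \<in> int_pts"
proof -
  have "x $ i - y $ i \<in> \<int>" for i
  proof -
    have c: "cis (2 * pi * x $ i) = cis (2 * pi * y $ i)"
      using assms by (simp add: torus_map_def vec_eq_iff)
    have "cis (2 * pi * (x $ i - y $ i)) = cis (2 * pi * x $ i) / cis (2 * pi * y $ i)"
      by (simp add: cis_divide algebra_simps)
    also have "\<dots> = 1" using c by simp
    finally have "cos (2 * pi * (x $ i - y $ i)) = 1" by (simp add: cis.ctr complex_eq_iff)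
    then obtain k :: int where "2 * pi * (x $ i - y $ i) = of_int k * 2 * pi"
      by (auto simp: cos_one_2pi_int)
    then have "x $ i - y $ i = of_int k" by simp
    then show ?thesis by simp
  qed
  then show ?thesis by (simp add: int_pts_def)
qed

lemma trig_poly_polynomial:
  assumes "real_polynomial_function p"
  shows "trig_poly (\<lambda>x::real^'n. complex_of_real (p (torus_map x)))"
  using assms
proof induction
  case (linear f)
  interpret f: bounded_linear f by fact
  have cosine: "trig_poly (\<lambda>x. complex_of_real (cos (2 * pi * x $ i)))" for i :: 'n
  proof -
    have "trig_poly (\<lambda>x. 1 / 2 * expi (axis i 1) x + 1 / 2 * expi (- axis i 1) x)"
      by (intro trig_poly.intros) (auto simp: int_pts_def axis_def)
    moreover have "1 / 2 * expi (axis i 1) x + 1 / 2 * expi (- axis i 1) x = complex_of_real (cos (2 * pi * x $ i))" for x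
      by (simp add: expi_def inner_axis' complex_eq_iff)
    ultimately show ?thesis by simp
  qed
  have sine: "trig_poly (\<lambda>x. complex_of_real (sin (2 * pi * x $ i)))" for i :: 'n
  proof -
    have "trig_poly (\<lambda>x. - \<i> / 2 * expi (axis i 1) x + \<i> / 2 * expi (- axis i 1) x)"
      by (intro trig_poly.intros) (auto simp: int_pts_def axis_def)
    moreover have "- \<i> / 2 * expi (axis i 1) x + \<i> / 2 * expi (- axis i 1) x = complex_of_real (sin (2 * pi * x $ i))" for x
      by (simp add: expi_def inner_axis' complex_eq_iff)
    ultimately show ?thesis by simp
  qed
  \<comment> \<open>A real linear functional is determined by its values at \<open>axis i 1\<close>
    and \<open>axis i \<i>\<close>; the corresponding coordinates of \<open>torus_map x\<close> are
    the cosine and the sine.\<close>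
  have "f (torus_map x) = (\<Sum>i\<in>UNIV. cos (2 * pi * x $ i) * f (axis i 1) + sin (2 * pi * x $ i) * f (axis i \<i>))" for x
  proof -
    have "torus_map x = (\<Sum>i\<in>UNIV. cos (2 * pi * x $ i) *\<^sub>R axis i 1 + sin (2 * pi * x $ i) *\<^sub>R axis i \<i>)"
    proof (subst vec_eq_iff, rule allI)
      fix j
      have "(\<Sum>i\<in>UNIV. cos (2 * pi * x $ i) *\<^sub>R axis i 1 + sin (2 * pi * x $ i) *\<^sub>R axis i \<i>) $ j =
          (\<Sum>i\<in>UNIV. if i = j then cos (2 * pi * x $ j) *\<^sub>R 1 + sin (2 * pi * x $ j) *\<^sub>R \<i> else 0)"
        unfolding sum_component by (rule sum.cong) (auto simp: axis_def)
      also have "\<dots> = torus_map x $ j"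
        by (simp add: torus_map_def complex_eq_iff)
      finally show "torus_map x $ j = (\<Sum>i\<in>UNIV. cos (2 * pi * x $ i) *\<^sub>R axis i 1 + sin (2 * pi * x $ i) *\<^sub>R axis i \<i>) $ j" ..
    qed
    then show ?thesis by (simp add: f.sum f.add f.scaleR)
  qed
  then show ?case
    by (simp only: of_real_sum of_real_add of_real_mult)
      (intro trig_poly_sum finite trig_poly.add trig_poly_mult cosine sine trig_poly_const)
next
  case (const c)
  show ?case by (rule trig_poly_const)
next
  case (add f g)
  then show ?case using trig_poly.add by simp
next
  case (mult f g)
  then show ?case using trig_poly_mult by simp
qed

text \<open>A periodic function factors through \<open>torus_map\<close>, whichever preimage
  \<open>SOME\<close> picks. The factor \<open>f\<close> is continuous because a continuous map from
  a compact set to a Hausdorff space is a quotient map onto its image.\<close>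

lemma trig_poly_approx:
  fixes F :: "real^'n \<Rightarrow> real"
  assumes F: "continuous_on UNIV F" "int_periodic F" and e: "e > 0"
  shows "\<exists>g. trig_poly g \<and> (\<forall>x\<in>cbox 0 1. cmod (complex_of_real (F x) - g x) < e)"
proof -
  let ?C = "cbox 0 1 :: (real^'n) set"
  let ?T = "torus_map ` ?C"
  define f where "f w = F (SOME x. x \<in> ?C \<and> torus_map x = w)" for w
  have f: "f (torus_map x) = F x" if "x \<in> ?C" for x
  proof -
    let ?y = "SOME y. y \<in> ?C \<and> torus_map y = torus_map x"
    have "?y \<in> ?C \<and> torus_map ?y = torus_map x" by (rule someI[of _ x]) (use that in simp)
    then have "?y - x \<in> int_pts" using torus_map_eq_imp by blast
    then have "F (x + (?y - x)) = F x" using F(2) int_periodicD by blast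
    then show ?thesis by (simp add: f_def)
  qed
  have cT: "compact ?T" by (intro compact_continuous_image continuous_on_torus_map compact_cbox)
  have "continuous_on ?T f"
  proof (subst continuous_on_open_gen[where T = UNIV])
    show "\<forall>U. openin (top_of_set UNIV) U \<longrightarrow> openin (top_of_set ?T) (?T \<inter> f -` U)"
    proof (intro allI impI)
      fix U :: "real set" assume "openin (top_of_set UNIV) U"
      then have "open U" by simp
      have "openin (top_of_set ?C) (?C \<inter> F -` U)"
        using continuous_on_subset[OF F(1)] \<open>open U\<close> by (intro continuous_openin_preimage_gen) auto
      moreover have "torus_map x \<in> ?T \<inter> f -` U \<longleftrightarrow> F x \<in> U" if "x \<in> ?C" for x
        using f[OF that] that by simp
      then have "?C \<inter> F -` U = ?C \<inter> torus_map -` (?T \<inter> f -` U)" by blast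
      ultimately have "openin (top_of_set ?C) (?C \<inter> torus_map -` (?T \<inter> f -` U))" by simp
      then show "openin (top_of_set ?T) (?T \<inter> f -` U)"
        by (subst (asm) Abstract_Topology_2.continuous_imp_quotient_map[OF continuous_on_torus_map refl compact_cbox]) auto
    qed
  qed auto
  then obtain p where p: "real_polynomial_function p" "\<And>w. w \<in> ?T \<Longrightarrow> \<bar>f w - p w\<bar> < e"
    using Stone_Weierstrass_real_polynomial_function[OF cT _ e] by blast
  have "cmod (complex_of_real (F x) - complex_of_real (p (torus_map x))) < e" if "x \<in> ?C" for x
    using p(2)[of "torus_map x"] f[OF that] that by (simp flip: of_real_diff)
  then show ?thesis using trig_poly_polynomial[OF p(1)] by blast
qed

section \<open>Uniqueness and absolutely convergent Fourier series\<close>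

lemma set_integrable_continuous_cube:
  fixes f :: "real^'n \<Rightarrow> complex"
  assumes "continuous_on UNIV f"
  shows "set_integrable lborel (cbox a b) f"
  unfolding set_integrable_def
  by (rule borel_integrable_compact) (auto intro: continuous_on_subset[OF assms])

lemma trig_poly_continuous: "trig_poly f \<Longrightarrow> continuous_on UNIV f"
  by (induction rule: trig_poly.induct) (auto intro!: continuous_intros)

lemma lint_trig_poly_eq_0:
  fixes H :: "real^'n \<Rightarrow> complex"
  assumes H: "continuous_on UNIV H"
    and z: "\<And>n. n \<in> int_pts \<Longrightarrow> (LINT x:cbox 0 1|lborel. H x * expi n x) = 0"
    and g: "trig_poly g"
  shows "(LINT x:cbox 0 1|lborel. H x * g x) = 0"
  using g
proof induction
  case (monom n c)
  have "(LINT x:cbox 0 1|lborel. H x * (c * expi n x)) = (LINT x:cbox 0 1|lborel. c * (H x * expi n x))"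
    by (simp add: mult_ac)
  also have "\<dots> = 0" using z[OF monom] by (simp only: set_integral_mult_right mult_zero_right)
  finally show ?case .
next
  case (add f g)
  have "(LINT x:cbox 0 1|lborel. H x * (f x + g x)) =
      (LINT x:cbox 0 1|lborel. H x * f x) + (LINT x:cbox 0 1|lborel. H x * g x)"
    unfolding distrib_left
    by (intro set_integral_add set_integrable_continuous_cube continuous_intros H trig_poly_continuous add)
  then show ?case using add by simp
qed

lemma norm_lint_cube_le:
  fixes f :: "real^'n \<Rightarrow> complex"
  assumes f: "continuous_on UNIV f" and B: "\<And>x. x \<in> cbox 0 1 \<Longrightarrow> cmod (f x) \<le> B"
  shows "cmod (LINT x:cbox 0 1|lborel. f x) \<le> B"
proof -
  have i: "integrable lborel (\<lambda>x. indicat_real (cbox 0 1) x *\<^sub>R f x)"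
    using set_integrable_continuous_cube[OF f, of 0 1] by (simp add: set_integrable_def)
  have "cmod (LINT x:cbox 0 1|lborel. f x) \<le> (LINT x|lborel. norm (indicat_real (cbox 0 1) x *\<^sub>R f x))"
    unfolding set_lebesgue_integral_def by (rule integral_norm_bound)
  also have "\<dots> \<le> (LINT x|lborel. B * indicat_real (cbox 0 1 :: (real^'n) set) x)"
  proof (intro Bochner_Integration.integral_mono integrable_norm i integrable_mult_right)
    show "integrable lborel (indicat_real (cbox 0 1 :: (real^'n) set))"
      using emeasure_bounded_finite[OF bounded_cbox, of "0::real^'n" 1] by (simp add: integrable_indicator_iff)
  qed (use B in \<open>auto simp: indicator_def\<close>)
  also have "\<dots> = B" by (simp add: content_cbox_cart interval_ne_empty_cart)
  finally show ?thesis .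
qed

text \<open>The integral of \<open>H\<close> against every trigonometric polynomial vanishes, and
  \<open>cnj H\<close> is a uniform limit of such on the cube. Hence the integral of the square of
  \<open>cmod H\<close> is 0, and continuity gives \<open>H = 0\<close> at every point.\<close>

lemma fourier_uniqueness:
  fixes H :: "real^'n \<Rightarrow> complex"
  assumes H: "continuous_on UNIV H" "int_periodic H"
    and z: "\<And>n. n \<in> int_pts \<Longrightarrow> (LINT x:cbox 0 1|lborel. H x * expi n x) = 0"
  shows "H x = 0"
proof -
  let ?C = "cbox 0 1 :: (real^'n) set"
  have "bounded (H ` ?C)"
    using compact_continuous_image[OF continuous_on_subset[OF H(1)] compact_cbox] compact_imp_bounded by blast
  then obtain B where B: "B > 0" "\<And>x. x \<in> ?C \<Longrightarrow> cmod (H x) \<le> B" by (auto simp: bounded_pos)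
  have cn: "continuous_on UNIV (\<lambda>x. H x * cnj (H x))" by (intro continuous_intros H(1))
  have small: "cmod (LINT x:?C|lborel. H x * cnj (H x)) \<le> e" if e: "e > 0" for e
  proof -
    \<comment> \<open>\<open>cnj H\<close> is approximated through its real part \<open>Re H\<close>
      and its imaginary part \<open>- Im H\<close>, each within \<open>e'\<close>; these two errors
      explain the 2, the bound for \<open>H\<close> explains \<open>B\<close>.\<close>
    define e' where "e' = e / (2 * B)"
    have e': "e' > 0" using e B by (simp add: e'_def)
    have perRe: "int_periodic (\<lambda>x. Re (H x))" "int_periodic (\<lambda>x. - Im (H x))"
      using H(2) by (auto simp: int_periodic_def)
    have cRe: "continuous_on UNIV (\<lambda>x. Re (H x))" "continuous_on UNIV (\<lambda>x. - Im (H x))"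
      by (intro continuous_intros H(1))+
    obtain g1 where g1: "trig_poly g1" "\<And>x. x \<in> ?C \<Longrightarrow> cmod (complex_of_real (Re (H x)) - g1 x) < e'"
      using trig_poly_approx[OF cRe(1) perRe(1) e'] by blast
    obtain g2 where g2: "trig_poly g2" "\<And>x. x \<in> ?C \<Longrightarrow> cmod (complex_of_real (- Im (H x)) - g2 x) < e'"
      using trig_poly_approx[OF cRe(2) perRe(2) e'] by blast
    define g where "g x = g1 x + \<i> * g2 x" for x
    have g: "trig_poly g" unfolding g_def
      by (intro trig_poly.add trig_poly_mult trig_poly_const g1(1) g2(1))
    have gc: "continuous_on UNIV g" by (rule trig_poly_continuous[OF g])
    have close: "cmod (cnj (H x) - g x) \<le> 2 * e'" if "x \<in> ?C" for x
    proof -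
      have "cnj (H x) - g x = (complex_of_real (Re (H x)) - g1 x) + \<i> * (complex_of_real (- Im (H x)) - g2 x)"
        by (simp add: g_def complex_eq_iff)
      then have "cmod (cnj (H x) - g x) \<le> cmod (complex_of_real (Re (H x)) - g1 x) + cmod (complex_of_real (- Im (H x)) - g2 x)"
        using norm_triangle_ineq[of "complex_of_real (Re (H x)) - g1 x" "\<i> * (complex_of_real (- Im (H x)) - g2 x)"]
        by (simp add: norm_mult)
      then show ?thesis using g1(2)[OF that] g2(2)[OF that] by linarith
    qed
    have "(LINT x:?C|lborel. H x * cnj (H x)) = (LINT x:?C|lborel. H x * (cnj (H x) - g x) + H x * g x)"
      by (simp add: algebra_simps)
    also have "\<dots> = (LINT x:?C|lborel. H x * (cnj (H x) - g x)) + (LINT x:?C|lborel. H x * g x)"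
      by (intro set_integral_add set_integrable_continuous_cube continuous_intros H(1) gc)
    also have "(LINT x:?C|lborel. H x * g x) = 0" by (rule lint_trig_poly_eq_0[OF H(1) z g])
    finally have "cmod (LINT x:?C|lborel. H x * cnj (H x)) = cmod (LINT x:?C|lborel. H x * (cnj (H x) - g x))" by simp
    also have "\<dots> \<le> B * (2 * e')"
    proof (rule norm_lint_cube_le)
      show "cmod (H x * (cnj (H x) - g x)) \<le> B * (2 * e')" if "x \<in> ?C" for x
        unfolding norm_mult using B(1) by (intro mult_mono B(2) close that) auto
    qed (intro continuous_intros H(1) gc)
    also have "\<dots> = e" using B(1) by (simp add: e'_def)
    finally show ?thesis .
  qed
  have zero: "(LINT x:?C|lborel. H x * cnj (H x)) = 0"
  proof (rule ccontr)
    assume "(LINT x:?C|lborel. H x * cnj (H x)) \<noteq> 0"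
    then have "cmod (LINT x:?C|lborel. H x * cnj (H x)) > 0" by simp
    then show False using small[of "cmod (LINT x:?C|lborel. H x * cnj (H x)) / 2"] by simp
  qed
  have "(LINT x:?C|lborel. complex_of_real ((cmod (H x))\<^sup>2)) = 0"
    using zero by (simp only: complex_norm_square)
  then have "(LINT x:?C|lborel. (cmod (H x))\<^sup>2) = 0"
    by (simp only: set_integral_complex_of_real of_real_eq_0_iff)
  moreover have cs: "continuous_on ?C (\<lambda>x. (cmod (H x))\<^sup>2)"
    by (intro continuous_intros continuous_on_subset[OF H(1)]) auto
  moreover have "set_integrable lborel ?C (\<lambda>x. (cmod (H x))\<^sup>2)"
    unfolding set_integrable_def by (rule borel_integrable_compact) (auto intro: cs)
  ultimately have "integral ?C (\<lambda>x. (cmod (H x))\<^sup>2) = 0"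
    by (metis set_borel_integral_eq_integral(2))
  then have "\<forall>x\<in>?C. (cmod (H x))\<^sup>2 = 0"
    using integral_cbox_eq_0_iff[OF cs] by (auto simp: interval_ne_empty_cart)
  moreover have "frac_vec x \<in> ?C" using frac_vec_in_half_cube half_cube_subset_cbox by blast
  ultimately have "H (frac_vec x) = 0" by auto
  then show ?thesis using int_periodic_frac_vec[OF H(2)] by simp
qed

text \<open>The series built from the coefficients of \<open>F\<close> converges uniformly to a
  continuous periodic \<open>G\<close> with the same coefficients, so \<open>F = G\<close> by
  uniqueness, at every point and not merely almost everywhere.\<close>

theorem bound_by_fourier_coefficients:
  fixes F :: "real^'n \<Rightarrow> real"
  assumes F: "continuous_on UNIV F" "int_periodic F"
    and a: "\<And>n. n \<in> int_pts \<Longrightarrow> a n = (LINT x:cbox 0 1|lborel. F x * expi (- n) x)"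
    and s: "(\<lambda>n. cmod (a n)) summable_on int_pts"
  shows "\<bar>F x\<bar> \<le> infsum (\<lambda>n. cmod (a n)) int_pts"
proof -
  define G where "G x = infsum (\<lambda>n. a n * expi n x) int_pts" for x
  have ul: "uniform_limit UNIV (\<lambda>X y. \<Sum>n\<in>X. a n * expi n y) G (finite_subsets_at_top int_pts)"
    unfolding G_def by (rule Weierstrass_m_test_general[OF _ s]) (simp add: norm_mult)
  have Gc: "continuous_on UNIV G"
    by (rule uniform_limit_theorem[OF _ ul]) (auto intro!: always_eventually continuous_intros)
  have Gp: "int_periodic G"
    unfolding int_periodic_def G_def by (auto intro!: infsum_cong simp: expi_add expi_int)
  define H where "H x = complex_of_real (F x) - G x" for x
  have "H x = 0"
  proof (rule fourier_uniqueness)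
    show Hc: "continuous_on UNIV H" unfolding H_def by (intro continuous_intros F(1) Gc)
    show "int_periodic H" using F(2) Gp by (simp add: int_periodic_def H_def)
    fix m :: "real^'n" assume m: "m \<in> int_pts"
    have "cmod (LINT x:cbox 0 1|lborel. H x * expi m x) \<le> e" if e: "e > 0" for e
    proof -
      have "\<forall>\<^sub>F X in finite_subsets_at_top int_pts. \<forall>y\<in>UNIV. dist (\<Sum>n\<in>X. a n * expi n y) (G y) < e"
        using ul e by (simp add: uniform_limit_iff)
      then obtain X0 where X0: "finite X0" "X0 \<subseteq> int_pts"
        "\<And>X. finite X \<Longrightarrow> X0 \<subseteq> X \<Longrightarrow> X \<subseteq> int_pts \<Longrightarrow> \<forall>y. dist (\<Sum>n\<in>X. a n * expi n y) (G y) < e"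
        unfolding eventually_finite_subsets_at_top by auto
      \<comment> \<open>Including \<open>- m\<close> gives the partial sum \<open>S\<close> exactly
        the coefficient of \<open>F\<close> at this frequency, so only the uniformly small
        \<open>S - G\<close> remains.\<close>
      define X where "X = insert (- m) X0"
      have X: "finite X" "X \<subseteq> int_pts" "- m \<in> X" using X0 m by (auto simp: X_def int_pts_minus)
      define S where "S y = (\<Sum>n\<in>X. a n * expi n y)" for y
      have close: "cmod (S y - G y) \<le> e" for y
      proof -
        have "\<forall>y. dist (S y) (G y) < e"
          unfolding S_def by (rule X0(3)) (use X in \<open>auto simp: X_def\<close>)
        then show ?thesis by (simp add: dist_norm less_imp_le)
      qed
      have Sc: "continuous_on UNIV S" unfolding S_def by (intro continuous_intros)
      have "(LINT x:cbox 0 1|lborel. S x * expi m x) = (LINT x:cbox 0 1|lborel. (\<Sum>n\<in>X. a n * expi (n + m) x))"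
        by (simp add: S_def sum_distrib_right expi_add_left mult.assoc)
      also have "\<dots> = (\<Sum>n\<in>X. LINT x:cbox 0 1|lborel. a n * expi (n + m) x)"
        unfolding set_lebesgue_integral_def scaleR_sum_right
      proof (rule Bochner_Integration.integral_sum)
        fix n
        have "set_integrable lborel (cbox 0 1) (\<lambda>x. a n * expi (n + m) x)"
          by (intro set_integrable_continuous_cube continuous_intros)
        then show "integrable lborel (\<lambda>x. indicat_real (cbox 0 1) x *\<^sub>R (a n * expi (n + m) x))"
          by (simp add: set_integrable_def)
      qed
      also have "\<dots> = (\<Sum>n\<in>X. if n = - m then a n else 0)"
      proof (rule sum.cong[OF refl])
        fix n assume n: "n \<in> X"
        have "(LINT x:cbox 0 1|lborel. a n * expi (n + m) x) = a n * (LINT x:cbox 0 1|lborel. expi (n + m) x)"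
          by (rule set_integral_mult_right)
        also have "\<dots> = a n * (if n + m = 0 then 1 else 0)"
        proof -
          have "n + m \<in> int_pts" by (rule int_pts_add) (use n X m in auto)
          then show ?thesis by (rule arg_cong[OF lint_expi])
        qed
        finally have "(LINT x:cbox 0 1|lborel. a n * expi (n + m) x) = a n * (if n + m = 0 then 1 else 0)" .
        then show "(LINT x:cbox 0 1|lborel. a n * expi (n + m) x) = (if n = - m then a n else 0)"
          by (simp only: eq_neg_iff_add_eq_0) simp
      qed
      also have "\<dots> = a (- m)" using X by simp
      also have "\<dots> = (LINT x:cbox 0 1|lborel. F x * expi m x)" using a[OF int_pts_minus[OF m]] by simp
      finally have eq: "(LINT x:cbox 0 1|lborel. S x * expi m x) = (LINT x:cbox 0 1|lborel. F x * expi m x)" .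
      have "(LINT x:cbox 0 1|lborel. H x * expi m x) =
          (LINT x:cbox 0 1|lborel. (F x * expi m x - S x * expi m x) + (S x - G x) * expi m x)"
        by (simp add: H_def algebra_simps)
      also have "\<dots> = (LINT x:cbox 0 1|lborel. F x * expi m x) - (LINT x:cbox 0 1|lborel. S x * expi m x)
          + (LINT x:cbox 0 1|lborel. (S x - G x) * expi m x)"
      proof -
        have i: "set_integrable lborel (cbox 0 1) (\<lambda>x. complex_of_real (F x) * expi m x)"
          "set_integrable lborel (cbox 0 1) (\<lambda>x. S x * expi m x)"
          "set_integrable lborel (cbox 0 1) (\<lambda>x. (S x - G x) * expi m x)"
          by (intro set_integrable_continuous_cube continuous_intros F(1) Sc Gc)+
        show ?thesis
          unfolding set_integral_add(2)[OF set_integral_diff(1)[OF i(1,2)] i(3)] set_integral_diff(2)[OF i(1,2)] ..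
      qed
      also have "\<dots> = (LINT x:cbox 0 1|lborel. (S x - G x) * expi m x)" using eq by simp
      also have "cmod \<dots> \<le> e"
        by (rule norm_lint_cube_le) (auto intro!: continuous_intros Sc Gc simp: norm_mult close)
      finally show ?thesis .
    qed
    then show "(LINT x:cbox 0 1|lborel. H x * expi m x) = 0"
      using field_le_epsilon[of "cmod (LINT x:cbox 0 1|lborel. H x * expi m x)" 0] by simp
  qed
  then have "complex_of_real (F x) = G x" by (simp add: H_def)
  then have "\<bar>F x\<bar> = cmod (G x)" by (metis norm_of_real real_norm_def)
  also have "\<dots> \<le> infsum (\<lambda>n. cmod (a n * expi n x)) int_pts"
    unfolding G_def by (rule norm_infsum_bound) (simp add: norm_mult s)
  also have "\<dots> = infsum (\<lambda>n. cmod (a n)) int_pts" by (simp add: norm_mult)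
  finally show ?thesis .
qed

section \<open>Discrepancy of the linear flow\<close>

lemma measurable_frac_vec [measurable]: "frac_vec \<in> borel_measurable borel"
proof -
  have nth: "(\<lambda>x::real^'n. x $ i) \<in> borel_measurable borel" for i
    by (intro borel_measurable_continuous_onI continuous_intros)
  have eq: "frac_vec = (\<lambda>x::real^'n. \<Sum>i\<in>UNIV. (x $ i - of_int \<lfloor>x $ i\<rfloor>) *\<^sub>R axis i 1)"
    by (auto simp: fun_eq_iff vec_eq_iff frac_vec_def frac_def axis_def if_distrib if_distribR cong: if_cong)
  show ?thesis unfolding eq
    by (intro borel_measurable_sum borel_measurable_scaleR borel_measurable_diff borel_measurable_const nth
        measurable_compose[OF nth borel_measurable_real_floor])
qed

lemma int_periodic_frac_vec_comp:
  fixes f :: "real^'n \<Rightarrow> 'b"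
  shows "int_periodic (\<lambda>x. f (frac_vec x))"
proof -
  have "frac_vec (x + z) = frac_vec x" if "z \<in> int_pts" for x z :: "real^'n"
  proof (subst vec_eq_iff, rule allI)
    fix i
    have "z $ i \<in> \<int>" using that by (simp add: int_pts_def)
    then show "frac_vec (x + z) $ i = frac_vec x $ i" by (auto simp: frac_vec_def elim!: Ints_cases)
  qed
  then show ?thesis by (simp add: int_periodic_def)
qed

definition wrap :: "(real^'n) set \<Rightarrow> real^'n \<Rightarrow> real" where
  "wrap P x = indicat_real P (frac_vec x)"

lemma wrap_measurable:
  assumes "P \<in> sets borel" shows "wrap P \<in> borel_measurable borel"
  unfolding wrap_def using assms by measurable

lemma int_periodic_wrap: "int_periodic (wrap P)"
  unfolding wrap_def by (rule int_periodic_frac_vec_comp)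

lemma wrap_bounds: "0 \<le> wrap P x" "wrap P x \<le> 1"
  by (auto simp: wrap_def indicator_def)

lemma abs_wrap_le [simp]: "\<bar>wrap P x\<bar> \<le> 1"
  using wrap_bounds[of P x] by simp

lemma discrepancy_eq:
  assumes P: "P \<in> sets borel"
  shows "discrepancy T s \<alpha> P = (LINT t:{0..T}|lborel. wrap P (s + t *\<^sub>R \<alpha>)) - T * measure lborel P"
proof -
  have [measurable]: "wrap P \<in> borel_measurable borel" by (rule wrap_measurable[OF P])
  have "(\<chi> i. frac (s $ i + t * \<alpha> $ i)) = frac_vec (s + t *\<^sub>R \<alpha>)" for t
    by (simp add: frac_vec_def)
  then have "(LINT t:{0..T}|lebesgue. indicat_real P (\<chi> i. frac (s $ i + t * \<alpha> $ i))) =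
      (LINT t:{0..T}|lebesgue. wrap P (s + t *\<^sub>R \<alpha>))"
    by (simp add: wrap_def)
  also have "\<dots> = (LINT t:{0..T}|lborel. wrap P (s + t *\<^sub>R \<alpha>))"
    unfolding set_lebesgue_integral_def by (rule integral_completion) measurable
  finally show ?thesis using P by (simp add: discrepancy_def measure_completion)
qed

text \<open>\<open>wrap P\<close> jumps, but for each \<open>s\<close> the orbit meets its
  discontinuities only in a null set of times, and dominated convergence applies. Continuity is what
  extends the Fourier bound to every starting point.\<close>

lemma continuous_on_wrap_integral:
  fixes \<alpha> :: "real^'n"
  assumes P: "P \<in> sets borel" and c: "\<And>s. AE t in lborel. isCont (wrap P) (s + t *\<^sub>R \<alpha>)"
  shows "continuous_on UNIV (\<lambda>s. LINT t:{0..T}|lborel. wrap P (s + t *\<^sub>R \<alpha>))"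
proof -
  have [measurable]: "wrap P \<in> borel_measurable borel" by (rule wrap_measurable[OF P])
  have "continuous (at s) (\<lambda>s. LINT t:{0..T}|lborel. wrap P (s + t *\<^sub>R \<alpha>))" for s
  proof (subst continuous_at_sequentially, intro allI impI)
    fix X :: "nat \<Rightarrow> real^'n" assume X: "X \<longlonglongrightarrow> s"
    have "(\<lambda>j. LINT t|lborel. indicat_real {0..T} t *\<^sub>R wrap P (X j + t *\<^sub>R \<alpha>))
        \<longlonglongrightarrow> (LINT t|lborel. indicat_real {0..T} t *\<^sub>R wrap P (s + t *\<^sub>R \<alpha>))"
    proof (rule integral_dominated_convergence[where w = "indicat_real {0..T}"])
      show "integrable lborel (indicat_real {0..T})"
        by (simp add: integrable_indicator_iff emeasure_lborel_Icc_eq)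
      show "AE t in lborel. (\<lambda>j. indicat_real {0..T} t *\<^sub>R wrap P (X j + t *\<^sub>R \<alpha>))
           \<longlonglongrightarrow> indicat_real {0..T} t *\<^sub>R wrap P (s + t *\<^sub>R \<alpha>)"
        using c[of s]
      proof eventually_elim
        case (elim t)
        then show ?case
          by (intro tendsto_intros isCont_tendsto_compose[of _ "wrap P"] X)
      qed
      show "AE t in lborel. norm (indicat_real {0..T} t *\<^sub>R wrap P (X j + t *\<^sub>R \<alpha>)) \<le> indicat_real {0..T} t" for j
        by (rule AE_I2) (auto simp: indicator_def)
    qed simp_all
    then show "((\<lambda>s. LINT t:{0..T}|lborel. wrap P (s + t *\<^sub>R \<alpha>)) \<circ> X) \<longlonglongrightarrow> (LINT t:{0..T}|lborel. wrap P (s + t *\<^sub>R \<alpha>))"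
      by (simp add: o_def set_lebesgue_integral_def)
  qed
  then show ?thesis by (simp add: continuous_on_eq_continuous_at)
qed

section \<open>Fourier coefficients of the discrepancy\<close>

lemma lint_wrap_expi:
  fixes P :: "(real^'n) set"
  assumes P: "P \<in> sets borel" "P \<subseteq> cbox 0 1"
  shows "(LINT x:cbox 0 1|lborel. expi n x * wrap P x) = ft P n"
proof -
  have [measurable]: "wrap P \<in> borel_measurable borel" "P \<in> sets borel" using wrap_measurable P by auto
  have "(LINT x:cbox 0 1|lborel. expi n x * wrap P x) = (LINT x:half_cube|lborel. expi n x * wrap P x)"
    by (rule lint_cbox_eq_half_cube) measurable
  also have "\<dots> = (LINT x:half_cube|lborel. indicat_real P x *\<^sub>R expi n x)"
    unfolding set_lebesgue_integral_def
  proof (rule Bochner_Integration.integral_cong[OF refl])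
    fix x :: "real^'n"
    have "frac_vec x = x" if "x \<in> half_cube"
      using that diff_int_in_half_cube_iff[of 0 x] by (simp add: frac_vec_eq)
    then show "indicat_real half_cube x *\<^sub>R (expi n x * complex_of_real (wrap P x)) =
        indicat_real half_cube x *\<^sub>R indicat_real P x *\<^sub>R expi n x"
      by (auto simp: indicator_def wrap_def)
  qed
  also have "\<dots> = (LINT x:cbox 0 1|lborel. indicat_real P x *\<^sub>R expi n x)"
    by (rule lint_cbox_eq_half_cube[symmetric]) measurable
  also have "\<dots> = ft P n"
    unfolding ft_def set_lebesgue_integral_def
    by (rule Bochner_Integration.integral_cong[OF refl]) (use P(2) in \<open>auto simp: indicator_def\<close>)
  finally show ?thesis .
qed

lemma lint_wrap_shift:
  fixes P :: "(real^'n) set"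
  assumes P: "P \<in> sets borel" "P \<subseteq> cbox 0 1" and n: "n \<in> int_pts"
  shows "(LINT x:cbox 0 1|lborel. expi (- n) x * wrap P (x + c)) = expi n c * ft P (- n)"
proof -
  have [measurable]: "wrap P \<in> borel_measurable borel" using wrap_measurable P by auto
  have "(LINT x:cbox 0 1|lborel. expi (- n) x * wrap P (x + c)) =
      (LINT x:cbox 0 1|lborel. expi n c * (expi (- n) (x + c) * wrap P (x + c)))"
  proof -
    have "expi n c * expi (- n) c = 1" using expi_add_left[of n "- n" c] by simp
    then have "expi (- n) x * y = expi n c * (expi (- n) (x + c) * y)" for x y
      by (simp add: expi_add mult_ac)
    then have "(\<lambda>x. expi (- n) x * complex_of_real (wrap P (x + c))) =
        (\<lambda>x. expi n c * (expi (- n) (x + c) * complex_of_real (wrap P (x + c))))"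
      by (rule ext)
    then show ?thesis by (rule arg_cong)
  qed
  also have "\<dots> = expi n c * (LINT x:cbox 0 1|lborel. expi (- n) (x + c) * wrap P (x + c))"
    by (rule set_integral_mult_right)
  also have "(LINT x:cbox 0 1|lborel. expi (- n) (x + c) * wrap P (x + c)) = (LINT x:cbox 0 1|lborel. expi (- n) x * wrap P x)"
  proof (rule lint_cube_shift)
    show "int_periodic (\<lambda>x. expi (- n) x * complex_of_real (wrap P x))"
      unfolding int_periodic_def
      by (simp add: int_periodicD[OF int_periodic_wrap] int_periodicD[OF int_periodic_expi[OF int_pts_minus[OF n]]])
    show "cmod (expi (- n) x * complex_of_real (wrap P x)) \<le> 1" for x
      using wrap_bounds[of P x] by (simp add: norm_mult)
  qed measurable
  finally show ?thesis using lint_wrap_expi[OF P] by simp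
qed

text \<open>By Fubini the integration over \<open>s\<close> comes first, where the shift by
  \<open>t *\<^sub>R \<alpha>\<close> turns into a phase; the integral of a character along the
  orbit is left.\<close>

lemma fourier_coefficient_wrap_integral:
  fixes P :: "(real^'n) set"
  assumes P: "P \<in> sets borel" "P \<subseteq> cbox 0 1" and n: "n \<in> int_pts"
  shows "(LINT s:cbox 0 1|lborel. (LINT t:{0..T}|lborel. wrap P (s + t *\<^sub>R \<alpha>)) * expi (- n) s)
     = (LINT t:{0..T}|lborel. expi n (t *\<^sub>R \<alpha>)) * ft P (- n)"
proof -
  have [measurable]: "wrap P \<in> borel_measurable borel" using wrap_measurable P by auto
  define f where "f t s = (indicat_real {0..T} t * indicat_real (cbox 0 1) s) *\<^sub>R
      (expi (- n) s * complex_of_real (wrap P (s + t *\<^sub>R \<alpha>)))" for t and s :: "real^'n"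
  have int: "integrable (lborel \<Otimes>\<^sub>M lborel) (case_prod f)"
  proof (rule Bochner_Integration.integrable_bound)
    show "integrable (lborel \<Otimes>\<^sub>M lborel) (indicat_real ({0..T} \<times> (cbox 0 1 :: (real^'n) set)))"
      using emeasure_bounded_finite[OF bounded_cbox, of "0::real^'n" 1]
      by (simp add: integrable_indicator_iff lborel.emeasure_pair_measure_Times ennreal_mult_less_top
          emeasure_lborel_Icc_eq del: emeasure_lborel_cbox)
    show "case_prod f \<in> borel_measurable (lborel \<Otimes>\<^sub>M lborel)"
      unfolding f_def by measurable
    show "AE x in lborel \<Otimes>\<^sub>M lborel. norm (case_prod f x) \<le> norm (indicat_real ({0..T} \<times> (cbox 0 1 :: (real^'n) set)) x)"
      by (rule AE_I2) (auto simp: f_def indicator_def norm_mult)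
  qed
  have "(LINT s:cbox 0 1|lborel. (LINT t:{0..T}|lborel. wrap P (s + t *\<^sub>R \<alpha>)) * expi (- n) s)
      = (LINT s|lborel. LINT t|lborel. f t s)"
    unfolding set_lebesgue_integral_def
  proof (rule Bochner_Integration.integral_cong[OF refl])
    fix s :: "real^'n"
    have "(LINT t|lborel. f t s) = (LINT t|lborel. (indicat_real (cbox 0 1) s *\<^sub>R expi (- n) s) *
        complex_of_real (indicat_real {0..T} t *\<^sub>R wrap P (s + t *\<^sub>R \<alpha>)))"
      by (rule Bochner_Integration.integral_cong[OF refl]) (simp add: f_def indicator_def)
    also have "\<dots> = (indicat_real (cbox 0 1) s *\<^sub>R expi (- n) s) *
        complex_of_real (LINT t|lborel. indicat_real {0..T} t *\<^sub>R wrap P (s + t *\<^sub>R \<alpha>))"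
      by (simp only: integral_mult_right_zero integral_complex_of_real)
    finally show "indicat_real (cbox 0 1) s *\<^sub>R (complex_of_real (LINT t|lborel. indicat_real {0..T} t *\<^sub>R wrap P (s + t *\<^sub>R \<alpha>)) * expi (- n) s)
        = (LINT t|lborel. f t s)"
      by (simp add: mult_ac)
  qed
  also have "\<dots> = (LINT t|lborel. LINT s|lborel. f t s)"
    by (rule lborel_pair.Fubini_integral[OF int])
  also have "\<dots> = (LINT t|lborel. (indicat_real {0..T} t *\<^sub>R expi n (t *\<^sub>R \<alpha>)) * ft P (- n))"
  proof (rule Bochner_Integration.integral_cong[OF refl])
    fix t
    have "(LINT s|lborel. f t s) = (LINT s|lborel. complex_of_real (indicat_real {0..T} t) *
        (indicat_real (cbox 0 1) s *\<^sub>R (expi (- n) s * complex_of_real (wrap P (s + t *\<^sub>R \<alpha>)))))"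
      by (rule Bochner_Integration.integral_cong[OF refl]) (simp add: f_def indicator_def)
    also have "\<dots> = complex_of_real (indicat_real {0..T} t) *
        (LINT s:cbox 0 1|lborel. expi (- n) s * complex_of_real (wrap P (s + t *\<^sub>R \<alpha>)))"
      unfolding set_lebesgue_integral_def by (rule integral_mult_right_zero)
    also have "\<dots> = complex_of_real (indicat_real {0..T} t) * (expi n (t *\<^sub>R \<alpha>) * ft P (- n))"
      by (simp only: lint_wrap_shift[OF P n])
    finally show "(LINT s|lborel. f t s) = (indicat_real {0..T} t *\<^sub>R expi n (t *\<^sub>R \<alpha>)) * ft P (- n)"
      by (simp add: indicator_def)
  qed
  also have "\<dots> = (LINT t:{0..T}|lborel. expi n (t *\<^sub>R \<alpha>)) * ft P (- n)"
    unfolding set_lebesgue_integral_def by (rule integral_mult_left_zero)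
  finally show ?thesis .
qed

lemma norm_lint_expi_line_le:
  assumes b: "n \<bullet> \<alpha> \<noteq> 0" and T: "T > 0"
  shows "cmod (LINT t:{0..T}|lborel. expi n (t *\<^sub>R \<alpha>)) \<le> 1 / \<bar>n \<bullet> \<alpha>\<bar>"
proof -
  define c where "c = \<i> * complex_of_real (2 * pi * (n \<bullet> \<alpha>))"
  have c: "c \<noteq> 0" using b by (simp add: c_def)
  have e: "expi n (t *\<^sub>R \<alpha>) = exp (c * of_real t)" for t
    by (simp add: expi_def cis_conv_exp c_def mult_ac)
  have "((\<lambda>t. exp (c * of_real t)) has_integral exp (c * of_real T) / c - exp (c * of_real 0) / c) {0..T}"
  proof (rule fundamental_theorem_of_calculus)
    fix t
    have "((\<lambda>z. exp (c * z) / c) has_field_derivative exp (c * of_real t)) (at (of_real t))"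
      by (auto intro!: derivative_eq_intros simp: c)
    then show "((\<lambda>t. exp (c * of_real t) / c) has_vector_derivative exp (c * of_real t)) (at t within {0..T})"
      by (rule has_vector_derivative_real_field)
  qed (use T in auto)
  then have "integral {0..T} (\<lambda>t. expi n (t *\<^sub>R \<alpha>)) = (exp (c * of_real T) - 1) / c"
    by (simp add: e integral_unique diff_divide_distrib)
  moreover have "set_integrable lborel {0..T} (\<lambda>t. expi n (t *\<^sub>R \<alpha>))"
    unfolding set_integrable_def
    by (rule borel_integrable_compact) (auto intro!: continuous_intros)
  ultimately have "(LINT t:{0..T}|lborel. expi n (t *\<^sub>R \<alpha>)) = (exp (c * of_real T) - 1) / c"
    by (simp add: set_borel_integral_eq_integral(2))
  moreover have "cmod (exp (c * of_real T) - 1) \<le> 2"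
  proof -
    have "cmod (exp (c * of_real T)) = 1" using norm_expi[of n "T *\<^sub>R \<alpha>"] by (simp only: e)
    then show ?thesis using norm_triangle_ineq4[of "exp (c * of_real T)" 1] by (simp only: norm_one)
  qed
  moreover have "cmod c = 2 * pi * \<bar>n \<bullet> \<alpha>\<bar>" by (simp add: c_def norm_mult abs_mult)
  ultimately have "cmod (LINT t:{0..T}|lborel. expi n (t *\<^sub>R \<alpha>)) \<le> 2 / (2 * pi * \<bar>n \<bullet> \<alpha>\<bar>)"
    by (simp only: norm_divide) (rule divide_right_mono, simp_all)
  also have "\<dots> \<le> 1 / \<bar>n \<bullet> \<alpha>\<bar>"
    using b pi_ge_two by (simp add: field_simps)
  finally show ?thesis .
qed

theorem discrepancy_le_fourier_sum:
  fixes P :: "(real^'n) set"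
  assumes P: "P \<in> sets borel" "P \<subseteq> cbox 0 1"
    and c: "\<And>s. AE t in lborel. isCont (wrap P) (s + t *\<^sub>R \<alpha>)"
    and nz: "\<And>n. n \<in> int_pts \<Longrightarrow> n \<noteq> 0 \<Longrightarrow> n \<bullet> \<alpha> \<noteq> 0"
    and b: "\<And>n. n \<in> int_pts \<Longrightarrow> n \<noteq> 0 \<Longrightarrow> cmod (ft P (- n)) / \<bar>n \<bullet> \<alpha>\<bar> \<le> b n"
    and s: "b summable_on (int_pts - {0})" and T: "T > 0"
  shows "\<bar>discrepancy T x \<alpha> P\<bar> \<le> infsum b (int_pts - {0})"
proof -
  define F where "F s = (LINT t:{0..T}|lborel. wrap P (s + t *\<^sub>R \<alpha>)) - T * measure lborel P" for s
  define a where "a n = (LINT x:cbox 0 1|lborel. F x * expi (- n) x)" for n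
  have Fc0: "continuous_on UNIV (\<lambda>s. LINT t:{0..T}|lborel. wrap P (s + t *\<^sub>R \<alpha>))"
    by (rule continuous_on_wrap_integral[OF P(1) c])
  have Fc: "continuous_on UNIV F" unfolding F_def by (intro continuous_intros Fc0)
  have Fp: "int_periodic F"
    unfolding int_periodic_def
  proof (intro allI ballI)
    fix s z :: "real^'n" assume z: "z \<in> int_pts"
    have "wrap P (s + z + t *\<^sub>R \<alpha>) = wrap P (s + t *\<^sub>R \<alpha>)" for t
      using int_periodicD[OF int_periodic_wrap z, of P "s + t *\<^sub>R \<alpha>"] by (simp add: algebra_simps)
    then show "F (s + z) = F s" by (simp add: F_def)
  qed
  have a: "a n = (LINT t:{0..T}|lborel. expi n (t *\<^sub>R \<alpha>)) * ft P (- n) - (if n = 0 then T * measure lborel P else 0)"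
    if n: "n \<in> int_pts" for n
  proof -
    have "a n = (LINT x:cbox 0 1|lborel. (LINT t:{0..T}|lborel. wrap P (x + t *\<^sub>R \<alpha>)) * expi (- n) x
        - complex_of_real (T * measure lborel P) * expi (- n) x)"
      by (simp add: a_def F_def left_diff_distrib)
    also have "\<dots> = (LINT x:cbox 0 1|lborel. (LINT t:{0..T}|lborel. wrap P (x + t *\<^sub>R \<alpha>)) * expi (- n) x)
        - (LINT x:cbox 0 1|lborel. complex_of_real (T * measure lborel P) * expi (- n) x)"
      by (intro set_integral_diff set_integrable_continuous_cube continuous_intros Fc0)
    also have "(LINT x:cbox 0 1|lborel. complex_of_real (T * measure lborel P) * expi (- n) x)
        = complex_of_real (T * measure lborel P) * (LINT x:cbox 0 1|lborel. expi (- n) x)"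
      by (rule set_integral_mult_right)
    finally show ?thesis
      using lint_expi[OF int_pts_minus[OF n]] fourier_coefficient_wrap_integral[OF P n] by simp
  qed
  \<comment> \<open>The subtracted term \<open>T * measure lborel P\<close> is exactly the mean over
    \<open>s\<close>, so the coefficient at frequency 0 vanishes.\<close>
  have "ft P 0 = complex_of_real (measure lborel P)"
  proof -
    have "expi (0::real^'n) = (\<lambda>x. complex_of_real 1)" by (simp add: fun_eq_iff)
    then have "ft P 0 = complex_of_real (LINT x:P|lborel. 1)"
      unfolding ft_def by (simp only: set_integral_complex_of_real)
    then show ?thesis using P(1) by (simp add: set_lebesgue_integral_def)
  qed
  then have a0: "a 0 = 0"
    using a[of 0] T by (simp add: set_lebesgue_integral_def scaleR_conv_of_real)
  have ab: "cmod (a n) \<le> b n" if n: "n \<in> int_pts" "n \<noteq> 0" for n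
  proof -
    have "cmod (a n) = cmod (LINT t:{0..T}|lborel. expi n (t *\<^sub>R \<alpha>)) * cmod (ft P (- n))"
      using a[OF n(1)] n(2) by (simp add: norm_mult)
    also have "\<dots> \<le> 1 / \<bar>n \<bullet> \<alpha>\<bar> * cmod (ft P (- n))"
      by (intro mult_right_mono norm_lint_expi_line_le nz n T) auto
    also have "\<dots> \<le> b n" using b[OF n] by simp
    finally show ?thesis .
  qed
  have sa': "(\<lambda>n. cmod (a n)) summable_on (int_pts - {0})"
    by (rule summable_on_comparison_test[OF s]) (use ab in auto)
  have ins: "insert 0 (int_pts - {0}) = (int_pts :: (real^'n) set)" by auto
  have sa: "(\<lambda>n. cmod (a n)) summable_on int_pts"
    using summable_on_insert_iff[of "\<lambda>n. cmod (a n)" 0 "int_pts - {0}"] sa' ins by simp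
  have "\<bar>F x\<bar> \<le> infsum (\<lambda>n. cmod (a n)) int_pts"
    by (rule bound_by_fourier_coefficients[OF Fc Fp _ sa]) (simp add: a_def)
  also have "\<dots> = infsum (\<lambda>n. cmod (a n)) (int_pts - {0})"
    by (rule infsum_cong_neutral) (use a0 in auto)
  also have "\<dots> \<le> infsum b (int_pts - {0})"
    by (rule infsum_mono[OF sa' s]) (use ab in auto)
  finally show ?thesis using discrepancy_eq[OF P(1)] by (simp add: F_def)
qed

section \<open>Polytopes\<close>

text \<open>With nonempty interior, the affine hull of a facet is a hyperplane, which fixes the
  normal up to a factor.\<close>

lemma normal_to_facet_parallel:
  fixes P :: "'a::euclidean_space set"
  assumes P: "interior P \<noteq> {}" and F: "F facet_of P"
  shows "\<exists>a. \<forall>\<nu>. normal_to \<nu> F \<longrightarrow> (\<exists>t. t \<noteq> 0 \<and> \<nu> = t *\<^sub>R a)"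
proof -
  have "aff_dim P = DIM('a)" using P by (rule aff_dim_nonempty_interior)
  then have "aff_dim F = DIM('a) - 1" using F by (simp add: facet_of_def)
  then obtain a b where a: "a \<noteq> 0" and hull: "affine hull F = {x. a \<bullet> x = b}"
    using aff_dim_eq_hyperplane[of F] by blast
  obtain x0 where x0: "x0 \<in> F" using F by (auto simp: facet_of_def)
  have "\<exists>t. t \<noteq> 0 \<and> \<nu> = t *\<^sub>R a" if \<nu>: "normal_to \<nu> F" for \<nu>
  proof -
    have "F \<subseteq> {x. \<nu> \<bullet> x = \<nu> \<bullet> x0}"
    proof
      fix x assume "x \<in> F"
      then have "orthogonal \<nu> (x - x0)" using \<nu> x0 unfolding normal_to_def by blast
      then show "x \<in> {x. \<nu> \<bullet> x = \<nu> \<bullet> x0}" by (simp add: orthogonal_def inner_diff_right)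
    qed
    then have sub: "affine hull F \<subseteq> {x. \<nu> \<bullet> x = \<nu> \<bullet> x0}"
      by (rule hull_minimal) (rule affine_hyperplane)
    define t where "t = (\<nu> \<bullet> a) / (a \<bullet> a)"
    \<comment> \<open>The part of \<open>\<nu>\<close> parallel to the hyperplane. Moving from
      \<open>x0\<close> by \<open>y\<close> stays in the affine hull, so
      \<open>\<nu> \<bullet> y = 0\<close>, which forces \<open>y = 0\<close>.\<close>
    define y where "y = \<nu> - t *\<^sub>R a"
    have ay: "a \<bullet> y = 0" using a by (simp add: y_def t_def inner_diff_right inner_commute)
    have "x0 \<in> affine hull F" using x0 by (rule hull_inc)
    then have "x0 + y \<in> affine hull F" using ay by (simp add: hull inner_add_right)
    then have "\<nu> \<bullet> y = 0" using sub by (auto simp: inner_add_right)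
    then have "y \<bullet> y = 0" using ay by (simp add: y_def inner_diff_left)
    then have "\<nu> = t *\<^sub>R a" by (simp add: y_def)
    moreover have "\<nu> \<noteq> 0" using \<nu> by (simp add: normal_to_def)
    ultimately show ?thesis by (intro exI[of _ t]) auto
  qed
  then show ?thesis by blast
qed

lemma facet_normals_parallel:
  fixes P :: "'a::euclidean_space set"
  assumes "interior P \<noteq> {}" "F facet_of P" "normal_to \<nu> F" "normal_to \<mu> F"
  shows "\<exists>t. \<nu> = t *\<^sub>R \<mu>"
proof -
  obtain a where a: "\<And>\<nu>. normal_to \<nu> F \<Longrightarrow> \<exists>t. t \<noteq> 0 \<and> \<nu> = t *\<^sub>R a"
    using normal_to_facet_parallel[OF assms(1,2)] by blast
  obtain t s where "\<nu> = t *\<^sub>R a" "s \<noteq> 0" "\<mu> = s *\<^sub>R a" using a[OF assms(3)] a[OF assms(4)] by blast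
  then show ?thesis by (intro exI[of _ "t / s"]) auto
qed

text \<open>In a minimal description of \<open>P\<close> by half-spaces each one cuts out a facet,
  so its normal is a multiple, of either sign, of some element of \<open>A\<close>. The projection
  of \<open>P\<close> to that element respects the half-space from whichever side it bounds.\<close>

lemma polytope_eq_strips:
  fixes P :: "'a::euclidean_space set"
  assumes P: "polytope P" "interior P \<noteq> {}"
    and A: "\<And>\<nu>. \<nu> \<in> facet_normals P \<Longrightarrow> \<exists>a\<in>A. \<exists>t. \<nu> = t *\<^sub>R a"
  shows "P = strips A (\<lambda>a. (\<lambda>x. a \<bullet> x) ` P)"
proof
  show "P \<subseteq> strips A (\<lambda>a. (\<lambda>x. a \<bullet> x) ` P)" by (auto simp: strips_def)
  have "polyhedron P" by (rule polytope_imp_polyhedron[OF P(1)])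
  moreover have hull: "affine hull P = UNIV" by (rule affine_hull_nonempty_interior[OF P(2)])
  ultimately obtain \<H> where fin: "finite \<H>" and PH: "P = affine hull P \<inter> \<Inter>\<H>"
    and hs: "\<forall>h\<in>\<H>. \<exists>a b. a \<noteq> 0 \<and> h = {x. a \<bullet> x \<le> b}"
    and min: "\<forall>F'. F' \<subset> \<H> \<longrightarrow> P \<subset> affine hull P \<inter> \<Inter>F'"
    by (auto simp: polyhedron_Int_affine_minimal)
  obtain a b where ab: "\<And>h. h \<in> \<H> \<Longrightarrow> a h \<noteq> 0 \<and> h = {x. a h \<bullet> x \<le> b h}"
    using hs by metis
  have facet: "P \<inter> {x. a h \<bullet> x = b h} facet_of P" if "h \<in> \<H>" for h
    using facet_of_polyhedron_explicit[OF fin PH ab] min that by blast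
  show "strips A (\<lambda>a. (\<lambda>x. a \<bullet> x) ` P) \<subseteq> P"
  proof
    fix x assume x: "x \<in> strips A (\<lambda>a. (\<lambda>x. a \<bullet> x) ` P)"
    have "x \<in> h" if h: "h \<in> \<H>" for h
    proof -
      have "normal_to (a h) (P \<inter> {x. a h \<bullet> x = b h})"
        using ab[OF h] by (auto simp: normal_to_def orthogonal_def inner_diff_right)
      then have "a h \<in> facet_normals P" using facet[OF h] by (auto simp: facet_normals_def)
      then obtain e t where e: "e \<in> A" "a h = t *\<^sub>R e" using A by blast
      obtain p where p: "p \<in> P" "e \<bullet> x = e \<bullet> p" using x e(1) by (auto simp: strips_def)
      have "p \<in> h" using p(1) PH h by blast
      then have "a h \<bullet> p \<le> b h" using ab[OF h] by blast
      then have "a h \<bullet> x \<le> b h" using p(2) e(2) by simp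
      then show ?thesis using ab[OF h] by blast
    qed
    then show "x \<in> P" using PH hull by blast
  qed
qed

section \<open>Orbits and the boundary of the polytope\<close>

lemma countable_int_pts: "countable (int_pts :: (real^'n) set)"
proof -
  have "int_pts = (\<Union>R::nat. {n \<in> int_pts. norm (n::real^'n) \<le> real R})"
    using real_arch_simple by auto
  moreover have "countable (\<Union>R::nat. {n \<in> int_pts. norm (n::real^'n) \<le> real R})"
    using card_int_pts_le by (intro countable_UN) (auto intro: countable_finite)
  ultimately show ?thesis by simp
qed

lemma isCont_wrap:
  fixes x :: "real^'n"
  assumes x: "\<And>i. x $ i \<notin> \<int>" and P: "frac_vec x \<notin> frontier P"
  shows "isCont (wrap P) x"
proof -
  have "isCont frac_vec x"
    unfolding isCont_def frac_vec_def
  proof (rule tendsto_vec_lambda)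
    fix i
    have "isCont frac (x $ i)" using x by (rule continuous_frac)
    moreover have "((\<lambda>y. y $ i) \<longlongrightarrow> x $ i) (at x)" by (intro tendsto_intros)
    ultimately show "((\<lambda>y. frac (y $ i)) \<longlongrightarrow> frac (x $ i)) (at x)" by (rule isCont_tendsto_compose)
  qed
  moreover have "isCont (indicat_real P) (frac_vec x)" using P by (simp add: isCont_indicator)
  ultimately have "isCont (\<lambda>x. indicat_real P (frac_vec x)) x" by (rule isCont_o2)
  then show ?thesis unfolding wrap_def .
qed

text \<open>The line is transversal to the hyperplanes where a coordinate is integral and to the
  integer translates of the hyperplanes of the facets, so it meets each of them once. They are
  countably many, and \<open>E\<close> collects the times.\<close>

lemma AE_isCont_wrap_line:
  fixes P :: "(real^'n) set"
  assumes P: "polytope P" "interior P \<noteq> {}"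
    and \<alpha>: "\<And>i. \<alpha> $ i \<noteq> 0"
    and F: "\<And>F. F facet_of P \<Longrightarrow> \<exists>\<nu>. normal_to \<nu> F \<and> \<nu> \<bullet> \<alpha> \<noteq> 0"
  shows "AE t in lborel. isCont (wrap P) (s + t *\<^sub>R \<alpha>)"
proof -
  obtain \<nu> where \<nu>: "\<And>F. F facet_of P \<Longrightarrow> normal_to (\<nu> F) F \<and> \<nu> F \<bullet> \<alpha> \<noteq> 0" using F by metis
  have "\<forall>F. F facet_of P \<longrightarrow> (\<exists>x. x \<in> F)" by (auto simp: facet_of_def)
  then obtain p where p: "\<And>F. F facet_of P \<Longrightarrow> p F \<in> F" by metis
  define E where "E = (\<Union>i\<in>UNIV. \<Union>k\<in>(\<int>::real set). {(k - s $ i) / \<alpha> $ i}) \<union>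
    (\<Union>F\<in>{F. F facet_of P}. \<Union>z\<in>int_pts. {(\<nu> F \<bullet> p F - \<nu> F \<bullet> s + \<nu> F \<bullet> z) / (\<nu> F \<bullet> \<alpha>)})"
  have "countable E"
    unfolding E_def using finite_polytope_facets[OF P(1)] countable_int_pts
    by (intro countable_Un countable_UN countable_finite[of UNIV]) (auto intro: countable_finite simp: Ints_def)
  then have "AE t in lborel. t \<notin> E" by (intro AE_not_in countable_imp_null_set_lborel)
  then show ?thesis
  proof eventually_elim
    case (elim t)
    let ?x = "s + t *\<^sub>R \<alpha>"
    show ?case
    proof (rule isCont_wrap)
      show "?x $ i \<notin> \<int>" for i
      proof
        assume k: "?x $ i \<in> \<int>"
        have "t = (?x $ i - s $ i) / \<alpha> $ i" using \<alpha>[of i] by simp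
        then have "t \<in> {(?x $ i - s $ i) / \<alpha> $ i}" by blast
        then have "t \<in> E" unfolding E_def using k by blast
        then show False using elim by blast
      qed
      show "frac_vec ?x \<notin> frontier P"
      proof
        assume fr: "frac_vec ?x \<in> frontier P"
        have "frontier P = P - rel_interior P"
          using P by (simp add: frontier_def closure_closed polytope_imp_closed rel_interior_nonempty_interior)
        then have "frac_vec ?x \<in> \<Union>{F. F facet_of P}"
          using fr rel_boundary_of_polyhedron[OF polytope_imp_polyhedron[OF P(1)]] by simp
        then obtain F where F: "F facet_of P" "frac_vec ?x \<in> F" by blast
        have "\<nu> F \<bullet> (frac_vec ?x - p F) = 0"
          using \<nu>[OF F(1)] F(2) p[OF F(1)] by (auto simp: normal_to_def orthogonal_def)
        then have "t * (\<nu> F \<bullet> \<alpha>) = \<nu> F \<bullet> p F - \<nu> F \<bullet> s + \<nu> F \<bullet> floor_vec ?x"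
          by (simp add: frac_vec_eq inner_diff_right inner_add_right)
        then have "t = (\<nu> F \<bullet> p F - \<nu> F \<bullet> s + \<nu> F \<bullet> floor_vec ?x) / (\<nu> F \<bullet> \<alpha>)"
          using \<nu>[OF F(1)] by (simp add: field_simps)
        then have tz: "t \<in> {(\<nu> F \<bullet> p F - \<nu> F \<bullet> s + \<nu> F \<bullet> floor_vec ?x) / (\<nu> F \<bullet> \<alpha>)}" by (simp only: singleton_iff)
        have "F \<in> {F. F facet_of P}" using F(1) by simp
        then have "t \<in> E" unfolding E_def by (intro UnI2) (rule UN_I, assumption, rule UN_I, rule floor_vec_int, rule tz)
        then show False using elim by contradiction
      qed
    qed
  qed
qed

text \<open>The first \<open>d - 1\<close> coordinate forms are all orthogonal to
  \<open>axis None 1\<close>, which is not orthogonal to \<open>\<alpha>\<close>; the lower bound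
  that they yield is positive.\<close>

lemma diophantine_imp_inner_nonzero:
  fixes \<alpha> :: "real^('m::finite option)"
  assumes K: "real_subfield K" and \<alpha>: "\<alpha> \<in> vecs K" "\<alpha> $ None = 1" and dio: "diophantine_over K \<alpha>"
    and n: "n \<in> int_pts" "n \<noteq> 0"
  shows "n \<bullet> \<alpha> \<noteq> 0"
proof -
  let ?e = "\<lambda>i::'m. axis (Some i) (1::real)"
  have "inj ?e" by (auto simp: inj_def axis_eq_axis)
  then have "card (range ?e) = CARD('m)" by (rule card_image)
  moreover have "range ?e \<subseteq> Basis" by (auto simp: Basis_vec_def)
  then have "independent (range ?e)" using independent_Basis independent_mono by blast
  moreover have "range ?e \<subseteq> vecs K" using K by (auto simp: vecs_def axis_def real_subfieldD)
  moreover have "axis None 1 \<bullet> \<alpha> \<noteq> 0" using \<alpha>(2) by (simp add: inner_axis')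
  moreover have "\<forall>v\<in>range ?e. v \<bullet> axis None 1 = 0" by (auto simp: inner_axis_axis)
  ultimately obtain \<gamma> c where c: "c > 0"
    "\<forall>n\<in>int_pts - {0}. \<bar>n \<bullet> \<alpha>\<bar> \<ge> c * norm n powr - \<gamma> * form_weight (range ?e) n"
    using diophantine_lower_bound[OF K \<alpha> dio, of "range ?e" "axis None 1"] by blast
  have "c * norm n powr - \<gamma> * form_weight (range ?e) n > 0"
    using c(1) n(2) form_weight_pos[of "range ?e" n] by simp
  then show ?thesis using c(2) n by force
qed

text \<open>\<open>A\<close> collects representatives of the facet normals up to scaling. The bound
  is uniform over the polytopes with normals from \<open>A\<close>, since neither the families
  \<open>\<V>\<close> nor the constant \<open>C1\<close> see the position of the facets.\<close>

lemma uniform_discrepancy_bound: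
  fixes \<alpha> :: "real^('m::finite option)"
  assumes K: "real_subfield K" and \<alpha>: "\<alpha> \<in> vecs K" "\<alpha> $ None = 1" and dio: "diophantine_over K \<alpha>"
    and A: "finite A" "A \<subseteq> vecs K" "\<And>a. a \<in> A \<Longrightarrow> a \<bullet> \<alpha> \<noteq> 0"
  shows "\<exists>C>0. \<forall>P s T. polytope P \<longrightarrow> P \<subseteq> cbox 0 1 \<longrightarrow> interior P \<noteq> {} \<longrightarrow>
    (\<forall>F. F facet_of P \<longrightarrow> (\<exists>\<nu>. normal_to \<nu> F \<and> \<nu> \<bullet> \<alpha> \<noteq> 0)) \<longrightarrow>
    (\<forall>\<nu>\<in>facet_normals P. \<exists>a\<in>A. \<exists>t. \<nu> = t *\<^sub>R a) \<longrightarrow> T > 0 \<longrightarrow> \<bar>discrepancy T s \<alpha> P\<bar> \<le> C"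
proof -
  have d: "CARD('m option) = Suc (CARD('m))" by simp
  obtain C1 \<V> where C1: "C1 \<ge> 0" and fV: "finite \<V>"
    and V: "\<forall>V\<in>\<V>. independent V \<and> card V = CARD('m) \<and> V \<subseteq> vecs K \<and> (\<exists>a\<in>A. a \<noteq> 0 \<and> (\<forall>v\<in>V. v \<bullet> a = 0))"
    and decay: "\<forall>I n. (\<forall>a\<in>A. is_interval (I a)) \<longrightarrow> strips A I \<subseteq> cbox 0 1 \<longrightarrow> n \<noteq> 0 \<longrightarrow>
         cmod (ft (strips A I) n) \<le> C1 / norm n * (\<Sum>V\<in>\<V>. form_weight V n)"
    using ft_strips_decay[OF K A(1,2) d] by blast
  define g where "g V n = 1 / norm n * form_weight V n / \<bar>n \<bullet> \<alpha>\<bar>" for V n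
  have sg: "g V summable_on (int_pts - {0})" if "V \<in> \<V>" for V
  proof -
    note V1 = bspec[OF V that]
    have V': "V \<subseteq> vecs K" "independent V" "card V = CARD('m)" using V1 by auto
    obtain a where a: "a \<in> A" "\<forall>v\<in>V. v \<bullet> a = 0" using V1 by blast
    obtain \<gamma> c where c: "0 \<le> \<gamma>" "\<gamma> < 1" "c > 0"
      "\<And>n. n \<in> int_pts - {0} \<Longrightarrow> \<bar>n \<bullet> \<alpha>\<bar> \<ge> c * norm n powr - \<gamma> * form_weight V n"
      using diophantine_lower_bound[OF K \<alpha> dio V' A(3)[OF a(1)] a(2)] by blast
    show ?thesis unfolding g_def
      by (rule summable_small_denominators[OF independent_imp_finite[OF V'(2)] c(1-3)]) (use c(4) in auto)
  qed
  define b where "b n = C1 * (\<Sum>V\<in>\<V>. g V n)" for n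
  have sb: "b summable_on (int_pts - {0})"
  proof -
    have "(\<lambda>n. \<Sum>V\<in>S. g V n) summable_on (int_pts - {0})" if "finite S" "S \<subseteq> \<V>" for S
      using that by (induction S rule: finite_induct) (auto intro!: summable_on_add sg)
    then show ?thesis unfolding b_def using fV by (intro summable_on_cmult_right) auto
  qed
  have b0: "b n \<ge> 0" for n unfolding b_def g_def using C1 by (intro mult_nonneg_nonneg sum_nonneg) auto
  \<comment> \<open>The sum may vanish; the added 1 makes \<open>C\<close> positive.\<close>
  define C where "C = infsum b (int_pts - {0}) + 1"
  have C: "C > 0" unfolding C_def using infsum_nonneg[of "int_pts - {0}" b] b0 by (simp add: add_nonneg_pos)
  have nz: "n \<bullet> \<alpha> \<noteq> 0" if "n \<in> int_pts" "n \<noteq> 0" for n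
    by (rule diophantine_imp_inner_nonzero[OF K \<alpha> dio that])
  have \<alpha>0: "\<alpha> $ i \<noteq> 0" for i
  proof -
    have "axis i 1 \<in> int_pts" by (auto simp: int_pts_def axis_def)
    then have "axis i 1 \<bullet> \<alpha> \<noteq> 0" by (rule nz) (simp add: axis_eq_0_iff)
    then show ?thesis by (simp add: inner_axis')
  qed
  have "\<bar>discrepancy T s \<alpha> P\<bar> \<le> C"
    if P: "polytope P" "P \<subseteq> cbox 0 1" "interior P \<noteq> {}"
      and F: "\<forall>F. F facet_of P \<longrightarrow> (\<exists>\<nu>. normal_to \<nu> F \<and> \<nu> \<bullet> \<alpha> \<noteq> 0)"
      and N: "\<forall>\<nu>\<in>facet_normals P. \<exists>a\<in>A. \<exists>t. \<nu> = t *\<^sub>R a" and T: "T > 0" for P s T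
  proof -
    let ?I = "\<lambda>a. (\<lambda>x. a \<bullet> x) ` P"
    have eq: "P = strips A ?I" by (rule polytope_eq_strips[OF P(1,3)]) (use N in blast)
    have conv: "convex P" by (rule polytope_imp_convex[OF P(1)])
    have I: "is_interval (?I a)" for a
      unfolding is_interval_connected_1
      by (intro connected_continuous_image convex_connected conv continuous_intros)
    have "\<bar>discrepancy T s \<alpha> P\<bar> \<le> infsum b (int_pts - {0})"
    proof (rule discrepancy_le_fourier_sum[OF _ P(2) _ nz _ sb T])
      show "P \<in> sets borel" using polytope_imp_closed[OF P(1)] by simp
      show "AE t in lborel. isCont (wrap P) (s + t *\<^sub>R \<alpha>)" for s
        by (rule AE_isCont_wrap_line[OF P(1,3) \<alpha>0]) (use F in blast)
      fix n :: "real^('m option)" assume n: "n \<in> int_pts" "n \<noteq> 0"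
      have "cmod (ft P (- n)) \<le> C1 / norm (- n) * (\<Sum>V\<in>\<V>. form_weight V (- n))"
        using decay[rule_format, of ?I "- n"] I P(2) n(2) eq by simp
      then have "cmod (ft P (- n)) / \<bar>n \<bullet> \<alpha>\<bar> \<le> C1 / norm n * (\<Sum>V\<in>\<V>. form_weight V n) / \<bar>n \<bullet> \<alpha>\<bar>"
        by (intro divide_right_mono) (simp_all add: form_weight_def)
      also have "\<dots> = b n" by (simp add: b_def g_def sum_distrib_left sum_divide_distrib)
      finally show "cmod (ft P (- n)) / \<bar>n \<bullet> \<alpha>\<bar> \<le> b n" .
    qed
    then show ?thesis by (simp add: C_def)
  qed
  then show ?thesis using C by blast
qed

theorem theorem3:
  "\<exists>C :: real^('m::finite option) \<Rightarrow> (real^('m option)) set \<Rightarrow> real.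
     (\<forall>\<alpha> N. C \<alpha> N > 0) \<and>
     (\<forall>K \<alpha> P.
        real_subfield K \<longrightarrow>
        (\<forall>i. \<alpha> $ i \<in> K) \<longrightarrow> \<alpha> $ None = 1 \<longrightarrow>
        diophantine_over K \<alpha> \<longrightarrow>
        polytope P \<longrightarrow> P \<subseteq> cbox 0 1 \<longrightarrow> interior P \<noteq> {} \<longrightarrow>
        (\<forall>F. F facet_of P \<longrightarrow> (\<exists>\<nu>. normal_to \<nu> F \<and> (\<forall>i. \<nu> $ i \<in> K) \<and> \<nu> \<bullet> \<alpha> \<noteq> 0)) \<longrightarrow>
        (\<forall>s\<in>cbox 0 1. \<forall>T>0. \<bar>discrepancy T s \<alpha> P\<bar> \<le> C \<alpha> (facet_normals P)))"
proof -
  define hyps where "hyps K \<alpha> P \<longleftrightarrow> real_subfield K \<and> (\<forall>i. \<alpha> $ i \<in> K) \<and> \<alpha> $ None = 1 \<and>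
        diophantine_over K \<alpha> \<and> polytope P \<and> P \<subseteq> cbox 0 1 \<and> interior P \<noteq> {} \<and>
        (\<forall>F. F facet_of P \<longrightarrow> (\<exists>\<nu>. normal_to \<nu> F \<and> (\<forall>i. \<nu> $ i \<in> K) \<and> \<nu> \<bullet> \<alpha> \<noteq> 0))"
    for K and \<alpha> :: "real^('m option)" and P
  have "\<exists>C>0. \<forall>K P s T. hyps K \<alpha> P \<longrightarrow> facet_normals P = N \<longrightarrow> T > 0 \<longrightarrow> \<bar>discrepancy T s \<alpha> P\<bar> \<le> C" for \<alpha> N
  proof (cases "\<exists>K P. hyps K \<alpha> P \<and> facet_normals P = N")
    case True
    then obtain K P0 where h: "hyps K \<alpha> P0" and N: "facet_normals P0 = N" by blast
    have K: "real_subfield K" and \<alpha>: "\<alpha> \<in> vecs K" "\<alpha> $ None = 1" and dio: "diophantine_over K \<alpha>"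
      and P0: "polytope P0" "interior P0 \<noteq> {}"
      using h by (auto simp: hyps_def vecs_def)
    obtain \<nu> where \<nu>: "\<And>F. F facet_of P0 \<Longrightarrow> normal_to (\<nu> F) F \<and> (\<forall>i. \<nu> F $ i \<in> K) \<and> \<nu> F \<bullet> \<alpha> \<noteq> 0"
      using h unfolding hyps_def by metis
    define A where "A = \<nu> ` {F. F facet_of P0}"
    have A: "finite A" "A \<subseteq> vecs K" "\<And>a. a \<in> A \<Longrightarrow> a \<bullet> \<alpha> \<noteq> 0"
      using \<nu> finite_polytope_facets[OF P0(1)] by (auto simp: A_def vecs_def)
    have par: "\<exists>a\<in>A. \<exists>t. \<mu> = t *\<^sub>R a" if \<mu>: "\<mu> \<in> N" for \<mu>
    proof -
      obtain F where F: "F facet_of P0" "normal_to \<mu> F" using \<mu> N by (auto simp: facet_normals_def)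
      then show ?thesis using facet_normals_parallel[OF P0(2) F(1,2)] \<nu>[OF F(1)] by (auto simp: A_def)
    qed
    obtain C where C: "C > 0" "\<forall>P s T. polytope P \<longrightarrow> P \<subseteq> cbox 0 1 \<longrightarrow> interior P \<noteq> {} \<longrightarrow>
      (\<forall>F. F facet_of P \<longrightarrow> (\<exists>\<nu>. normal_to \<nu> F \<and> \<nu> \<bullet> \<alpha> \<noteq> 0)) \<longrightarrow>
      (\<forall>\<nu>\<in>facet_normals P. \<exists>a\<in>A. \<exists>t. \<nu> = t *\<^sub>R a) \<longrightarrow> T > 0 \<longrightarrow> \<bar>discrepancy T s \<alpha> P\<bar> \<le> C"
      using uniform_discrepancy_bound[OF K \<alpha> dio A] by blast
    have "\<bar>discrepancy T s \<alpha> P\<bar> \<le> C"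
      if P: "hyps K' \<alpha> P" "facet_normals P = N" and T: "T > 0" for K' P s T
    proof (rule C(2)[rule_format])
      show "\<exists>\<nu>. normal_to \<nu> F \<and> \<nu> \<bullet> \<alpha> \<noteq> 0" if "F facet_of P" for F
        using P(1) that unfolding hyps_def by blast
      show "\<exists>a\<in>A. \<exists>t. \<mu> = t *\<^sub>R a" if "\<mu> \<in> facet_normals P" for \<mu>
        using par that P(2) by blast
    qed (use P(1) T in \<open>auto simp: hyps_def\<close>)
    then show ?thesis using C(1) by blast
  next
    case False
    then show ?thesis by (intro exI[of _ 1]) auto
  qed
  then obtain C where C: "\<And>\<alpha> N. C \<alpha> N > 0"
    "\<And>\<alpha> N K P s T. hyps K \<alpha> P \<Longrightarrow> facet_normals P = N \<Longrightarrow> T > 0 \<Longrightarrow> \<bar>discrepancy T s \<alpha> P\<bar> \<le> C \<alpha> N"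
    by metis
  show ?thesis
  proof (intro exI[of _ C] conjI allI impI ballI)
    show "C \<alpha> N > 0" for \<alpha> N by (rule C(1))
  next
    fix K P s and T :: real and \<alpha> :: "real^('m option)"
    assume "real_subfield K" "\<forall>i. \<alpha> $ i \<in> K" "\<alpha> $ None = 1" "diophantine_over K \<alpha>"
      "polytope P" "P \<subseteq> cbox 0 1" "interior P \<noteq> {}"
      "\<forall>F. F facet_of P \<longrightarrow> (\<exists>\<nu>. normal_to \<nu> F \<and> (\<forall>i. \<nu> $ i \<in> K) \<and> \<nu> \<bullet> \<alpha> \<noteq> 0)"
    then have "hyps K \<alpha> P" unfolding hyps_def by blast
    moreover assume "T > 0"
    ultimately show "\<bar>discrepancy T s \<alpha> P\<bar> \<le> C \<alpha> (facet_normals P)" using C(2) by blast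
  qed
qed

end
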